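(* The adjunction $(-)_{\le1}:\mathbf{Cpx}\rightleftarrows\mathbf{Gr}:\mathrm{C}\ell$, with $\mathbf{Cpx}$ carrying the Thomason model structure and $\mathbf{Gr}$ the Matsushita model structure, is a Quillen equivalence.
   Context: A simplicial complex $K$ consists of a set $V(K)$ and a collection of nonempty finite subsets (simplices) containing all singletons and closed under nonempty subsets; maps are vertex functions sending simplices to simplices; $\mathbf{Cpx}$ is the category. $\mathbf{Gr}$ (reflexive graphs) is the full subcategory of complexes all of whose simplices have at most two elements. $\mathrm{C}\ell:\mathbf{Gr}\to\mathbf{Cpx}$ is the clique complex functor, with left adjoint the 1-skeleton functor $(-)_{\le1}$. $\mathbf{\Delta}^n$ is the complex on $\{0,\dots,n\}$ with all nonempty subsets simplices, $\mathrm{Sing}(K)_n=\mathbf{Cpx}(\mathbf{\Delta}^n,K)$, and $\mathrm{Ex}$ is the right adjoint of barycentric subdivision. Thomason model structure on $\mathbf{Cpx}$: $f$ is a weak equivalence iff $\mathrm{Sing}(f)$ is a weak homotopy equivalence, a fibration iff $\mathrm{Ex}^2\mathrm{Sing}(f)$ is a Kan fibration, cofibrations are maps with the left lifting property against trivial fibrations. Matsushita model structure on $\mathbf{Gr}$: $f$ is a weak equivalence (fibration) iff $\mathrm{C}\ell(f)$ is a Thomason weak equivalence (fibration), cofibrations defined by left lifting against trivial fibrations. *)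

theory Defs
  imports "HOL-Analysis.Analysis" "HOL-Homology.Simplices"
begin

text \<open>A simplicial complex with vertices in type 'a is represented by its set of
simplices; its vertex set is the union of its simplices (all singletons are simplices).\<close>

definition complex :: "'a set set \<Rightarrow> bool" where
  "complex K \<longleftrightarrow> (\<forall>s\<in>K. finite s \<and> s \<noteq> {}) \<and>
                  (\<forall>s\<in>K. \<forall>t. t \<subseteq> s \<and> t \<noteq> {} \<longrightarrow> t \<in> K)"

definition verts :: "'a set set \<Rightarrow> 'a set" where
  "verts K = \<Union>K"

text \<open>Maps of complexes: vertex functions sending simplices to simplices
(only the values on vertices matter).\<close>
definition cpx_map :: "'a set set \<Rightarrow> 'b set set \<Rightarrow> ('a \<Rightarrow> 'b) \<Rightarrow> bool" where
  "cpx_map K L f \<longleftrightarrow> (\<forall>s\<in>K. f ` s \<in> L)"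

definition graph :: "'a set set \<Rightarrow> bool" where
  "graph G \<longleftrightarrow> complex G \<and> (\<forall>s\<in>G. card s \<le> 2)"

definition Cl :: "'a set set \<Rightarrow> 'a set set" where
  "Cl G = {s. finite s \<and> s \<noteq> {} \<and> s \<subseteq> verts G \<and>
              (\<forall>u\<in>s. \<forall>v\<in>s. {u, v} \<in> G)}"

definition skel1 :: "'a set set \<Rightarrow> 'a set set" where
  "skel1 K = {s\<in>K. card s \<le> 2}"

definition delta_mor :: "nat \<Rightarrow> nat \<Rightarrow> (nat \<Rightarrow> nat) \<Rightarrow> bool" where
  "delta_mor m n \<theta> \<longleftrightarrow> (\<forall>i\<le>m. \<theta> i \<le> n) \<and> (\<forall>i j. i \<le> j \<and> j \<le> m \<longrightarrow> \<theta> i \<le> \<theta> j)"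

definition coface :: "nat \<Rightarrow> nat \<Rightarrow> nat" where
  "coface i j = (if j < i then j else Suc j)"

text \<open>A simplicial set is given by sets X n of n-simplices and an action
act m n \<theta> : X n \<rightarrow> X m for \<theta> : [m] \<rightarrow> [n]; a simplicial map is a degreewise map
p n : X n \<rightarrow> Y n.  Kan fibration: right lifting property against all horn
inclusions, horns \<Lambda>^n_k \<rightarrow> E being described by compatible families of faces.\<close>
definition kan_fibration ::
  "(nat \<Rightarrow> 'x set) \<Rightarrow> (nat \<Rightarrow> nat \<Rightarrow> (nat \<Rightarrow> nat) \<Rightarrow> 'x \<Rightarrow> 'x) \<Rightarrow>
   (nat \<Rightarrow> 'y set) \<Rightarrow> (nat \<Rightarrow> nat \<Rightarrow> (nat \<Rightarrow> nat) \<Rightarrow> 'y \<Rightarrow> 'y) \<Rightarrow>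
   (nat \<Rightarrow> 'x \<Rightarrow> 'y) \<Rightarrow> bool" where
  "kan_fibration E actE B actB p \<longleftrightarrow>
     (\<forall>n k y b. 1 \<le> n \<and> k \<le> n \<and>
        (\<forall>i\<le>n. i \<noteq> k \<longrightarrow> y i \<in> E (n - 1)) \<and>
        (\<forall>i j. i < j \<and> j \<le> n \<and> i \<noteq> k \<and> j \<noteq> k \<longrightarrow>
            actE (n - 2) (n - 1) (coface i) (y j) = actE (n - 2) (n - 1) (coface (j - 1)) (y i)) \<and>
        b \<in> B n \<and>
        (\<forall>i\<le>n. i \<noteq> k \<longrightarrow> actB (n - 1) n (coface i) b = p (n - 1) (y i))
      \<longrightarrow> (\<exists>x\<in>E n. p n x = b \<and>
             (\<forall>i\<le>n. i \<noteq> k \<longrightarrow> actE (n - 1) n (coface i) x = y i)))"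

definition push_simplex :: "nat \<Rightarrow> (nat \<Rightarrow> nat) \<Rightarrow> (nat \<Rightarrow> real) \<Rightarrow> (nat \<Rightarrow> real)" where
  "push_simplex m \<theta> t = (\<lambda>j. \<Sum>i\<in>{i. i \<le> m \<and> \<theta> i = j}. t i)"

definition real_points :: "(nat \<Rightarrow> 'x set) \<Rightarrow> (nat \<times> 'x \<times> (nat \<Rightarrow> real)) set" where
  "real_points X = {(n, x, t). x \<in> X n \<and> t \<in> standard_simplex n}"

definition real_base ::
  "(nat \<Rightarrow> 'x set) \<Rightarrow> (nat \<Rightarrow> nat \<Rightarrow> (nat \<Rightarrow> nat) \<Rightarrow> 'x \<Rightarrow> 'x) \<Rightarrow>
   ((nat \<times> 'x \<times> (nat \<Rightarrow> real)) \<times> (nat \<times> 'x \<times> (nat \<Rightarrow> real))) set" where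
  "real_base X act = {((m, act m n \<theta> x, t), (n, x, push_simplex m \<theta> t)) | m n \<theta> x t.
       delta_mor m n \<theta> \<and> x \<in> X n \<and> t \<in> standard_simplex m}"

definition real_rel ::
  "(nat \<Rightarrow> 'x set) \<Rightarrow> (nat \<Rightarrow> nat \<Rightarrow> (nat \<Rightarrow> nat) \<Rightarrow> 'x \<Rightarrow> 'x) \<Rightarrow>
   ((nat \<times> 'x \<times> (nat \<Rightarrow> real)) \<times> (nat \<times> 'x \<times> (nat \<Rightarrow> real))) set" where
  "real_rel X act = (real_base X act \<union> (real_base X act)\<inverse>)\<^sup>* \<inter> (real_points X \<times> real_points X)"

definition realization ::
  "(nat \<Rightarrow> 'x set) \<Rightarrow> (nat \<Rightarrow> nat \<Rightarrow> (nat \<Rightarrow> nat) \<Rightarrow> 'x \<Rightarrow> 'x) \<Rightarrow>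
   (nat \<times> 'x \<times> (nat \<Rightarrow> real)) set topology" where
  "realization X act = topology (\<lambda>U. U \<subseteq> real_points X // real_rel X act \<and>
      (\<forall>n x. x \<in> X n \<longrightarrow>
         openin (subtopology (powertop_real UNIV) (standard_simplex n))
           {t \<in> standard_simplex n. real_rel X act `` {(n, x, t)} \<in> U}))"

definition realization_map ::
  "(nat \<Rightarrow> 'y set) \<Rightarrow> (nat \<Rightarrow> nat \<Rightarrow> (nat \<Rightarrow> nat) \<Rightarrow> 'y \<Rightarrow> 'y) \<Rightarrow> (nat \<Rightarrow> 'x \<Rightarrow> 'y) \<Rightarrow>
   (nat \<times> 'x \<times> (nat \<Rightarrow> real)) set \<Rightarrow> (nat \<times> 'y \<times> (nat \<Rightarrow> real)) set" where
  "realization_map Y actY g c =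
     (case SOME p. p \<in> c of (n, x, t) \<Rightarrow> real_rel Y actY `` {(n, g n x, t)})"

definition sphere_base :: "nat \<Rightarrow> real" where
  "sphere_base = (\<lambda>i. if i = 0 then 1 else 0)"

definition weak_homotopy_equivalence :: "'a topology \<Rightarrow> 'b topology \<Rightarrow> ('a \<Rightarrow> 'b) \<Rightarrow> bool" where
  "weak_homotopy_equivalence X Y f \<longleftrightarrow>
     continuous_map X Y f \<and>
     (\<forall>y\<in>topspace Y. \<exists>x\<in>topspace X. path_component_of Y (f x) y) \<and>
     (\<forall>x1\<in>topspace X. \<forall>x2\<in>topspace X.
        path_component_of Y (f x1) (f x2) \<longrightarrow> path_component_of X x1 x2) \<and>
     (\<forall>n\<ge>1. \<forall>x\<in>topspace X.
        (\<forall>g1 g2. continuous_map (nsphere n) X g1 \<and> g1 sphere_base = x \<and>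
                 continuous_map (nsphere n) X g2 \<and> g2 sphere_base = x \<and>
                 homotopic_with (\<lambda>h. h sphere_base = f x) (nsphere n) Y (f \<circ> g1) (f \<circ> g2)
                 \<longrightarrow> homotopic_with (\<lambda>h. h sphere_base = x) (nsphere n) X g1 g2) \<and>
        (\<forall>h. continuous_map (nsphere n) Y h \<and> h sphere_base = f x \<longrightarrow>
             (\<exists>g. continuous_map (nsphere n) X g \<and> g sphere_base = x \<and>
                  homotopic_with (\<lambda>h'. h' sphere_base = f x) (nsphere n) Y (f \<circ> g) h)))"

text \<open>Sing(K)_n = Cpx(\<Delta>^n, K): an n-simplex is a tuple (v_0,...,v_n) of vertices
(a list of length n+1) whose set of entries is a simplex of K.\<close>
definition Sing :: "'a set set \<Rightarrow> nat \<Rightarrow> 'a list set" where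
  "Sing K n = {xs. length xs = Suc n \<and> set xs \<in> K}"

definition Sing_act :: "nat \<Rightarrow> nat \<Rightarrow> (nat \<Rightarrow> nat) \<Rightarrow> 'a list \<Rightarrow> 'a list" where
  "Sing_act m n \<theta> xs = map (\<lambda>i. xs ! \<theta> i) [0..<Suc m]"

definition Sing_map :: "('a \<Rightarrow> 'b) \<Rightarrow> nat \<Rightarrow> 'a list \<Rightarrow> 'b list" where
  "Sing_map f n xs = map f xs"

definition sd2_verts :: "nat \<Rightarrow> nat set set set" where
  "sd2_verts n = {c. c \<noteq> {} \<and> (\<forall>S\<in>c. S \<noteq> {} \<and> S \<subseteq> {..n}) \<and>
                     (\<forall>S\<in>c. \<forall>T\<in>c. S \<subseteq> T \<or> T \<subseteq> S)}"

text \<open>(Ex^2 Sing K)_n = sSet(sd^2 \<Delta>^n, Sing K).  Since sd^2 \<Delta>^n is the nerve of the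
poset of chains of nonempty subsets of [n] and maps into Sing K are exactly vertex maps
sending (vertex sets of) simplices to simplices of K, an n-simplex is a function on
sd2_verts n sending every chain of chains to a simplex of K (extensional outside).\<close>
definition Ex2Sing :: "'a set set \<Rightarrow> nat \<Rightarrow> (nat set set \<Rightarrow> 'a) set" where
  "Ex2Sing K n = {g. (\<forall>c. c \<notin> sd2_verts n \<longrightarrow> g c = undefined) \<and>
      (\<forall>C. C \<noteq> {} \<and> C \<subseteq> sd2_verts n \<and> (\<forall>c\<in>C. \<forall>d\<in>C. c \<subseteq> d \<or> d \<subseteq> c)
           \<longrightarrow> g ` C \<in> K)}"

text \<open>Action of \<theta> : [m] \<rightarrow> [n]: precomposition with sd^2 \<theta>, which on vertices sends a
chain c to the chain of images {\<theta> ` S | S \<in> c}.\<close>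
definition Ex2Sing_act :: "nat \<Rightarrow> nat \<Rightarrow> (nat \<Rightarrow> nat) \<Rightarrow> (nat set set \<Rightarrow> 'a) \<Rightarrow> (nat set set \<Rightarrow> 'a)" where
  "Ex2Sing_act m n \<theta> g = (\<lambda>c. if c \<in> sd2_verts m then g ((\<lambda>S. \<theta> ` S) ` c) else undefined)"

definition Ex2Sing_map :: "('a \<Rightarrow> 'b) \<Rightarrow> nat \<Rightarrow> (nat set set \<Rightarrow> 'a) \<Rightarrow> (nat set set \<Rightarrow> 'b)" where
  "Ex2Sing_map f n g = (\<lambda>c. if c \<in> sd2_verts n then f (g c) else undefined)"

definition cpx_weq :: "'a set set \<Rightarrow> 'b set set \<Rightarrow> ('a \<Rightarrow> 'b) \<Rightarrow> bool" where
  "cpx_weq K L f \<longleftrightarrow>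
     weak_homotopy_equivalence (realization (Sing K) Sing_act) (realization (Sing L) Sing_act)
       (realization_map (Sing L) Sing_act (Sing_map f))"

definition cpx_fib :: "'a set set \<Rightarrow> 'b set set \<Rightarrow> ('a \<Rightarrow> 'b) \<Rightarrow> bool" where
  "cpx_fib K L f \<longleftrightarrow>
     kan_fibration (Ex2Sing K) Ex2Sing_act (Ex2Sing L) Ex2Sing_act (Ex2Sing_map f)"

definition cpx_trivfib :: "'a set set \<Rightarrow> 'b set set \<Rightarrow> ('a \<Rightarrow> 'b) \<Rightarrow> bool" where
  "cpx_trivfib K L f \<longleftrightarrow> cpx_fib K L f \<and> cpx_weq K L f"

definition cpx_cofibrant :: "'a set set \<Rightarrow> bool" where
  "cpx_cofibrant K \<longleftrightarrow>
     (\<forall>(E :: ('a + nat) set set) (B :: ('a + nat) set set) p g.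
        complex E \<and> complex B \<and> cpx_map E B p \<and> cpx_trivfib E B p \<and> cpx_map K B g
        \<longrightarrow> (\<exists>h. cpx_map K E h \<and> (\<forall>v\<in>verts K. p (h v) = g v)))"

definition gr_weq :: "'a set set \<Rightarrow> 'b set set \<Rightarrow> ('a \<Rightarrow> 'b) \<Rightarrow> bool" where
  "gr_weq G H f \<longleftrightarrow> cpx_weq (Cl G) (Cl H) f"

definition gr_fib :: "'a set set \<Rightarrow> 'b set set \<Rightarrow> ('a \<Rightarrow> 'b) \<Rightarrow> bool" where
  "gr_fib G H f \<longleftrightarrow> cpx_fib (Cl G) (Cl H) f"

definition gr_fibrant :: "'a set set \<Rightarrow> bool" where
  "gr_fibrant G \<longleftrightarrow> gr_fib G {{()}} (\<lambda>_. ())"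

end

theory Submission
  imports Defs
begin

text \<open>Only the comparison of \<open>K \<rightarrow> Cl G\<close> with \<open>Cl (skel1 K) \<rightarrow> Cl G\<close> is not formal, and for it one needs that
  \<open>K \<rightarrow> Cl (skel1 K)\<close> is a weak equivalence when \<open>K\<close> is cofibrant, although such a \<open>K\<close> need not be
  flag.  Start from a flag complex \<open>A\<close> over \<open>K\<close>, a blow-up of the barycentric subdivision homotopy
  equivalent to \<open>K\<close>, and freely glue on double subdivisions of simplices along double subdivisions of
  horns to obtain a trivial fibration \<open>Q \<rightarrow> K\<close>.  Deforming the cells one level of nesting at a
  time by maps that are determined on edges shows that both \<open>Q\<close> and \<open>Cl (skel1 Q)\<close> retract strongly
  onto \<open>A\<close>, so that \<open>Q \<rightarrow> Cl (skel1 Q)\<close> is a homotopy equivalence.  Cofibrancy gives a section of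
  \<open>Q \<rightarrow> K\<close>, which makes \<open>K \<rightarrow> Cl (skel1 K)\<close> a retract of \<open>Q \<rightarrow> Cl (skel1 Q)\<close>.\<close>

section \<open>Weak homotopy equivalences\<close>

text \<open>\<open>cpx_weq\<close> refers to the realization of \<open>Sing K\<close>, which has a
  simplex for every tuple with repetitions; weak equivalences are therefore moved to
  \<open>geo K\<close>, where deformations are given by moving mass between vertices. Two obstacles
  shape the rest. The retractions of a cell are not contiguous to the identity, and a homotopy on
  \<open>Q\<close> says nothing about the cliques of \<open>Q\<close>. Both are met by moving the
  vertices of a simplex one after the other: the sets \<open>mixed\<close> that then have to be
  simplices are smaller than contiguity asks for, and each pair in one of them already occurs over
  an edge. The double subdivision is forced by the definition of fibrations through
  \<open>Ex2Sing\<close>. It also separates: a chain disjoint from the horn is never adjacent to a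
  vertex of the horn, so that the part of a cell which no vertex map can remove is isolated and can
  be pushed off by a topological homotopy (\<open>sdr_push\<close>). Cells are glued along horns
  only, which solves all lifting problems and keeps the homotopy type of \<open>A\<close>. As
  cofibrancy is tested on complexes with vertices in \<open>'a + nat\<close>, the vertices of
  \<open>Q\<close> are finally coded in that type.\<close>

abbreviation unit_interval :: "real topology" where
  "unit_interval \<equiv> top_of_set {0..1}"

lemma sphere_base_in_nsphere: "sphere_base \<in> topspace (nsphere n)"
  unfolding sphere_base_def by (rule in_topspace_nsphere)

lemma continuous_map_unit_interval:
  "continuous_map X unit_interval f \<longleftrightarrow>
     continuous_map X euclideanreal f \<and> (\<forall>x\<in>topspace X. 0 \<le> f x \<and> f x \<le> 1)"
  by (auto simp: continuous_map_in_subtopology)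

text \<open>The segment from \<open>z\<close> to the base point is followed up to the fraction
  \<open>\<mu> (z 0)\<close> and normalised. This fraction is 0 for \<open>z 0 \<le> 0\<close>, so
  that the segment cannot run into the origin, and 1 on the cap
  \<open>1/2 \<le> z 0\<close>.\<close>

lemma nsphere_collapse:
  obtains \<Phi> where
    "continuous_map (prod_topology unit_interval (nsphere n)) (nsphere n) \<Phi>"
    "\<And>z. z \<in> topspace (nsphere n) \<Longrightarrow> \<Phi> (0, z) = z"
    "\<And>s. s \<in> {0..1} \<Longrightarrow> \<Phi> (s, sphere_base) = sphere_base"
    "\<And>z. z \<in> topspace (nsphere n) \<Longrightarrow> 1/2 \<le> z 0 \<Longrightarrow> \<Phi> (1, z) = sphere_base"
proof -
  define \<mu> :: "real \<Rightarrow> real" where "\<mu> r = max 0 (min 1 (2 * r))" for r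
  define w where "w p i = (1 - fst p * \<mu> (snd p 0)) * snd p i + fst p * \<mu> (snd p 0) * sphere_base i"
    for p :: "real \<times> (nat \<Rightarrow> real)" and i
  define N where "N p = sqrt (\<Sum>i\<le>n. (w p i)\<^sup>2)" for p
  define \<Phi> where "\<Phi> p = (\<lambda>i. w p i / N p)" for p
  have \<mu>01: "0 \<le> \<mu> r" "\<mu> r \<le> 1" for r
    by (auto simp: \<mu>_def)
  have mem: "z \<in> topspace (nsphere n) \<longleftrightarrow> (\<Sum>i\<le>n. (z i)\<^sup>2) = 1 \<and> (\<forall>i>n. z i = 0)" for z
    by (simp add: nsphere)
  have Npos: "N (s, z) > 0" if s: "s \<in> {0..1}" and z: "z \<in> topspace (nsphere n)" for s z
  proof (cases "z 0 \<le> 0")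
    case True
    then have "w (s, z) i = z i" for i
      by (simp add: w_def \<mu>_def)
    then show ?thesis using z by (simp add: N_def mem)
  next
    case False
    have le1: "s * \<mu> (z 0) \<le> 1" "0 \<le> s * \<mu> (z 0)"
      using s \<mu>01[of "z 0"] by (auto simp: mult_le_one)
    \<comment> \<open>For \<open>z 0 > 0\<close> both ends of the segment have positive zeroth
      coordinate.\<close>
    have "w (s, z) 0 > 0"
    proof (cases "s * \<mu> (z 0) = 1")
      case True
      then show ?thesis by (simp add: w_def sphere_base_def)
    next
      case ne: False
      then have "(1 - s * \<mu> (z 0)) * z 0 > 0"
        using le1 False by simp
      then show ?thesis using le1 by (simp add: w_def sphere_base_def)
    qed
    then have "(w (s, z) 0)\<^sup>2 > 0" by simp
    then have "(\<Sum>i\<le>n. (w (s, z) i)\<^sup>2) > 0"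
      by (intro sum_pos2[where i = 0]) auto
    then show ?thesis by (simp add: N_def)
  qed
  let ?P = "prod_topology unit_interval (nsphere n)"
  have c1: "continuous_map ?P euclideanreal (\<lambda>p. snd p i)" for i
    using continuous_map_compose[OF continuous_map_snd continuous_map_nsphere_projection, of unit_interval n i]
    by (simp add: o_def)
  have c0: "continuous_map ?P euclideanreal fst"
    using continuous_map_fst[of unit_interval "nsphere n"] by (auto simp: continuous_map_in_subtopology)
  have cw: "continuous_map ?P euclideanreal (\<lambda>p. w p i)" for i
    unfolding w_def \<mu>_def
    by (intro continuous_intros continuous_map_real_max continuous_map_real_min c1 c0; simp)
  have cN: "continuous_map ?P euclideanreal N"
    unfolding N_def
    by (intro continuous_map_sqrt continuous_map_sum continuous_map_real_pow cw) auto
  have sumw: "(\<Sum>i\<le>n. (\<Phi> (s, z) i)\<^sup>2) = 1" if "N (s,z) > 0" for s z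
  proof -
    have "(N (s,z))\<^sup>2 = (\<Sum>i\<le>n. (w (s,z) i)\<^sup>2)"
      by (simp add: N_def sum_nonneg)
    then show ?thesis using that
      by (simp add: \<Phi>_def power_divide flip: sum_divide_distrib) (metis less_irrefl zero_eq_power2)
  qed
  have wbig: "w (s, z) i = 0" if "i > n" "z \<in> topspace (nsphere n)" for s z i
    using that by (simp add: w_def mem sphere_base_def)
  have base1: "(\<Sum>i\<le>n. (sphere_base i)\<^sup>2) = 1"
    using sphere_base_in_nsphere[of n] mem by blast
  show thesis
  proof
    show "continuous_map ?P (nsphere n) \<Phi>"
      unfolding nsphere
    proof (subst continuous_map_in_subtopology, intro conjI)
      have "N x \<noteq> 0" if "x \<in> topspace ?P" for x
        using Npos[of "fst x" "snd x"] that by auto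
      then show "continuous_map (prod_topology unit_interval (subtopology (powertop_real UNIV) {x. (\<Sum>i\<le>n. (x i)\<^sup>2) = 1 \<and> (\<forall>i>n. x i = 0)})) (powertop_real UNIV) \<Phi>"
        unfolding continuous_map_componentwise_UNIV \<Phi>_def nsphere[symmetric]
        by (intro allI continuous_map_real_divide cw cN)
      show "\<Phi> \<in> topspace (prod_topology unit_interval (subtopology (powertop_real UNIV) {x. (\<Sum>i\<le>n. (x i)\<^sup>2) = 1 \<and> (\<forall>i>n. x i = 0)})) \<rightarrow> {x. (\<Sum>i\<le>n. (x i)\<^sup>2) = 1 \<and> (\<forall>i>n. x i = 0)}"
        unfolding nsphere[symmetric]
        using sumw Npos wbig by (force simp: \<Phi>_def)
    qed
    show "\<Phi> (0, z) = z" if "z \<in> topspace (nsphere n)" for z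
      using that by (simp add: \<Phi>_def w_def N_def mem)
    show "\<Phi> (s, sphere_base) = sphere_base" if "s \<in> {0..1}" for s
    proof -
      have "w (s, sphere_base) i = sphere_base i" for i
        by (simp add: w_def algebra_simps)
      then show ?thesis by (simp add: \<Phi>_def N_def base1)
    qed
    show "\<Phi> (1, z) = sphere_base" if "z \<in> topspace (nsphere n)" "1/2 \<le> z 0" for z
    proof -
      have "w (1, z) i = sphere_base i" for i
        using that by (simp add: w_def \<mu>_def)
      then show ?thesis by (simp add: \<Phi>_def N_def base1)
    qed
  qed
qed

lemma continuous_map_pair_interval:
  assumes "continuous_map (prod_topology unit_interval S) Y k" "continuous_map Z unit_interval a"
    "continuous_map Z S b"
  shows "continuous_map Z Y (\<lambda>z. k (a z, b z))"
  using continuous_map_compose[OF continuous_map_pairedI[OF assms(2,3)] assms(1)]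
  by (simp add: o_def)

text \<open>A free homotopy of spheres is traded for a based one by letting the trace of the base
  point run over the cap \<open>1/2 \<le> z 0\<close>, the rest of the sphere being stretched over it.\<close>

lemma free_homotopy_cap:
  assumes \<Phi>: "continuous_map (prod_topology unit_interval (nsphere n)) (nsphere n) \<Phi>"
    "\<And>z. z \<in> topspace (nsphere n) \<Longrightarrow> \<Phi> (0, z) = z"
    "\<And>s. s \<in> {0..1} \<Longrightarrow> \<Phi> (s, sphere_base) = sphere_base"
    "\<And>z. z \<in> topspace (nsphere n) \<Longrightarrow> 1/2 \<le> z 0 \<Longrightarrow> \<Phi> (1, z) = sphere_base"
    and k: "continuous_map (prod_topology unit_interval (nsphere n)) Y k"
  shows "homotopic_with (\<lambda>h. h sphere_base = k (1, sphere_base)) (nsphere n) Y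
      (\<lambda>z. if z 0 \<le> 1/2 then k (0, \<Phi> (1, z)) else k (2 * z 0 - 1, sphere_base))
      (\<lambda>z. k (1, z))"
proof (rule homotopic_with_trans)
  let ?S = "nsphere n" and ?b = sphere_base
  let ?P = "prod_topology unit_interval (nsphere n)"
  have c1: "continuous_map ?P euclideanreal (\<lambda>p. snd p i)" for i
    using continuous_map_compose[OF continuous_map_snd continuous_map_nsphere_projection, of unit_interval n i]
    by (simp add: o_def)
  have c0: "continuous_map ?P euclideanreal fst" and c01: "continuous_map ?P unit_interval fst"
    using continuous_map_fst[of unit_interval "nsphere n"] by (auto simp: continuous_map_in_subtopology)
  have b: "?b \<in> topspace ?S" by (rule sphere_base_in_nsphere)
  have b0: "?b 0 = 1" by (simp add: sphere_base_def)
  have z01: "z 0 \<le> 1" if "z \<in> topspace ?S" for z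
  proof -
    have "(z 0)\<^sup>2 \<le> (\<Sum>i\<le>n. (z i)\<^sup>2)" by (rule member_le_sum) auto
    also have "\<dots> = 1" using that by (simp add: nsphere)
    finally show ?thesis by (simp add: abs_square_le_1 abs_le_iff)
  qed
  show "homotopic_with (\<lambda>h. h ?b = k (1, ?b)) ?S Y
      (\<lambda>z. if z 0 \<le> 1/2 then k (0, \<Phi> (1, z)) else k (2 * z 0 - 1, ?b)) (\<lambda>z. k (1, \<Phi> (1, z)))"
  proof (subst homotopic_with)
    show "(h ?b = k (1, ?b)) = (k' ?b = k (1, ?b))" if "\<And>x. x \<in> topspace ?S \<Longrightarrow> h x = k' x" for h k'
      using that b by simp
    \<comment> \<open>At parameter \<open>s\<close> the outer part has advanced to time
      \<open>s\<close> of \<open>k\<close> and the cap carries only the trace over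
      \<open>[s, 1]\<close>. At \<open>z 0 = 1/2\<close> both clauses give
      \<open>k (s, sphere_base)\<close>; at the base point, where \<open>z 0 = 1\<close>, the value
      is always \<open>k (1, sphere_base)\<close>.\<close>
    let ?h = "\<lambda>p. if snd p 0 \<le> 1/2 then k (fst p, \<Phi> (1, snd p))
                  else k (fst p + (1 - fst p) * (2 * snd p 0 - 1), ?b)"
    have "continuous_map ?P Y ?h"
    proof (rule continuous_map_cases_le)
      show "continuous_map ?P euclideanreal (\<lambda>p. snd p 0)" by (rule c1)
      show "continuous_map ?P euclideanreal (\<lambda>p. 1/2)" by simp
      have "continuous_map ?P Y (\<lambda>p. k (fst p, \<Phi> (1, snd p)))"
        by (intro continuous_map_pair_interval[OF k] c01 continuous_map_pair_interval[OF \<Phi>(1)] continuous_map_snd) auto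
      then show "continuous_map (subtopology ?P {x \<in> topspace ?P. snd x 0 \<le> 1/2}) Y (\<lambda>p. k (fst p, \<Phi> (1, snd p)))"
        by (rule continuous_map_from_subtopology)
      let ?P' = "subtopology ?P {x \<in> topspace ?P. 1/2 \<le> snd x 0}"
      show "continuous_map ?P' Y (\<lambda>p. k (fst p + (1 - fst p) * (2 * snd p 0 - 1), ?b))"
      proof (intro continuous_map_pair_interval[OF k])
        have "continuous_map ?P euclideanreal (\<lambda>p. fst p + (1 - fst p) * (2 * snd p 0 - 1))"
          by (intro continuous_intros c1 c0; simp)
        moreover have "0 \<le> s + (1 - s) * (2 * z 0 - 1) \<and> s + (1 - s) * (2 * z 0 - 1) \<le> 1"
          if "z \<in> topspace ?S" "0 \<le> s" "s \<le> 1" "1/2 \<le> z 0" for s z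
        proof -
          have "0 \<le> (1 - s) * (2 * z 0 - 1)" "(1 - s) * (2 * z 0 - 1) \<le> 1 - s"
            using z01[OF that(1)] that by (auto intro!: mult_left_le)
          then show ?thesis using that by linarith
        qed
        ultimately show "continuous_map ?P' unit_interval (\<lambda>p. fst p + (1 - fst p) * (2 * snd p 0 - 1))"
          unfolding continuous_map_unit_interval by (auto intro: continuous_map_from_subtopology)
        show "continuous_map ?P' ?S (\<lambda>p. ?b)" using b by simp
      qed
      show "k (fst p, \<Phi> (1, snd p)) = k (fst p + (1 - fst p) * (2 * snd p 0 - 1), ?b)"
        if "p \<in> topspace ?P" "snd p 0 = 1/2" for p
      proof -
        have "2 * snd p 0 - 1 = 0" using that by simp
        moreover have "\<Phi> (1, snd p) = ?b" using that \<Phi>(4)[of "snd p"] by auto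
        ultimately show ?thesis by simp
      qed
    qed
    moreover have "k (1, \<Phi> (1, z)) = k (1, ?b)" if "z \<in> topspace ?S" "\<not> z 0 \<le> 1/2" for z
      using \<Phi>(4)[of z] that by simp
    ultimately show "\<exists>h. continuous_map ?P Y h \<and>
        (\<forall>z\<in>topspace ?S. h (0, z) = (if z 0 \<le> 1/2 then k (0, \<Phi> (1, z)) else k (2 * z 0 - 1, ?b))) \<and>
        (\<forall>z\<in>topspace ?S. h (1, z) = k (1, \<Phi> (1, z))) \<and> (\<forall>t\<in>{0..1}. h (t, ?b) = k (1, ?b))"
      by (intro exI[of _ ?h]) (auto simp: b0)
  qed
  show "homotopic_with (\<lambda>h. h ?b = k (1, ?b)) ?S Y (\<lambda>z. k (1, \<Phi> (1, z))) (\<lambda>z. k (1, z))"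
  proof (subst homotopic_with_sym, subst homotopic_with)
    show "(h ?b = k (1, ?b)) = (k' ?b = k (1, ?b))" if "\<And>x. x \<in> topspace ?S \<Longrightarrow> h x = k' x" for h k'
      using that b by simp
    \<comment> \<open>It remains to undo the collapse of the cap, which fixes the base
      point.\<close>
    have "continuous_map ?P Y (\<lambda>p. k (1, \<Phi> p))"
      using \<Phi>(1) by (intro continuous_map_pair_interval[OF k]) auto
    then show "\<exists>h. continuous_map ?P Y h \<and>
        (\<forall>z\<in>topspace ?S. h (0, z) = k (1, z)) \<and>
        (\<forall>z\<in>topspace ?S. h (1, z) = k (1, \<Phi> (1, z))) \<and> (\<forall>t\<in>{0..1}. h (t, ?b) = k (1, ?b))"
      using \<Phi> by (intro exI[of _ "\<lambda>p. k (1, \<Phi> p)"]) auto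
  qed
qed

text \<open>Stands in for the change of base point along a path. By \<open>free_homotopy_cap\<close>
  both ends are, up to based homotopy, the starting spheres with one and the same path spread over
  the cap, so a based homotopy of the starting spheres extends by a cap that does not move.\<close>

lemma based_homotopy_transport:
  assumes k: "continuous_map (prod_topology unit_interval (nsphere n)) Y k"
    and l: "continuous_map (prod_topology unit_interval (nsphere n)) Y l"
    and trace: "\<And>t. t \<in> {0..1} \<Longrightarrow> k (t, sphere_base) = l (t, sphere_base)"
    and hom: "homotopic_with (\<lambda>h. h sphere_base = k (0, sphere_base)) (nsphere n) Y
                (\<lambda>z. k (0, z)) (\<lambda>z. l (0, z))"
  shows "homotopic_with (\<lambda>h. h sphere_base = k (1, sphere_base)) (nsphere n) Y
                (\<lambda>z. k (1, z)) (\<lambda>z. l (1, z))"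
proof -
  let ?S = "nsphere n" and ?b = sphere_base
  let ?P = "prod_topology unit_interval (nsphere n)"
  obtain \<Phi> where \<Phi>: "continuous_map (prod_topology unit_interval (nsphere n)) (nsphere n) \<Phi>"
    "\<And>z. z \<in> topspace (nsphere n) \<Longrightarrow> \<Phi> (0, z) = z"
    "\<And>s. s \<in> {0..1} \<Longrightarrow> \<Phi> (s, sphere_base) = sphere_base"
    "\<And>z. z \<in> topspace (nsphere n) \<Longrightarrow> 1/2 \<le> z 0 \<Longrightarrow> \<Phi> (1, z) = sphere_base"
    using nsphere_collapse[of n] by blast
  have c1: "continuous_map ?P euclideanreal (\<lambda>p. snd p i)" for i
    using continuous_map_compose[OF continuous_map_snd continuous_map_nsphere_projection, of unit_interval n i]
    by (simp add: o_def)
  have c01: "continuous_map ?P unit_interval fst"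
    using continuous_map_fst[of unit_interval "nsphere n"] by simp
  have b: "?b \<in> topspace ?S" by (rule sphere_base_in_nsphere)
  have b0: "?b 0 = 1" by (simp add: sphere_base_def)
  have z01: "z 0 \<le> 1" if "z \<in> topspace ?S" for z
  proof -
    have "(z 0)\<^sup>2 \<le> (\<Sum>i\<le>n. (z i)\<^sup>2)" by (rule member_le_sum) auto
    also have "\<dots> = 1" using that by (simp add: nsphere)
    finally show ?thesis by (simp add: abs_square_le_1 abs_le_iff)
  qed
  let ?e = "\<lambda>k' z. if z 0 \<le> 1/2 then k' (0, \<Phi> (1, z)) else k' (2 * z 0 - 1, ?b)"
  have k': "homotopic_with (\<lambda>h. h ?b = k (1, ?b)) ?S Y (?e k) (\<lambda>z. k (1, z))"
    by (rule free_homotopy_cap[OF \<Phi> k])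
  have l': "homotopic_with (\<lambda>h. h ?b = k (1, ?b)) ?S Y (?e l) (\<lambda>z. l (1, z))"
    using free_homotopy_cap[OF \<Phi> l] trace[of 1] by simp
  have "homotopic_with (\<lambda>h. h ?b = k (1, ?b)) ?S Y (?e k) (?e l)"
  proof (subst homotopic_with)
    show "(h ?b = k (1, ?b)) = (k' ?b = k (1, ?b))" if "\<And>x. x \<in> topspace ?S \<Longrightarrow> h x = k' x" for h k'
      using that b by simp
    obtain h where h: "continuous_map ?P Y h" "\<And>z. h (0, z) = k (0, z)" "\<And>z. h (1, z) = l (0, z)"
      "\<And>t. t \<in> {0..1} \<Longrightarrow> h (t, ?b) = k (0, ?b)"
      using hom unfolding homotopic_with_def by auto
    let ?h = "\<lambda>p. if snd p 0 \<le> 1/2 then h (fst p, \<Phi> (1, snd p)) else k (2 * snd p 0 - 1, ?b)"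
    have "continuous_map ?P Y ?h"
    proof (rule continuous_map_cases_le)
      show "continuous_map ?P euclideanreal (\<lambda>p. snd p 0)" by (rule c1)
      show "continuous_map ?P euclideanreal (\<lambda>p. 1/2)" by simp
      have "continuous_map ?P Y (\<lambda>p. h (fst p, \<Phi> (1, snd p)))"
        by (intro continuous_map_pair_interval[OF h(1)] c01 continuous_map_pair_interval[OF \<Phi>(1)] continuous_map_snd) auto
      then show "continuous_map (subtopology ?P {x \<in> topspace ?P. snd x 0 \<le> 1/2}) Y (\<lambda>p. h (fst p, \<Phi> (1, snd p)))"
        by (rule continuous_map_from_subtopology)
      let ?P' = "subtopology ?P {x \<in> topspace ?P. 1/2 \<le> snd x 0}"
      show "continuous_map ?P' Y (\<lambda>p. k (2 * snd p 0 - 1, ?b))"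
      proof (intro continuous_map_pair_interval[OF k])
        have "continuous_map ?P euclideanreal (\<lambda>p. 2 * snd p 0 - 1)"
          by (intro continuous_intros c1; simp)
        then show "continuous_map ?P' unit_interval (\<lambda>p. 2 * snd p 0 - 1)"
          unfolding continuous_map_unit_interval
          by (auto intro: continuous_map_from_subtopology dest: z01)
        show "continuous_map ?P' ?S (\<lambda>p. ?b)" using b by simp
      qed
      show "h (fst p, \<Phi> (1, snd p)) = k (2 * snd p 0 - 1, ?b)"
        if "p \<in> topspace ?P" "snd p 0 = 1/2" for p
      proof -
        have "2 * snd p 0 - 1 = 0" using that by simp
        moreover have "\<Phi> (1, snd p) = ?b" using that \<Phi>(4)[of "snd p"] by auto
        moreover have "h (fst p, ?b) = k (0, ?b)" using that h(4) by auto
        ultimately show ?thesis by simp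
      qed
    qed
    moreover have "k (2 * z 0 - 1, ?b) = l (2 * z 0 - 1, ?b)" if "z \<in> topspace ?S" "\<not> z 0 \<le> 1/2" for z
      using trace z01[OF that(1)] that by simp
    ultimately show "\<exists>h. continuous_map ?P Y h \<and>
        (\<forall>z\<in>topspace ?S. h (0, z) = ?e k z) \<and>
        (\<forall>z\<in>topspace ?S. h (1, z) = ?e l z) \<and> (\<forall>t\<in>{0..1}. h (t, ?b) = k (1, ?b))"
      using h by (intro exI[of _ ?h]) (auto simp: b0)
  qed
  then show ?thesis
    using k' l' homotopic_with_trans homotopic_with_symD by blast
qed

lemma whe_injD:
  assumes "weak_homotopy_equivalence X Y f" "1 \<le> n" "x \<in> topspace X"
    "continuous_map (nsphere n) X g1" "g1 sphere_base = x"
    "continuous_map (nsphere n) X g2" "g2 sphere_base = x"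
    "homotopic_with (\<lambda>h. h sphere_base = f x) (nsphere n) Y (f \<circ> g1) (f \<circ> g2)"
  shows "homotopic_with (\<lambda>h. h sphere_base = x) (nsphere n) X g1 g2"
  using assms unfolding weak_homotopy_equivalence_def by blast

lemma whe_surjE:
  assumes "weak_homotopy_equivalence X Y f" "1 \<le> n" "x \<in> topspace X"
    "continuous_map (nsphere n) Y h" "h sphere_base = f x"
  obtains g where "continuous_map (nsphere n) X g" "g sphere_base = x"
    "homotopic_with (\<lambda>h'. h' sphere_base = f x) (nsphere n) Y (f \<circ> g) h"
  using assms unfolding weak_homotopy_equivalence_def by blast

text \<open>On homotopy groups \<open>f\<close> and \<open>f'\<close> differ by the change of base
  point along the path \<open>H (t, x)\<close>, so injectivity and surjectivity both reduce to
  \<open>based_homotopy_transport\<close>.\<close>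

lemma whe_homotopic:
  assumes whe: "weak_homotopy_equivalence X Y f" and hom: "homotopic_with (\<lambda>_. True) X Y f f'"
  shows "weak_homotopy_equivalence X Y f'"
proof -
  let ?b = sphere_base
  obtain H where H: "continuous_map (prod_topology unit_interval X) Y H"
    "\<And>x. H (0, x) = f x" "\<And>x. H (1, x) = f' x"
    using hom unfolding homotopic_with_def by auto
  note W = whe[unfolded weak_homotopy_equivalence_def]
  have path: "path_component_of Y (f x) (f' x)" if x: "x \<in> topspace X" for x
  proof -
    have "continuous_map unit_interval Y (\<lambda>t. H (t, x))"
      using x by (intro continuous_map_pair_interval[OF H(1)]) auto
    then show ?thesis
      unfolding path_component_of_def pathin_def
      using H by (intro exI[of _ "\<lambda>t. H (t, x)"]) auto
  qed
  note pt = path_component_of_trans and ps = path_component_of_sym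
  have HS: "continuous_map (prod_topology unit_interval (nsphere n)) Y (\<lambda>p. H (fst p, g (snd p)))"
    if "continuous_map (nsphere n) X g" for n g
    by (intro continuous_map_pair_interval[OF H(1)] continuous_map_fst
        continuous_map_compose[OF continuous_map_snd that, unfolded o_def])
  \<comment> \<open>The reversed homotopy is for injectivity, where a homotopy is carried from
    \<open>f'\<close> back to \<open>f\<close>.\<close>
  have HS': "continuous_map (prod_topology unit_interval (nsphere n)) Y (\<lambda>p. H (1 - fst p, g (snd p)))"
    if "continuous_map (nsphere n) X g" for n g
  proof (intro continuous_map_pair_interval[OF H(1)] continuous_map_compose[OF continuous_map_snd that, unfolded o_def])
    have "continuous_map (prod_topology unit_interval (nsphere n)) euclideanreal fst"
      using continuous_map_fst[of unit_interval "nsphere n"] by (auto simp: continuous_map_in_subtopology)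
    then show "continuous_map (prod_topology unit_interval (nsphere n)) unit_interval (\<lambda>p. 1 - fst p)"
      unfolding continuous_map_unit_interval by (auto intro!: continuous_intros)
  qed
  show ?thesis
    unfolding weak_homotopy_equivalence_def
  proof (intro conjI ballI allI impI)
    show "continuous_map X Y f'"
      using hom homotopic_with_imp_continuous_maps by blast
    show "\<exists>x\<in>topspace X. path_component_of Y (f' x) y" if "y \<in> topspace Y" for y
      using W that path pt ps by meson
    show "path_component_of X x1 x2"
      if "x1 \<in> topspace X" "x2 \<in> topspace X" "path_component_of Y (f' x1) (f' x2)" for x1 x2
    proof -
      have "path_component_of Y (f x1) (f x2)"
        using path[OF that(1)] path[OF that(2)] that(3) pt ps by meson
      then show ?thesis using W that by blast
    qed
  next
    fix n :: nat and x g1 g2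
    assume n: "1 \<le> n" and x: "x \<in> topspace X"
      and "continuous_map (nsphere n) X g1 \<and> g1 ?b = x \<and> continuous_map (nsphere n) X g2 \<and>
           g2 ?b = x \<and> homotopic_with (\<lambda>h. h ?b = f' x) (nsphere n) Y (f' \<circ> g1) (f' \<circ> g2)"
    then have g: "continuous_map (nsphere n) X g1" "g1 ?b = x" "continuous_map (nsphere n) X g2"
      "g2 ?b = x" and hg: "homotopic_with (\<lambda>h. h ?b = f' x) (nsphere n) Y (f' \<circ> g1) (f' \<circ> g2)"
      by auto
    have "homotopic_with (\<lambda>h. h ?b = f x) (nsphere n) Y (f \<circ> g1) (f \<circ> g2)"
      using based_homotopy_transport[OF HS'[OF g(1)] HS'[OF g(3)]] hg g H
      by (simp add: o_def)
    then show "homotopic_with (\<lambda>h. h ?b = x) (nsphere n) X g1 g2"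
      using W n x g by blast
  next
    fix n :: nat and x h
    assume n: "1 \<le> n" and x: "x \<in> topspace X" and "continuous_map (nsphere n) Y h \<and> h ?b = f' x"
    then have h: "continuous_map (nsphere n) Y h" "h ?b = f' x" by auto
    obtain \<Phi> where \<Phi>: "continuous_map (prod_topology unit_interval (nsphere n)) (nsphere n) \<Phi>"
      "\<And>z. z \<in> topspace (nsphere n) \<Longrightarrow> \<Phi> (0, z) = z"
      "\<And>s. s \<in> {0..1} \<Longrightarrow> \<Phi> (s, sphere_base) = sphere_base"
      "\<And>z. z \<in> topspace (nsphere n) \<Longrightarrow> 1/2 \<le> z 0 \<Longrightarrow> \<Phi> (1, z) = sphere_base"
      using nsphere_collapse[of n] by blast
    let ?S = "nsphere n" and ?P = "prod_topology unit_interval (nsphere n)"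
    have b: "?b \<in> topspace ?S" by (rule sphere_base_in_nsphere)
    have b0: "?b 0 = 1" by (simp add: sphere_base_def)
    have c1: "continuous_map ?P euclideanreal (\<lambda>p. snd p i)" for i
      using continuous_map_compose[OF continuous_map_snd continuous_map_nsphere_projection, of unit_interval n i]
      by (simp add: o_def)
    have c0: "continuous_map ?P euclideanreal fst"
      using continuous_map_fst[of unit_interval "nsphere n"] by (auto simp: continuous_map_in_subtopology)
    have z01: "z 0 \<le> 1" if "z \<in> topspace ?S" for z
    proof -
      have "(z 0)\<^sup>2 \<le> (\<Sum>i\<le>n. (z i)\<^sup>2)" by (rule member_le_sum) auto
      also have "\<dots> = 1" using that by (simp add: nsphere)
      finally show ?thesis by (simp add: abs_square_le_1 abs_le_iff)
    qed
    \<comment> \<open>\<open>N\<close> starts at a sphere based at \<open>f x\<close>, made of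
      \<open>h\<close> and the reversed path on the cap, and ends at \<open>h\<close> with a
      constant cap, while the base point traces \<open>H (t, x)\<close>. Surjectivity for
      \<open>f\<close> is applied to the start of \<open>N\<close>.\<close>
    define N where "N p = (if snd p 0 \<le> 1/2 then h (\<Phi> (1, snd p))
                           else H (1 - (1 - fst p) * (2 * snd p 0 - 1), x))" for p :: "real \<times> (nat \<Rightarrow> real)"
    have N: "continuous_map ?P Y N"
      unfolding N_def
    proof (rule continuous_map_cases_le)
      show "continuous_map ?P euclideanreal (\<lambda>p. snd p 0)" by (rule c1)
      show "continuous_map ?P euclideanreal (\<lambda>p. 1/2)" by simp
      have "continuous_map ?P ?S (\<lambda>p. \<Phi> (1, snd p))"
        by (intro continuous_map_pair_interval[OF \<Phi>(1)] continuous_map_snd) auto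
      from continuous_map_compose[OF this h(1)]
      have "continuous_map ?P Y (\<lambda>p. h (\<Phi> (1, snd p)))" by (simp add: o_def)
      then show "continuous_map (subtopology ?P {x \<in> topspace ?P. snd x 0 \<le> 1/2}) Y (\<lambda>p. h (\<Phi> (1, snd p)))"
        by (rule continuous_map_from_subtopology)
      let ?P' = "subtopology ?P {x \<in> topspace ?P. 1/2 \<le> snd x 0}"
      show "continuous_map ?P' Y (\<lambda>p. H (1 - (1 - fst p) * (2 * snd p 0 - 1), x))"
      proof (intro continuous_map_pair_interval[OF H(1)])
        have "continuous_map ?P euclideanreal (\<lambda>p. 1 - (1 - fst p) * (2 * snd p 0 - 1))"
          by (intro continuous_intros c1 c0; simp)
        moreover have "(1 - s) * (2 * z 0 - 1) \<le> 1 \<and> 0 \<le> (1 - s) * (2 * z 0 - 1)"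
          if "z \<in> topspace ?S" "0 \<le> s" "s \<le> 1" "1/2 \<le> z 0" for s z
          using z01[OF that(1)] that by (auto intro!: mult_le_one)
        ultimately show "continuous_map ?P' unit_interval (\<lambda>p. 1 - (1 - fst p) * (2 * snd p 0 - 1))"
          unfolding continuous_map_unit_interval by (auto intro: continuous_map_from_subtopology)
        show "continuous_map ?P' X (\<lambda>p. x)" using x by simp
      qed
      show "h (\<Phi> (1, snd p)) = H (1 - (1 - fst p) * (2 * snd p 0 - 1), x)"
        if "p \<in> topspace ?P" "snd p 0 = 1/2" for p
      proof -
        have "2 * snd p 0 - 1 = 0" using that by simp
        moreover have "\<Phi> (1, snd p) = ?b" using that \<Phi>(4)[of "snd p"] by auto
        ultimately show ?thesis using h(2) H(3) by simp
      qed
    qed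
    have N0: "continuous_map ?S Y (\<lambda>z. N (0, z))"
      by (intro continuous_map_pair_interval[OF N]) (auto simp: continuous_map_id[unfolded id_def])
    obtain g where g: "continuous_map ?S X g" "g ?b = x"
      and hg: "homotopic_with (\<lambda>h'. h' ?b = f x) ?S Y (f \<circ> g) (\<lambda>z. N (0, z))"
    proof (rule whe_surjE[OF whe n x N0])
      show "N (0, ?b) = f x" using H(2) by (simp add: N_def b0)
    qed
    have "homotopic_with (\<lambda>h'. h' ?b = f' x) ?S Y (f' \<circ> g) (\<lambda>z. N (1, z))"
      using based_homotopy_transport[OF HS[OF g(1)] N] hg H g by (simp add: o_def N_def b0)
    moreover have "homotopic_with (\<lambda>h'. h' ?b = f' x) ?S Y (\<lambda>z. N (1, z)) h"
    proof (subst homotopic_with_sym, subst homotopic_with)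
      show "(h ?b = f' x) = (k' ?b = f' x)" if "\<And>x. x \<in> topspace ?S \<Longrightarrow> h x = k' x" for h k'
        using that b by simp
      have "continuous_map ?P Y (\<lambda>p. h (\<Phi> p))"
        using continuous_map_compose[OF \<Phi>(1) h(1)] by (simp add: o_def)
      moreover have "N (1, z) = h (\<Phi> (1, z))" if "z \<in> topspace ?S" for z
        using \<Phi>(4)[of z] that h H by (auto simp: N_def)
      ultimately show "\<exists>k. continuous_map ?P Y k \<and> (\<forall>z\<in>topspace ?S. k (0, z) = h z) \<and>
          (\<forall>z\<in>topspace ?S. k (1, z) = N (1, z)) \<and> (\<forall>t\<in>{0..1}. k (t, ?b) = f' x)"
        using \<Phi> h by (intro exI[of _ "\<lambda>p. h (\<Phi> p)"]) auto
    qed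
    ultimately have "homotopic_with (\<lambda>h'. h' ?b = f' x) ?S Y (f' \<circ> g) h"
      using homotopic_with_trans by blast
    then show "\<exists>g. continuous_map ?S X g \<and> g ?b = x \<and> homotopic_with (\<lambda>h'. h' ?b = f' x) ?S Y (f' \<circ> g) h"
      using g by blast
  qed
qed

lemma continuous_map_path_component_of:
  assumes "continuous_map X Y f" "path_component_of X a b"
  shows "path_component_of Y (f a) (f b)"
proof -
  obtain g where "pathin X g" "g 0 = a" "g 1 = b"
    using assms(2) by (auto simp: path_component_of_def)
  then show ?thesis
    unfolding path_component_of_def using pathin_compose[OF _ assms(1)]
    by (intro exI[of _ "f \<circ> g"]) auto
qed

lemma whe_comp:
  assumes f: "weak_homotopy_equivalence X Y f" and g: "weak_homotopy_equivalence Y Z g"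
  shows "weak_homotopy_equivalence X Z (g \<circ> f)"
proof -
  let ?b = sphere_base
  have cf: "continuous_map X Y f" and cg: "continuous_map Y Z g"
    using f g by (auto simp: weak_homotopy_equivalence_def)
  have fx: "f x \<in> topspace Y" if "x \<in> topspace X" for x
    using cf that by (auto simp: continuous_map_def)
  note F = f[unfolded weak_homotopy_equivalence_def] and G = g[unfolded weak_homotopy_equivalence_def]
  show ?thesis
    unfolding weak_homotopy_equivalence_def
  proof (intro conjI ballI allI impI)
    show "continuous_map X Z (g \<circ> f)" using cf cg by (rule continuous_map_compose)
    show "\<exists>x\<in>topspace X. path_component_of Z ((g \<circ> f) x) z" if z: "z \<in> topspace Z" for z
    proof -
      obtain y where y: "y \<in> topspace Y" "path_component_of Z (g y) z" using G z by blast
      obtain x where x: "x \<in> topspace X" "path_component_of Y (f x) y" using F y by blast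
      show ?thesis
        using x y continuous_map_path_component_of[OF cg x(2)] path_component_of_trans
        by (metis comp_apply)
    qed
    show "path_component_of X x1 x2"
      if "x1 \<in> topspace X" "x2 \<in> topspace X" "path_component_of Z ((g \<circ> f) x1) ((g \<circ> f) x2)" for x1 x2
      using F G fx that by (metis comp_apply)
  next
    fix n :: nat and x g1 g2
    assume n: "1 \<le> n" and x: "x \<in> topspace X"
      and "continuous_map (nsphere n) X g1 \<and> g1 ?b = x \<and> continuous_map (nsphere n) X g2 \<and>
        g2 ?b = x \<and> homotopic_with (\<lambda>h. h ?b = (g \<circ> f) x) (nsphere n) Z (g \<circ> f \<circ> g1) (g \<circ> f \<circ> g2)"
    then have a: "continuous_map (nsphere n) X g1" "g1 ?b = x" "continuous_map (nsphere n) X g2"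
      "g2 ?b = x" "homotopic_with (\<lambda>h. h ?b = g (f x)) (nsphere n) Z (g \<circ> (f \<circ> g1)) (g \<circ> (f \<circ> g2))"
      by (auto simp: o_assoc)
    have "homotopic_with (\<lambda>h. h ?b = f x) (nsphere n) Y (f \<circ> g1) (f \<circ> g2)"
      by (intro whe_injD[OF g n fx[OF x]] continuous_map_compose[OF a(1) cf] continuous_map_compose[OF a(3) cf])
        (simp_all add: a)
    then show "homotopic_with (\<lambda>h. h ?b = x) (nsphere n) X g1 g2"
      by (rule whe_injD[OF f n x a(1-4)])
  next
    fix n :: nat and x h
    assume n: "1 \<le> n" and x: "x \<in> topspace X" and "continuous_map (nsphere n) Z h \<and> h ?b = (g \<circ> f) x"
    then have h: "continuous_map (nsphere n) Z h" "h ?b = g (f x)" by auto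
    obtain h' where h': "continuous_map (nsphere n) Y h'" "h' ?b = f x"
      "homotopic_with (\<lambda>h'. h' ?b = g (f x)) (nsphere n) Z (g \<circ> h') h"
      using whe_surjE[OF g n fx[OF x] h] .
    obtain g' where g': "continuous_map (nsphere n) X g'" "g' ?b = x"
      "homotopic_with (\<lambda>h'. h' ?b = f x) (nsphere n) Y (f \<circ> g') h'"
      using whe_surjE[OF f n x h'(1,2)] .
    have "homotopic_with (\<lambda>h'. h' ?b = g (f x)) (nsphere n) Z (g \<circ> (f \<circ> g')) (g \<circ> h')"
      by (rule homotopic_with_compose_continuous_map_left[OF g'(3) cg]) auto
    then have "homotopic_with (\<lambda>h'. h' ?b = g (f x)) (nsphere n) Z (g \<circ> (f \<circ> g')) h"
      using h'(3) homotopic_with_trans by blast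
    then show "\<exists>g'. continuous_map (nsphere n) X g' \<and> g' ?b = x \<and>
        homotopic_with (\<lambda>h'. h' ?b = (g \<circ> f) x) (nsphere n) Z (g \<circ> f \<circ> g') h"
      using g' by (auto simp: o_assoc)
  qed
qed

lemma whe_id: "weak_homotopy_equivalence X X id"
  unfolding weak_homotopy_equivalence_def
proof (intro conjI ballI allI impI)
  show "\<exists>x\<in>topspace X. path_component_of X (id x) y" if "y \<in> topspace X" for y
    using that by (intro bexI[of _ y]) (simp_all add: path_component_of_refl)
qed (auto)

text \<open>For the surjectivity of \<open>f\<close>, a lift of \<open>g \<circ> h\<close> along
  \<open>g \<circ> f\<close> is taken. After \<open>f\<close> it agrees with \<open>h\<close> up to
  \<open>f \<circ> g\<close>, whose injectivity at \<open>f x\<close> finishes. Only base points of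
  the form \<open>f x\<close> occur, so base points stay where they are.\<close>

lemma whe_two_of_six:
  assumes f: "continuous_map X Y f" and g: "continuous_map Y X g"
    and gf: "weak_homotopy_equivalence X X (g \<circ> f)" and fg: "weak_homotopy_equivalence Y Y (f \<circ> g)"
  shows "weak_homotopy_equivalence X Y f"
proof -
  let ?b = sphere_base
  have fx: "f x \<in> topspace Y" if "x \<in> topspace X" for x
    using f that by (auto simp: continuous_map_def)
  have gy: "g y \<in> topspace X" if "y \<in> topspace Y" for y
    using g that by (auto simp: continuous_map_def)
  note GF = gf[unfolded weak_homotopy_equivalence_def] and FG = fg[unfolded weak_homotopy_equivalence_def]
  show ?thesis
    unfolding weak_homotopy_equivalence_def
  proof (intro conjI ballI allI impI)
    show "continuous_map X Y f" by fact
    show "\<exists>x\<in>topspace X. path_component_of Y (f x) y" if "y \<in> topspace Y" for y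
      using FG that gy by (metis comp_apply)
    show "path_component_of X x1 x2"
      if "x1 \<in> topspace X" "x2 \<in> topspace X" "path_component_of Y (f x1) (f x2)" for x1 x2
      using GF that continuous_map_path_component_of[OF g that(3)] by (metis comp_apply)
  next
    fix n :: nat and x g1 g2
    assume n: "1 \<le> n" and x: "x \<in> topspace X"
      and "continuous_map (nsphere n) X g1 \<and> g1 ?b = x \<and> continuous_map (nsphere n) X g2 \<and>
        g2 ?b = x \<and> homotopic_with (\<lambda>h. h ?b = f x) (nsphere n) Y (f \<circ> g1) (f \<circ> g2)"
    then have a: "continuous_map (nsphere n) X g1" "g1 ?b = x" "continuous_map (nsphere n) X g2"
      "g2 ?b = x" "homotopic_with (\<lambda>h. h ?b = f x) (nsphere n) Y (f \<circ> g1) (f \<circ> g2)"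
      by auto
    have "homotopic_with (\<lambda>h. h ?b = (g \<circ> f) x) (nsphere n) X (g \<circ> f \<circ> g1) (g \<circ> f \<circ> g2)"
      using homotopic_with_compose_continuous_map_left[OF a(5) g] by (simp add: o_assoc)
    then show "homotopic_with (\<lambda>h. h ?b = x) (nsphere n) X g1 g2"
      by (rule whe_injD[OF gf n x a(1-4)])
  next
    fix n :: nat and x h
    assume n: "1 \<le> n" and x: "x \<in> topspace X" and "continuous_map (nsphere n) Y h \<and> h ?b = f x"
    then have h: "continuous_map (nsphere n) Y h" "h ?b = f x" by auto
    have "continuous_map (nsphere n) X (g \<circ> h)" using h(1) g by (rule continuous_map_compose)
    then obtain a where a: "continuous_map (nsphere n) X a" "a ?b = x"
      "homotopic_with (\<lambda>h'. h' ?b = (g \<circ> f) x) (nsphere n) X (g \<circ> f \<circ> a) (g \<circ> h)"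
      using whe_surjE[OF gf n x, of "g \<circ> h"] h(2) by auto
    have c: "continuous_map (nsphere n) Y (f \<circ> a)" using a(1) f by (rule continuous_map_compose)
    have "homotopic_with (\<lambda>h'. h' ?b = f (g (f x))) (nsphere n) Y (f \<circ> (g \<circ> f \<circ> a)) (f \<circ> (g \<circ> h))"
      by (rule homotopic_with_compose_continuous_map_left[OF a(3) f]) auto
    then have hh: "homotopic_with (\<lambda>h'. h' ?b = (f \<circ> g) (f x)) (nsphere n) Y ((f \<circ> g) \<circ> (f \<circ> a)) ((f \<circ> g) \<circ> h)"
      by (simp add: o_assoc)
    have "homotopic_with (\<lambda>h'. h' ?b = f x) (nsphere n) Y (f \<circ> a) h"
      by (rule whe_injD[OF fg n fx[OF x] c _ h hh]) (simp add: a)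
    then show "\<exists>a. continuous_map (nsphere n) X a \<and> a ?b = x \<and>
        homotopic_with (\<lambda>h'. h' ?b = f x) (nsphere n) Y (f \<circ> a) h"
      using a by blast
  qed
qed

section \<open>Homotopy equivalences with a chosen inverse\<close>

definition hinverse :: "'a topology \<Rightarrow> 'b topology \<Rightarrow> ('a \<Rightarrow> 'b) \<Rightarrow> ('b \<Rightarrow> 'a) \<Rightarrow> bool" where
  "hinverse X Y f g \<longleftrightarrow> continuous_map X Y f \<and> continuous_map Y X g \<and>
     homotopic_with (\<lambda>_. True) X X (g \<circ> f) id \<and> homotopic_with (\<lambda>_. True) Y Y (f \<circ> g) id"

lemma hinverse_sym: "hinverse X Y f g \<Longrightarrow> hinverse Y X g f"
  by (auto simp: hinverse_def)

lemma homotopic_comp_left: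
  assumes "homotopic_with (\<lambda>_. True) X Y f g" "continuous_map Y Z h"
  shows "homotopic_with (\<lambda>_. True) X Z (h \<circ> f) (h \<circ> g)"
  using homotopic_with_compose_continuous_map_left[OF assms] by simp

lemma homotopic_comp_right:
  assumes "homotopic_with (\<lambda>_. True) Y Z f g" "continuous_map X Y h"
  shows "homotopic_with (\<lambda>_. True) X Z (f \<circ> h) (g \<circ> h)"
  using homotopic_with_compose_continuous_map_right[OF assms] by simp

text \<open>\<open>whe_two_of_six\<close> reduces this to self-maps homotopic to the identity; the
  homotopies are free, which is the case that \<open>whe_homotopic\<close> covers.\<close>

lemma hinverse_whe:
  assumes "hinverse X Y f g"
  shows "weak_homotopy_equivalence X Y f"
proof (rule whe_two_of_six)
  show "continuous_map X Y f" "continuous_map Y X g"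
    using assms by (auto simp: hinverse_def)
  show "weak_homotopy_equivalence X X (g \<circ> f)" "weak_homotopy_equivalence Y Y (f \<circ> g)"
    using assms by (auto simp: hinverse_def intro: whe_homotopic[OF whe_id] homotopic_with_symD)
qed

lemma whe_comp_hinverse_right:
  assumes e: "hinverse X Y e e'" and g: "continuous_map Y Z g"
  shows "weak_homotopy_equivalence X Z (g \<circ> e) \<longleftrightarrow> weak_homotopy_equivalence Y Z g"
proof
  assume "weak_homotopy_equivalence X Z (g \<circ> e)"
  then have "weak_homotopy_equivalence Y Z (g \<circ> e \<circ> e')"
    using whe_comp hinverse_whe[OF hinverse_sym[OF e]] by blast
  moreover have "homotopic_with (\<lambda>_. True) Y Z (g \<circ> (e \<circ> e')) (g \<circ> id)"
    using e g unfolding hinverse_def by (intro homotopic_comp_left) auto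
  ultimately show "weak_homotopy_equivalence Y Z g"
    using whe_homotopic[of Y Z "g \<circ> e \<circ> e'" g] by (simp add: o_assoc)
qed (auto intro: whe_comp hinverse_whe[OF e])

lemma whe_comp_hinverse_left:
  assumes e: "hinverse Y Z e e'" and g: "continuous_map X Y g"
  shows "weak_homotopy_equivalence X Z (e \<circ> g) \<longleftrightarrow> weak_homotopy_equivalence X Y g"
proof
  assume "weak_homotopy_equivalence X Z (e \<circ> g)"
  then have "weak_homotopy_equivalence X Y (e' \<circ> (e \<circ> g))"
    using whe_comp hinverse_whe[OF hinverse_sym[OF e]] by blast
  moreover have "homotopic_with (\<lambda>_. True) X Y (e' \<circ> e \<circ> g) (id \<circ> g)"
    using e g unfolding hinverse_def by (intro homotopic_comp_right) auto
  ultimately show "weak_homotopy_equivalence X Y g"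
    using whe_homotopic[of X Y "e' \<circ> (e \<circ> g)" g] by (simp add: o_assoc)
qed (auto intro: whe_comp hinverse_whe[OF e])

lemma hinverse_comp:
  assumes e: "hinverse X Y e e'" and f: "hinverse Y Z f f'"
  shows "hinverse X Z (f \<circ> e) (e' \<circ> f')"
proof -
  have c: "continuous_map X Y e" "continuous_map Y X e'" "continuous_map Y Z f" "continuous_map Z Y f'"
    using e f by (auto simp: hinverse_def)
  have 1: "homotopic_with (\<lambda>_. True) X X (e' \<circ> ((f' \<circ> f) \<circ> e)) (e' \<circ> (id \<circ> e))"
    using c f by (intro homotopic_comp_left homotopic_comp_right) (auto simp: hinverse_def)
  have 2: "homotopic_with (\<lambda>_. True) Z Z (f \<circ> ((e \<circ> e') \<circ> f')) (f \<circ> (id \<circ> f'))"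
    using c e by (intro homotopic_comp_left homotopic_comp_right) (auto simp: hinverse_def)
  have "homotopic_with (\<lambda>_. True) X X (e' \<circ> f' \<circ> (f \<circ> e)) id"
    using homotopic_with_trans[OF 1, of id] e by (simp add: hinverse_def o_assoc)
  moreover have "homotopic_with (\<lambda>_. True) Z Z (f \<circ> e \<circ> (e' \<circ> f')) id"
    using homotopic_with_trans[OF 2, of id] f by (simp add: hinverse_def o_assoc)
  ultimately show ?thesis
    unfolding hinverse_def using c by (auto intro: continuous_map_compose)
qed

lemma hinverse_homotopic:
  assumes e: "hinverse X Y f g" and h: "homotopic_with (\<lambda>_. True) X Y f f'"
  shows "hinverse X Y f' g"
proof -
  have c: "continuous_map X Y f'" "continuous_map Y X g"
    using homotopic_with_imp_continuous_maps[OF h] e by (auto simp: hinverse_def)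
  have "homotopic_with (\<lambda>_. True) X X (g \<circ> f') id"
    using homotopic_with_trans[OF homotopic_with_symD[OF homotopic_comp_left[OF h c(2)]]] e
    by (simp add: hinverse_def)
  moreover have "homotopic_with (\<lambda>_. True) Y Y (f' \<circ> g) id"
    using homotopic_with_trans[OF homotopic_with_symD[OF homotopic_comp_right[OF h c(2)]]] e
    by (simp add: hinverse_def)
  ultimately show ?thesis using c by (simp add: hinverse_def)
qed

section \<open>Geometric realization of complexes\<close>

definition final_topology ::
  "'z set \<Rightarrow> 'i set \<Rightarrow> ('i \<Rightarrow> 'y topology) \<Rightarrow> ('i \<Rightarrow> 'y \<Rightarrow> 'z) \<Rightarrow> 'z topology" where
  "final_topology Z I Y q =
     topology (\<lambda>U. U \<subseteq> Z \<and> (\<forall>i\<in>I. openin (Y i) {y \<in> topspace (Y i). q i y \<in> U}))"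

lemma openin_final_topology:
  "openin (final_topology Z I Y q) U \<longleftrightarrow>
     U \<subseteq> Z \<and> (\<forall>i\<in>I. openin (Y i) {y \<in> topspace (Y i). q i y \<in> U})"
proof -
  have "istopology (\<lambda>U. U \<subseteq> Z \<and> (\<forall>i\<in>I. openin (Y i) {y \<in> topspace (Y i). q i y \<in> U}))"
  proof -
    have 1: "{y \<in> topspace (Y i). q i y \<in> S \<inter> T} =
        {y \<in> topspace (Y i). q i y \<in> S} \<inter> {y \<in> topspace (Y i). q i y \<in> T}" for S T i
      by auto
    have 2: "{y \<in> topspace (Y i). q i y \<in> \<Union>\<K>} = (\<Union>K\<in>\<K>. {y \<in> topspace (Y i). q i y \<in> K})" for \<K> i
      by auto
    show ?thesis
      unfolding istopology_def 1 2 by blast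
  qed
  then show ?thesis by (simp add: final_topology_def)
qed

lemma topspace_final_topology:
  assumes "\<And>i. i \<in> I \<Longrightarrow> q i ` topspace (Y i) \<subseteq> Z"
  shows "topspace (final_topology Z I Y q) = Z"
proof -
  have "{y \<in> topspace (Y i). q i y \<in> Z} = topspace (Y i)" if "i \<in> I" for i
    using assms that by auto
  then have "openin (final_topology Z I Y q) Z"
    unfolding openin_final_topology by simp
  then have "Z \<subseteq> topspace (final_topology Z I Y q)"
    by (rule openin_subset)
  moreover have "topspace (final_topology Z I Y q) \<subseteq> Z"
    using openin_topspace[of "final_topology Z I Y q"] unfolding openin_final_topology by simp
  ultimately show ?thesis by simp
qed

lemma continuous_map_into_final:
  assumes "\<And>i. i \<in> I \<Longrightarrow> q i ` topspace (Y i) \<subseteq> Z" "i \<in> I"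
  shows "continuous_map (Y i) (final_topology Z I Y q) (q i)"
proof -
  have t: "topspace (final_topology Z I Y q) = Z"
    using assms(1) by (rule topspace_final_topology)
  show ?thesis
    unfolding continuous_map_def t using assms by (auto simp: openin_final_topology)
qed

lemma quotient_map_final:
  assumes Z: "Z = (\<Union>i\<in>I. q i ` topspace (Y i))"
  shows "quotient_map (sum_topology Y I) (final_topology Z I Y q) (\<lambda>(i, y). q i y)"
proof -
  have t: "topspace (final_topology Z I Y q) = Z"
    using Z by (intro topspace_final_topology) auto
  have "{y. (i, y) \<in> {x \<in> Sigma I (topspace \<circ> Y). (case x of (i, y) \<Rightarrow> q i y) \<in> U}}
      = {y \<in> topspace (Y i). q i y \<in> U}" if "i \<in> I" for U i
    using that by auto
  then show ?thesis
    unfolding quotient_map_def t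
    by (auto simp: openin_sum_topology openin_final_topology Z)
qed

lemma continuous_map_from_final:
  assumes Z: "Z = (\<Union>i\<in>I. q i ` topspace (Y i))"
    and f: "\<And>i. i \<in> I \<Longrightarrow> continuous_map (Y i) T (\<lambda>y. f (q i y))"
  shows "continuous_map (final_topology Z I Y q) T f"
proof -
  have t: "topspace (final_topology Z I Y q) = Z"
    using Z by (intro topspace_final_topology) auto
  show ?thesis
    unfolding continuous_map_def
  proof (intro conjI allI impI)
    show "f \<in> topspace (final_topology Z I Y q) \<rightarrow> topspace T"
      unfolding t using f by (auto simp: Z continuous_map_def)
    show "openin (final_topology Z I Y q) {x \<in> topspace (final_topology Z I Y q). f x \<in> U}"
      if "openin T U" for U
    proof -
      have "{y \<in> topspace (Y i). q i y \<in> {x \<in> Z. f x \<in> U}} = {y \<in> topspace (Y i). f (q i y) \<in> U}"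
        if "i \<in> I" for i
        using Z that by auto
      then show ?thesis
        using f that by (auto simp: openin_final_topology t continuous_map_def)
    qed
  qed
qed

lemma continuous_map_from_prod_sum:
  assumes f: "\<And>i. i \<in> I \<Longrightarrow> continuous_map (prod_topology S (Y i)) T (\<lambda>(t, y). f (t, i, y))"
  shows "continuous_map (prod_topology S (sum_topology Y I)) T f"
proof (rule pasting_lemma[where I = I and T = "\<lambda>i. topspace S \<times> ({i} \<times> topspace (Y i))" and f = "\<lambda>_. f"])
  fix i assume i: "i \<in> I"
  have op: "openin (sum_topology Y I) ({i} \<times> U)" if "openin (Y i) U" for U
  proof -
    have "{x. (j, x) \<in> {i} \<times> U} = (if j = i then U else {})" for j by auto
    then show ?thesis
      using i that openin_subset[OF that] by (auto simp: openin_sum_topology)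
  qed
  show "openin (prod_topology S (sum_topology Y I)) (topspace S \<times> ({i} \<times> topspace (Y i)))"
    unfolding openin_prod_Times_iff by (auto intro: op)
  let ?A = "topspace S \<times> ({i} \<times> topspace (Y i))"
  let ?X = "subtopology (prod_topology S (sum_topology Y I)) ?A"
  have "continuous_map (subtopology (sum_topology Y I) ({i} \<times> topspace (Y i))) (Y i) snd"
    unfolding continuous_map_def
  proof (intro conjI allI impI)
    fix U assume U: "openin (Y i) U"
    have "{x \<in> topspace (subtopology (sum_topology Y I) ({i} \<times> topspace (Y i))). snd x \<in> U}
       = ({i} \<times> U) \<inter> ({i} \<times> topspace (Y i))"
      using i openin_subset[OF U] by auto
    then show "openin (subtopology (sum_topology Y I) ({i} \<times> topspace (Y i)))
        {x \<in> topspace (subtopology (sum_topology Y I) ({i} \<times> topspace (Y i))). snd x \<in> U}"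
      using op[OF U] by (auto simp: openin_subtopology)
  qed (auto)
  then have s: "continuous_map ?X (Y i) (\<lambda>p. snd (snd p))"
    unfolding prod_topology_subtopology(1)[symmetric] subtopology_Times
    using continuous_map_compose[OF continuous_map_snd] by (auto simp: o_def)
  have "continuous_map ?X S fst"
    by (intro continuous_map_from_subtopology continuous_map_fst)
  from continuous_map_compose[OF continuous_map_pairedI[OF this s] f[OF i]]
  have "continuous_map ?X T (\<lambda>p. f (fst p, i, snd (snd p)))"
    by (simp add: o_def)
  then show "continuous_map ?X T f"
    by (rule continuous_map_eq) auto
qed (auto)

text \<open>A quotient map stays one after taking the product with the interval, because the
  interval is locally compact Hausdorff. Hence homotopies, like maps, may be checked on
  cells.\<close>

lemma continuous_map_from_prod_final:
  assumes Z: "Z = (\<Union>i\<in>I. q i ` topspace (Y i))"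
    and f: "\<And>i. i \<in> I \<Longrightarrow> continuous_map (prod_topology unit_interval (Y i)) T (\<lambda>p. f (fst p, q i (snd p)))"
  shows "continuous_map (prod_topology unit_interval (final_topology Z I Y q)) T f"
proof (rule continuous_compose_quotient_map)
  have "compact_space unit_interval"
    by (simp add: compact_space_subtopology compactin_euclidean_iff)
  moreover have "Hausdorff_space unit_interval"
    by (simp add: Hausdorff_space_subtopology)
  ultimately show "quotient_map (prod_topology unit_interval (sum_topology Y I))
      (prod_topology unit_interval (final_topology Z I Y q)) (\<lambda>(t, p). (t, case p of (i, y) \<Rightarrow> q i y))"
    by (intro quotient_map_prod_right quotient_map_final[OF Z])
      (auto simp: compact_imp_locally_compact_space)
  show "continuous_map (prod_topology unit_interval (sum_topology Y I)) T
      (f \<circ> (\<lambda>(t, p). (t, case p of (i, y) \<Rightarrow> q i y)))"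
    using f by (intro continuous_map_from_prod_sum) (auto simp: o_def case_prod_unfold)
qed

section \<open>Barycentric coordinates\<close>

definition gsupp :: "('v \<Rightarrow> real) \<Rightarrow> 'v set" where
  "gsupp x = {v. x v \<noteq> 0}"

definition gsimp :: "'v set \<Rightarrow> ('v \<Rightarrow> real) set" where
  "gsimp s = {x. (\<forall>v. 0 \<le> x v) \<and> gsupp x \<subseteq> s \<and> sum x s = 1}"

abbreviation gcell :: "'v set \<Rightarrow> ('v \<Rightarrow> real) topology" where
  "gcell s \<equiv> subtopology (powertop_real UNIV) (gsimp s)"

text \<open>Points are functions on all vertices, zero off a simplex, so that the inclusion of a
  subcomplex is the identity on points. The topology is the weak one, in general finer than that of
  pointwise convergence.\<close>

definition geo :: "'v set set \<Rightarrow> ('v \<Rightarrow> real) topology" where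
  "geo K = final_topology (\<Union>s\<in>K. gsimp s) K gcell (\<lambda>_ x. x)"

lemma topspace_geo: "topspace (geo K) = (\<Union>s\<in>K. gsimp s)"
  unfolding geo_def by (intro topspace_final_topology) auto

lemma complex_finite: "complex K \<Longrightarrow> s \<in> K \<Longrightarrow> finite s"
  by (simp add: complex_def)

lemma complex_nonempty: "complex K \<Longrightarrow> s \<in> K \<Longrightarrow> s \<noteq> {}"
  by (simp add: complex_def)

lemma complex_subset: "complex K \<Longrightarrow> s \<in> K \<Longrightarrow> t \<subseteq> s \<Longrightarrow> t \<noteq> {} \<Longrightarrow> t \<in> K"
  unfolding complex_def by blast

lemma gsimp_mono:
  assumes "x \<in> gsimp s" "s \<subseteq> t" "finite t"
  shows "x \<in> gsimp t"
proof -
  have "sum x t = sum x s"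
    using assms by (intro sum.mono_neutral_right) (auto simp: gsimp_def gsupp_def)
  then show ?thesis using assms by (auto simp: gsimp_def)
qed

lemma gsimp_supp:
  assumes "x \<in> gsimp s" "finite s" "gsupp x \<subseteq> t" "finite t"
  shows "x \<in> gsimp t"
proof -
  have "gsupp x \<subseteq> s" using assms(1) by (auto simp: gsimp_def)
  then have "sum x (gsupp x) = sum x s" "sum x (gsupp x) = sum x t"
    using assms by (auto intro!: sum.mono_neutral_left simp: gsupp_def)
  then show ?thesis using assms by (auto simp: gsimp_def)
qed

lemma gsimp_gsupp_ne: "x \<in> gsimp s \<Longrightarrow> gsupp x \<noteq> {}"
proof
  assume x: "x \<in> gsimp s" "gsupp x = {}"
  then have "sum x s = 0" by (auto simp: gsupp_def intro: sum.neutral)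
  then show False using x by (simp add: gsimp_def)
qed

lemma in_geo_iff:
  assumes "complex K"
  shows "x \<in> topspace (geo K) \<longleftrightarrow> gsupp x \<in> K \<and> x \<in> gsimp (gsupp x)"
proof
  assume "x \<in> topspace (geo K)"
  then obtain s where s: "s \<in> K" "x \<in> gsimp s" by (auto simp: topspace_geo)
  then have "gsupp x \<in> K"
    using complex_subset[OF assms s(1)] gsimp_gsupp_ne[OF s(2)] by (auto simp: gsimp_def)
  moreover have "x \<in> gsimp (gsupp x)"
    using gsimp_supp[OF s(2)] complex_finite[OF assms] s calculation by blast
  ultimately show "gsupp x \<in> K \<and> x \<in> gsimp (gsupp x)" ..
qed (auto simp: topspace_geo)

lemma closedin_gsimp: "closedin (powertop_real UNIV) (gsimp s)"
proof -
  have c: "continuous_map (powertop_real UNIV) euclideanreal (\<lambda>x. x v)" for v :: 'a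
    by (rule continuous_map_product_projection) simp
  have t: "topspace (powertop_real UNIV) = (UNIV :: ('a \<Rightarrow> real) set)" by simp
  have pre: "closedin (powertop_real UNIV) {x. g x \<in> C}"
    if "continuous_map (powertop_real UNIV) euclideanreal g" "closed C" for g :: "('a \<Rightarrow> real) \<Rightarrow> real" and C
    using closedin_continuous_map_preimage[OF that(1), of C] that(2) unfolding t by simp
  have 1: "closedin (powertop_real UNIV) (\<Inter>v. {x :: 'a \<Rightarrow> real. x v \<in> {0..}})"
    using pre[OF c, of "{0..}"] by (intro closedin_Inter) auto
  have 2: "closedin (powertop_real UNIV) (\<Inter>v. {x :: 'a \<Rightarrow> real. x v \<in> (if v \<in> s then UNIV else {0})})"
    by (intro closedin_Inter) (auto intro!: pre[OF c])
  have 3: "closedin (powertop_real UNIV) {x. sum x s \<in> {1}}"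
  proof (cases "finite s")
    case True
    show ?thesis by (intro pre continuous_map_sum c True) auto
  next
    \<comment> \<open>A sum over an infinite set is 0 by convention, so the set in question is
      empty.\<close>
    case False
    then show ?thesis by simp
  qed
  have "x \<in> gsimp s \<longleftrightarrow> (\<forall>v. x v \<in> {0..}) \<and> (\<forall>v. x v \<in> (if v \<in> s then UNIV else {0})) \<and> sum x s \<in> {1}" for x
    by (auto simp: gsimp_def gsupp_def subset_iff)
  then have "gsimp s = (\<Inter>v. {x. x v \<in> {0..}}) \<inter>
     ((\<Inter>v. {x. x v \<in> (if v \<in> s then UNIV else {0})}) \<inter> {x. sum x s \<in> {1}})"
    by blast
  then show ?thesis
    using closedin_Int[OF 1 closedin_Int[OF 2 3]] by simp
qed

lemma continuous_map_gcell_geo: "s \<in> K \<Longrightarrow> continuous_map (gcell s) (geo K) (\<lambda>x. x)"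
  unfolding geo_def by (rule continuous_map_into_final[where q = "\<lambda>_ x. x" and Y = gcell]) auto

lemma continuous_map_from_geo:
  assumes "\<And>s. s \<in> K \<Longrightarrow> continuous_map (gcell s) T f"
  shows "continuous_map (geo K) T f"
  unfolding geo_def using assms by (intro continuous_map_from_final) auto

lemma continuous_map_from_prod_geo:
  assumes "\<And>s. s \<in> K \<Longrightarrow> continuous_map (prod_topology unit_interval (gcell s)) T f"
  shows "continuous_map (prod_topology unit_interval (geo K)) T f"
  unfolding geo_def using assms by (intro continuous_map_from_prod_final) auto

lemma continuous_map_gcell_coord: "continuous_map (gcell s) euclideanreal (\<lambda>x. x v)"
  by (intro continuous_map_from_subtopology continuous_map_product_projection) simp

lemma continuous_map_geo_coord: "continuous_map (geo K) euclideanreal (\<lambda>x. x v)"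
  by (intro continuous_map_from_geo continuous_map_gcell_coord)

lemma continuous_map_prod_gcell_coord:
  "continuous_map (prod_topology unit_interval (gcell s)) euclideanreal (\<lambda>p. snd p v)"
  using continuous_map_compose[OF continuous_map_snd continuous_map_gcell_coord] by (auto simp: o_def)

lemma continuous_map_interval_fst:
  "continuous_map (prod_topology unit_interval X) euclideanreal fst"
  using continuous_map_fst[of unit_interval X] by (auto simp: continuous_map_in_subtopology)

text \<open>For the weak topology coordinatewise continuity is not enough in general. It is once
  finitely many simplices contain all values: their preimages form a finite closed cover, and on
  each simplex the topology is that of pointwise convergence.\<close>

lemma continuous_map_into_geo:
  assumes fin: "finite \<T>" and sub: "\<T> \<subseteq> L"
    and val: "\<And>a. a \<in> topspace A \<Longrightarrow> \<exists>\<tau>\<in>\<T>. \<phi> a \<in> gsimp \<tau>"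
    and coord: "\<And>w. continuous_map A euclideanreal (\<lambda>a. \<phi> a w)"
  shows "continuous_map A (geo L) \<phi>"
proof (rule pasting_lemma_closed[where I = \<T> and T = "\<lambda>\<tau>. {a \<in> topspace A. \<phi> a \<in> gsimp \<tau>}" and f = "\<lambda>_. \<phi>"])
  have c: "continuous_map A (powertop_real UNIV) \<phi>"
    using coord by (simp add: continuous_map_componentwise_UNIV)
  show "closedin A {a \<in> topspace A. \<phi> a \<in> gsimp \<tau>}" for \<tau>
    by (rule closedin_continuous_map_preimage[OF c closedin_gsimp])
  fix \<tau> assume \<tau>: "\<tau> \<in> \<T>"
  have "continuous_map (subtopology A {a \<in> topspace A. \<phi> a \<in> gsimp \<tau>}) (gcell \<tau>) \<phi>"
    by (auto simp: continuous_map_in_subtopology intro: continuous_map_from_subtopology[OF c])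
  from continuous_map_compose[OF this continuous_map_gcell_geo] \<tau> sub
  show "continuous_map (subtopology A {a \<in> topspace A. \<phi> a \<in> gsimp \<tau>}) (geo L) \<phi>"
    by (auto simp: o_def)
qed (use fin val in auto)

definition gmap :: "('v \<Rightarrow> 'w) \<Rightarrow> ('v \<Rightarrow> real) \<Rightarrow> 'w \<Rightarrow> real" where
  "gmap f x w = (\<Sum>v\<in>gsupp x. if f v = w then x v else 0)"

lemma sum_gsupp:
  assumes "finite s" "gsupp x \<subseteq> s" "\<And>v. x v = 0 \<Longrightarrow> h v = (0::real)"
  shows "sum h (gsupp x) = sum h s"
  using assms by (intro sum.mono_neutral_left) (auto simp: gsupp_def)

lemma gmap_eq:
  assumes "finite s" "gsupp x \<subseteq> s"
  shows "gmap f x w = (\<Sum>v\<in>s. if f v = w then x v else 0)"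
  unfolding gmap_def using assms by (intro sum_gsupp) auto

lemma gmap_gsimp:
  assumes s: "finite s" and x: "x \<in> gsimp s" and f: "f ` s \<subseteq> t" and t: "finite t"
  shows "gmap f x \<in> gsimp t"
proof -
  have sub: "gsupp x \<subseteq> s" and nn: "\<And>v. 0 \<le> x v" and sm: "sum x s = 1"
    using x by (auto simp: gsimp_def)
  have "sum (gmap f x) t = (\<Sum>v\<in>s. \<Sum>w\<in>t. if f v = w then x v else 0)"
    unfolding gmap_eq[OF s sub] by (rule sum.swap)
  also have "\<dots> = sum x s"
    using t f by (intro sum.cong refl) (auto simp: sum.delta')
  finally have "sum (gmap f x) t = 1" using sm by simp
  moreover have "0 \<le> gmap f x w" for w
    unfolding gmap_def by (intro sum_nonneg) (auto simp: nn)
  moreover have "gmap f x w = 0" if "w \<notin> t" for w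
    unfolding gmap_eq[OF s sub] using f that by (intro sum.neutral) auto
  ultimately show ?thesis
    by (auto simp: gsimp_def gsupp_def)
qed

lemma continuous_map_gmap:
  assumes K: "complex K" and L: "complex L" and f: "cpx_map K L f"
  shows "continuous_map (geo K) (geo L) (gmap f)"
proof (rule continuous_map_from_geo)
  fix s assume s: "s \<in> K"
  have fs: "f ` s \<in> L" using f s by (auto simp: cpx_map_def)
  have fin: "finite s" using K s by (rule complex_finite)
  show "continuous_map (gcell s) (geo L) (gmap f)"
  proof (rule continuous_map_into_geo[of "{f ` s}"])
    show "\<exists>\<tau>\<in>{f ` s}. gmap f x \<in> gsimp \<tau>" if "x \<in> topspace (gcell s)" for x
      using that gmap_gsimp[OF fin, of x f "f ` s"] fin by auto
    have "continuous_map (gcell s) euclideanreal (\<lambda>x. \<Sum>v\<in>s. if f v = w then x v else 0)" for w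
      by (intro continuous_map_sum fin) (auto simp: continuous_map_gcell_coord)
    then show "continuous_map (gcell s) euclideanreal (\<lambda>x. gmap f x w)" for w
      by (rule continuous_map_eq) (auto simp: gmap_eq[OF fin] gsimp_def)
  qed (use fs in auto)
qed

lemma finite_gsupp_geo: "complex K \<Longrightarrow> x \<in> topspace (geo K) \<Longrightarrow> finite (gsupp x)"
  using in_geo_iff complex_finite by blast

lemma gsupp_gmap: "gsupp (gmap f x) \<subseteq> f ` gsupp x"
proof
  fix w assume "w \<in> gsupp (gmap f x)"
  then have "(\<Sum>v\<in>gsupp x. if f v = w then x v else 0) \<noteq> 0"
    by (simp add: gsupp_def gmap_def)
  then obtain v where "v \<in> gsupp x" "(if f v = w then x v else 0) \<noteq> 0"
    by (rule sum.not_neutral_contains_not_neutral)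
  then show "w \<in> f ` gsupp x" by (auto split: if_splits)
qed

lemma gmap_gmap:
  assumes "finite (gsupp x)"
  shows "gmap g (gmap f x) = gmap (g \<circ> f) x"
proof
  fix w
  have "gmap g (gmap f x) w = (\<Sum>u\<in>f ` gsupp x. if g u = w then gmap f x u else 0)"
    by (rule gmap_eq[OF _ gsupp_gmap]) (simp add: assms)
  also have "\<dots> = (\<Sum>u\<in>f ` gsupp x. \<Sum>v\<in>gsupp x. if f v = u then if g u = w then x v else 0 else 0)"
  proof (intro sum.cong refl)
    show "(if g u = w then gmap f x u else 0) =
        (\<Sum>v\<in>gsupp x. if f v = u then if g u = w then x v else 0 else 0)" for u
      by (cases "g u = w") (auto simp: gmap_def cong: if_cong)
  qed
  also have "\<dots> = (\<Sum>v\<in>gsupp x. \<Sum>u\<in>f ` gsupp x. if f v = u then if g u = w then x v else 0 else 0)"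
    by (rule sum.swap)
  also have "\<dots> = (\<Sum>v\<in>gsupp x. if g (f v) = w then x v else 0)"
    using assms by (intro sum.cong refl) (simp add: sum.delta')
  finally show "gmap g (gmap f x) w = gmap (g \<circ> f) x w"
    by (simp add: gmap_def)
qed

lemma gmap_id_on:
  assumes "finite (gsupp x)" "\<And>v. v \<in> gsupp x \<Longrightarrow> f v = v"
  shows "gmap f x = x"
proof
  fix w
  have "gmap f x w = (\<Sum>v\<in>gsupp x. if v = w then x v else 0)"
    unfolding gmap_def using assms by (intro sum.cong) auto
  also have "\<dots> = x w"
    using assms(1) by (simp add: sum.delta) (simp add: gsupp_def)
  finally show "gmap f x w = x w" .
qed

lemma gmap_cong: "(\<And>v. v \<in> gsupp x \<Longrightarrow> f v = g v) \<Longrightarrow> gmap f x = gmap g x"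
  by (auto simp: gmap_def intro!: sum.cong)

section \<open>Homotopies that move mass linearly or in stages\<close>

lemma homotopic_straight_line:
  fixes X :: "'v set set" and Y :: "'w set set"
  assumes Y: "complex Y"
    and \<phi>: "continuous_map (geo X) (geo Y) \<phi>" and \<psi>: "continuous_map (geo X) (geo Y) \<psi>"
    and carrier: "\<And>s. s \<in> X \<Longrightarrow> \<exists>\<tau>\<in>Y. \<forall>x\<in>gsimp s. \<phi> x \<in> gsimp \<tau> \<and> \<psi> x \<in> gsimp \<tau>"
  shows "homotopic_with (\<lambda>_. True) (geo X) (geo Y) \<phi> \<psi>"
  unfolding homotopic_with_def
proof (intro exI conjI allI ballI)
  let ?H = "\<lambda>(t, x) v. (1 - t) * \<phi> x v + t * \<psi> x v"
  show "continuous_map (prod_topology unit_interval (geo X)) (geo Y) ?H"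
  proof (rule continuous_map_from_prod_geo)
    fix s assume s: "s \<in> X"
    obtain \<tau> where \<tau>: "\<tau> \<in> Y" "\<And>x. x \<in> gsimp s \<Longrightarrow> \<phi> x \<in> gsimp \<tau> \<and> \<psi> x \<in> gsimp \<tau>"
      using carrier[OF s] by blast
    let ?P = "prod_topology unit_interval (gcell s)"
    show "continuous_map ?P (geo Y) ?H"
    proof (rule continuous_map_into_geo[of "{\<tau>}"])
      fix p assume "p \<in> topspace ?P"
      then obtain t x where p: "p = (t, x)" "0 \<le> t" "t \<le> 1" "x \<in> gsimp s" by auto
      have "\<phi> x v = 0" "\<psi> x v = 0" if "v \<notin> \<tau>" for v
        using \<tau>(2)[OF p(4)] that by (auto simp: gsimp_def gsupp_def)
      then have "?H (t, x) \<in> gsimp \<tau>"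
        using \<tau>(2)[OF p(4)] p(2,3)
        by (auto simp: gsimp_def gsupp_def sum.distrib simp flip: sum_distrib_left)
      then show "\<exists>\<tau>\<in>{\<tau>}. ?H p \<in> gsimp \<tau>" using p by auto
    next
      fix w
      have c: "continuous_map ?P euclideanreal (\<lambda>p. \<rho> (snd p) w)"
        if "continuous_map (geo X) (geo Y) \<rho>" for \<rho> :: "('v \<Rightarrow> real) \<Rightarrow> 'w \<Rightarrow> real"
        using continuous_map_compose[OF continuous_map_compose[OF
              continuous_map_compose[OF continuous_map_snd continuous_map_gcell_geo[OF s]] that]
            continuous_map_geo_coord[of Y w]]
        by (simp add: o_def)
      have "continuous_map ?P euclideanreal (\<lambda>p. (1 - fst p) * \<phi> (snd p) w + fst p * \<psi> (snd p) w)"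
        by (intro continuous_intros continuous_map_interval_fst c \<phi> \<psi>; simp)
      then show "continuous_map ?P euclideanreal (\<lambda>p. ?H p w)"
        by (simp add: case_prod_unfold)
    qed (use \<tau> in auto)
  qed
qed auto

text \<open>In the homotopy below the mass at \<open>v\<close> moves from \<open>h0 v\<close> to \<open>h1 v\<close> during the
  \<open>\<sigma> v\<close>-th of the time intervals \<open>[1 - 1/(j+1), 1 - 1/(j+2)]\<close>.\<close>

definition stage :: "nat \<Rightarrow> real \<Rightarrow> real" where
  "stage j t = min 1 (max 0 ((real j + 1) * (real j + 2) * (t - 1 + 1 / (real j + 1))))"

lemma stage_bounds: "0 \<le> stage j t" "stage j t \<le> 1"
  by (auto simp: stage_def)

lemma stage_0: "stage j 0 = 0"
  by (auto simp: stage_def mult_nonneg_nonpos)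

lemma stage_1: "stage j 1 = 1"
  by (auto simp: stage_def field_simps)

text \<open>The \<open>j\<close>-th interval has length \<open>1 / ((j + 1) * (j + 2))\<close>, the
  inverse of the slope in \<open>stage\<close>, and begins no earlier than the \<open>i\<close>-th
  ends. Together the intervals fill \<open>[0, 1)\<close>, so that arbitrarily many stages fit into
  unit time.\<close>

lemma stage_ordered:
  assumes "i < j" "0 < stage j t"
  shows "stage i t = 1"
proof -
  have "0 < (real j + 1) * (real j + 2) * (t - 1 + 1 / (real j + 1))"
    using assms(2) by (auto simp: stage_def split: if_splits)
  then have "0 < t - 1 + 1 / (real j + 1)"
    by (rule zero_less_mult_pos) simp
  moreover have "1 / (real j + 1) \<le> 1 / (real i + 2)"
    using assms(1) by (intro divide_left_mono) auto
  ultimately have "1 / (real i + 1) - 1 / (real i + 2) \<le> t - 1 + 1 / (real i + 1)"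
    by linarith
  then have "(real i + 1) * (real i + 2) * (1 / (real i + 1) - 1 / (real i + 2))
      \<le> (real i + 1) * (real i + 2) * (t - 1 + 1 / (real i + 1))"
    by (intro mult_left_mono) auto
  moreover have "(real i + 1) * (real i + 2) * (1 / (real i + 1) - 1 / (real i + 2)) = 1"
    by (simp add: right_diff_distrib)
  ultimately show ?thesis by (simp add: stage_def)
qed

text \<open>The vertices that may carry mass while stage \<open>j\<close> is under way: vertices of
  smaller \<open>\<sigma>\<close> have arrived, those of larger \<open>\<sigma>\<close> have not
  left, and those with \<open>\<sigma> v = j\<close> may be seen at both ends.\<close>

definition mixed :: "('v \<Rightarrow> 'w) \<Rightarrow> ('v \<Rightarrow> 'w) \<Rightarrow> ('v \<Rightarrow> nat) \<Rightarrow> 'v set \<Rightarrow> nat \<Rightarrow> 'w set" where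
  "mixed h0 h1 \<sigma> s j = h1 ` {v \<in> s. \<sigma> v \<le> j} \<union> h0 ` {v \<in> s. j \<le> \<sigma> v}"

text \<open>Contiguity would ask that the images of \<open>s\<close> under \<open>h0\<close> and
  \<open>h1\<close> together form a simplex; moving the vertices in the order of
  \<open>\<sigma>\<close> asks it only of the smaller sets \<open>mixed\<close>. The property
  \<open>P\<close> may be anything that follows from this carrier bound and from the rest of points
  whose vertices do not move; it yields relative homotopies as well as homotopies of pairs.\<close>

lemma homotopic_ordered:
  assumes X: "complex X" and Y: "complex Y"
    and oc: "\<And>s j. s \<in> X \<Longrightarrow> mixed h0 h1 \<sigma> s j \<in> Y"
    and P: "\<And>k. (\<And>x. x \<in> topspace (geo X) \<Longrightarrow>
        (\<exists>j. gsupp (k x) \<subseteq> mixed h0 h1 \<sigma> (gsupp x) j) \<and>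
        ((\<forall>v\<in>gsupp x. h0 v = h1 v) \<longrightarrow> k x = gmap h0 x)) \<Longrightarrow> P k"
  shows "homotopic_with P (geo X) (geo Y) (gmap h0) (gmap h1)"
proof -
  define c where "c t v w = (1 - stage (\<sigma> v) t) * of_bool (h0 v = w) + stage (\<sigma> v) t * of_bool (h1 v = w)"
    for t v w
  define H where "H p w = (\<Sum>v\<in>gsupp (snd p). snd p v * c (fst p) v w)" for p :: "real \<times> ('a \<Rightarrow> real)" and w
  have H_eq: "H (t, x) w = (\<Sum>v\<in>s. x v * c t v w)" if "x \<in> gsimp s" "finite s" for t x s w
    unfolding H_def fst_conv snd_conv using that by (intro sum_gsupp) (auto simp: gsimp_def)
  have cnn: "0 \<le> c t v w" for t v w
    using stage_bounds by (auto simp: c_def)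
  have supp: "\<exists>j\<le>Max (\<sigma> ` s). gsupp (H (t, x)) \<subseteq> mixed h0 h1 \<sigma> s j"
    if s: "finite s" "s \<noteq> {}" and x: "x \<in> gsimp s" for s t x
  proof -
    let ?A = "{v \<in> s. 0 < stage (\<sigma> v) t}"
    \<comment> \<open>The last stage that has begun. If none has, 0 is a valid value because all
      mass still sits at \<open>h0\<close>.\<close>
    define j where "j = (if ?A = {} then 0 else Max (\<sigma> ` ?A))"
    have jA: "\<sigma> v \<le> j" if "v \<in> ?A" for v
      using that s(1) by (auto simp: j_def)
    have Aj: "stage (\<sigma> v) t = 1" if "\<sigma> v < j" for v
    proof -
      have "?A \<noteq> {}" using that by (metis (lifting) j_def not_less_zero)
      then have "j \<in> \<sigma> ` ?A" using s(1) by (auto simp: j_def intro!: Max_in)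
      then show ?thesis using stage_ordered that by auto
    qed
    have "gsupp (H (t, x)) \<subseteq> mixed h0 h1 \<sigma> s j"
    proof
      fix w assume "w \<in> gsupp (H (t, x))"
      then have "(\<Sum>v\<in>s. x v * c t v w) \<noteq> 0" by (simp add: gsupp_def H_eq[OF x s(1)])
      then obtain v where v: "v \<in> s" "c t v w \<noteq> 0"
        by (metis (mono_tags, lifting) mult_zero_right sum.neutral)
      consider "h0 v = w" "stage (\<sigma> v) t \<noteq> 1" | "h1 v = w" "stage (\<sigma> v) t \<noteq> 0"
        using v(2) by (cases "h0 v = w"; cases "h1 v = w"; cases "stage (\<sigma> v) t = 1") (auto simp: c_def)
      then show "w \<in> mixed h0 h1 \<sigma> s j"
      proof cases
        case 1
        then have "j \<le> \<sigma> v" using Aj[of v] by (meson leI)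
        then show ?thesis using 1 v by (auto simp: mixed_def)
      next
        case 2
        then have "\<sigma> v \<le> j" using jA[of v] stage_bounds(1)[of "\<sigma> v" t] v by auto
        then show ?thesis using 2 v by (auto simp: mixed_def)
      qed
    qed
    moreover have "j \<le> Max (\<sigma> ` s)"
      unfolding j_def using s by (auto intro: Max_mono)
    ultimately show ?thesis by blast
  qed
  have mfin: "finite (mixed h0 h1 \<sigma> s j)" if "finite s" for s j
    using that by (auto simp: mixed_def)
  have mem: "H (t, x) \<in> gsimp m"
    if s: "finite s" and x: "x \<in> gsimp s" and m: "finite m" "gsupp (H (t, x)) \<subseteq> m"
    for s t x m
  proof -
    \<comment> \<open>The total mass is counted on a set containing both images; the bound on the
      support then leads back to \<open>m\<close>.\<close>
    let ?n = "m \<union> h0 ` s \<union> h1 ` s"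
    have xnn: "0 \<le> x v" for v using x by (auto simp: gsimp_def)
    have one: "(\<Sum>w\<in>?n. c t v w) = 1" if "v \<in> s" for v
      using m s that by (auto simp: c_def sum.distrib simp flip: sum_distrib_left)
    have "sum (H (t, x)) ?n = (\<Sum>v\<in>s. \<Sum>w\<in>?n. x v * c t v w)"
      unfolding H_eq[OF x s] by (rule sum.swap)
    also have "\<dots> = sum x s"
      using one by (intro sum.cong refl) (simp flip: sum_distrib_left)
    finally have "sum (H (t, x)) ?n = 1" using x by (simp add: gsimp_def)
    moreover have "0 \<le> H (t, x) w" for w
      unfolding H_def using cnn xnn by (intro sum_nonneg) auto
    ultimately have "H (t, x) \<in> gsimp ?n" using m by (auto simp: gsimp_def)
    then show ?thesis using gsimp_supp m s by blast
  qed
  show ?thesis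
    unfolding homotopic_with_def
  proof (intro exI[of _ H] conjI allI ballI P)
    show "continuous_map (prod_topology unit_interval (geo X)) (geo Y) H"
    proof (rule continuous_map_from_prod_geo)
      fix s assume s: "s \<in> X"
      have fin: "finite s" "s \<noteq> {}" using X s by (auto simp: complex_def)
      let ?P = "prod_topology unit_interval (gcell s)"
      show "continuous_map ?P (geo Y) H"
      proof (rule continuous_map_into_geo[of "mixed h0 h1 \<sigma> s ` {..Max (\<sigma> ` s)}"])
        fix p assume "p \<in> topspace ?P"
        then obtain t x where p: "p = (t, x)" "x \<in> gsimp s" by auto
        obtain j where j: "j \<le> Max (\<sigma> ` s)" "gsupp (H (t, x)) \<subseteq> mixed h0 h1 \<sigma> s j"
          using supp[OF fin p(2)] by blast
        then show "\<exists>\<tau>\<in>mixed h0 h1 \<sigma> s ` {..Max (\<sigma> ` s)}. H p \<in> gsimp \<tau>"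
          using mem[OF fin(1) p(2) mfin[OF fin(1)] j(2)] p by auto
      next
        fix w
        have st: "continuous_map ?P euclideanreal (\<lambda>p. stage j (fst p))" for j
          unfolding stage_def
          by (intro continuous_intros continuous_map_real_min continuous_map_real_max
              continuous_map_interval_fst; simp)
        have "continuous_map ?P euclideanreal (\<lambda>p. \<Sum>v\<in>s. snd p v * c (fst p) v w)"
          unfolding c_def
          by (intro continuous_map_sum fin continuous_intros st continuous_map_prod_gcell_coord; simp)
        then show "continuous_map ?P euclideanreal (\<lambda>p. H p w)"
          by (rule continuous_map_eq) (auto simp: H_eq[OF _ fin(1)])
      qed (use oc s in auto)
    qed
    show "H (0, x) = gmap h0 x" for x
      by (auto simp: fun_eq_iff H_def c_def stage_0 gmap_def intro!: sum.cong)
    show "H (1, x) = gmap h1 x" for x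
      by (auto simp: fun_eq_iff H_def c_def stage_1 gmap_def intro!: sum.cong)
    fix t x assume t: "t \<in> {0..1::real}" and x: "x \<in> topspace (geo X)"
    have sx: "gsupp x \<in> X" "x \<in> gsimp (gsupp x)" using x in_geo_iff[OF X] by auto
    have fx: "finite (gsupp x)" "gsupp x \<noteq> {}" using X sx by (auto simp: complex_def)
    show "\<exists>j. gsupp (H (t, x)) \<subseteq> mixed h0 h1 \<sigma> (gsupp x) j"
      using supp[OF fx sx(2)] by blast
    show "(\<forall>v\<in>gsupp x. h0 v = h1 v) \<longrightarrow> H (t, x) = gmap h0 x"
      by (auto simp: fun_eq_iff H_def c_def gmap_def algebra_simps intro!: sum.cong)
  qed
qed

section \<open>The realization of \<open>Sing K\<close>\<close>

lemma sorted_wrt_antisym_unique: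
  assumes "antisymp_on UNIV R" "sorted_wrt R xs" "sorted_wrt R ys" "distinct xs" "distinct ys" "set xs = set ys"
  shows "xs = ys"
  using assms
proof (induction xs arbitrary: ys)
  case (Cons x xs)
  then obtain y ys' where ys: "ys = y # ys'" by (cases ys) auto
  have "x = y"
  proof (rule ccontr)
    assume "x \<noteq> y"
    then have "x \<in> set ys'" "y \<in> set xs" using Cons.prems ys by auto
    then have "R y x" "R x y" using Cons.prems ys by auto
    then show False using Cons.prems(1) \<open>x \<noteq> y\<close> by (auto dest: antisympD)
  qed
  moreover have "set xs = set ys'" using Cons.prems ys \<open>x = y\<close> by auto
  ultimately show ?case using Cons ys by auto
qed simp

text \<open>One global well-order sorts every finite set. Sorting makes the list of a subset a
  sublist, which is the compatibility with faces that a section of \<open>sing_geo\<close>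
  requires.\<close>

lemma coherent_enumeration:
  obtains L :: "'a set \<Rightarrow> 'a list" where
    "\<And>s. finite s \<Longrightarrow> set (L s) = s" "\<And>s. finite s \<Longrightarrow> distinct (L s)"
    "\<And>s t. finite s \<Longrightarrow> t \<subseteq> s \<Longrightarrow> L t = filter (\<lambda>v. v \<in> t) (L s)"
proof -
  obtain r :: "'a rel" where wo: "well_order_on UNIV r"
    using well_order_on by blast
  define R where "R a b \<longleftrightarrow> (a, b) \<in> r" for a b
  have anti: "antisymp_on UNIV R"
    using wo by (auto simp: R_def antisymp_on_def well_order_on_def linear_order_on_def partial_order_on_def antisym_def)
  have ex: "\<exists>xs. set xs = s \<and> distinct xs \<and> sorted_wrt R xs" if "finite s" for s
    using that
  proof (induction "card s" arbitrary: s)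
    case 0
    then show ?case by (intro exI[of _ "[]"]) auto
  next
    case (Suc n)
    then have "s \<noteq> {}" by auto
    moreover have "wf (r - Id)" using wo by (simp add: well_order_on_def)
    ultimately obtain m where m: "m \<in> s" "\<And>y. (y, m) \<in> r - Id \<Longrightarrow> y \<notin> s"
      unfolding wf_eq_minimal by blast
    have mR: "R m y" if "y \<in> s" for y
    proof (cases "y = m")
      case True
      then show ?thesis
        using wo by (auto simp: R_def well_order_on_def linear_order_on_def partial_order_on_def
            preorder_on_def refl_on_def)
    next
      case False
      then have "(y, m) \<in> r \<or> (m, y) \<in> r"
        using wo by (auto simp: well_order_on_def linear_order_on_def total_on_def)
      then show ?thesis using m(2)[of y] that False by (auto simp: R_def)
    qed
    have "n = card (s - {m})" using Suc m by simp
    then obtain xs where "set xs = s - {m}" "distinct xs" "sorted_wrt R xs"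
      using Suc by blast
    then show ?case using m mR by (intro exI[of _ "m # xs"]) auto
  qed
  define L where "L s = (SOME xs. set xs = s \<and> distinct xs \<and> sorted_wrt R xs)" for s
  have L: "set (L s) = s \<and> distinct (L s) \<and> sorted_wrt R (L s)" if "finite s" for s
    unfolding L_def by (rule someI_ex[OF ex[OF that]])
  show thesis
  proof
    show "L t = filter (\<lambda>v. v \<in> t) (L s)" if "finite s" "t \<subseteq> s" for s t
      using L[OF that(1)] L[of t] that finite_subset[OF that(2,1)]
      by (intro sorted_wrt_antisym_unique[OF anti]) (auto intro: sorted_wrt_filter)
  qed (use L in auto)
qed

lemma sum_lessThan_add:
  fixes f :: "nat \<Rightarrow> real"
  shows "(\<Sum>i<m + k. f i) = (\<Sum>i<m. f i) + (\<Sum>i<k. f (m + i))"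
  by (induction k) auto

lemma filter_embedding:
  obtains \<phi> where "\<And>i. i < length (filter P xs) \<Longrightarrow> \<phi> i < length xs \<and> filter P xs ! i = xs ! \<phi> i"
    "\<And>i j. i \<le> j \<Longrightarrow> j < length (filter P xs) \<Longrightarrow> \<phi> i \<le> \<phi> j"
proof -
  have "\<exists>\<phi>. (\<forall>i < length (filter P xs). \<phi> i < length xs \<and> filter P xs ! i = xs ! \<phi> i) \<and>
    (\<forall>i j. i \<le> j \<and> j < length (filter P xs) \<longrightarrow> \<phi> i \<le> \<phi> j)"
  proof (induction xs)
    case (Cons x xs)
    then obtain \<phi> where \<phi>: "\<And>i. i < length (filter P xs) \<Longrightarrow> \<phi> i < length xs \<and> filter P xs ! i = xs ! \<phi> i"
      "\<And>i j. i \<le> j \<Longrightarrow> j < length (filter P xs) \<Longrightarrow> \<phi> i \<le> \<phi> j" by blast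
    show ?case
    proof (cases "P x")
      case True
      have "\<forall>i j. i \<le> j \<and> j < length (filter P (x # xs)) \<longrightarrow>
          (case i of 0 \<Rightarrow> 0 | Suc i \<Rightarrow> Suc (\<phi> i)) \<le> (case j of 0 \<Rightarrow> 0 | Suc i \<Rightarrow> Suc (\<phi> i))"
        using True \<phi>(2) by (auto split: nat.splits)
      moreover have "\<forall>i<length (filter P (x # xs)). (case i of 0 \<Rightarrow> 0 | Suc i \<Rightarrow> Suc (\<phi> i)) < length (x # xs) \<and>
          filter P (x # xs) ! i = (x # xs) ! (case i of 0 \<Rightarrow> 0 | Suc i \<Rightarrow> Suc (\<phi> i))"
        using True \<phi>(1) by (auto split: nat.splits)
      ultimately show ?thesis by blast
    next
      case False
      then show ?thesis using \<phi> by (intro exI[of _ "\<lambda>i. Suc (\<phi> i)"]) auto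
    qed
  qed auto
  then show thesis using that by blast
qed

lemma push_simplex_standard:
  assumes "delta_mor m n \<theta>" "t \<in> standard_simplex m"
  shows "push_simplex m \<theta> t \<in> standard_simplex n"
proof -
  have t: "\<And>i. 0 \<le> t i" "\<And>i. t i \<le> 1" "\<And>i. m < i \<Longrightarrow> t i = 0" "(\<Sum>i\<le>m. t i) = 1"
    using assms(2) by (auto simp: standard_simplex_def)
  have nn: "0 \<le> push_simplex m \<theta> t j" for j
    unfolding push_simplex_def by (intro sum_nonneg) (auto simp: t)
  have z: "push_simplex m \<theta> t j = 0" if "n < j" for j
    unfolding push_simplex_def using assms(1) that by (intro sum.neutral) (force simp: delta_mor_def)
  have "(\<Sum>j\<le>n. push_simplex m \<theta> t j) = (\<Sum>j\<in>{..n}. \<Sum>i\<in>{i \<in> {..m}. \<theta> i = j}. t i)"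
    unfolding push_simplex_def by (simp add: atMost_def)
  also have "\<dots> = (\<Sum>i\<le>m. t i)"
    using assms(1) by (intro sum.group) (auto simp: delta_mor_def)
  finally have s: "(\<Sum>j\<le>n. push_simplex m \<theta> t j) = 1" using t by simp
  have "push_simplex m \<theta> t j \<le> 1" for j
  proof (cases "j \<le> n")
    case True
    then have "push_simplex m \<theta> t j \<le> (\<Sum>j\<le>n. push_simplex m \<theta> t j)"
      using nn by (intro member_le_sum) auto
    then show ?thesis using s by simp
  qed (use z in auto)
  then show ?thesis using nn z s by (auto simp: standard_simplex_def)
qed

section \<open>Realizations as quotients of cells\<close>

lemma real_rel_equiv: "equiv (real_points X) (real_rel X act)"
proof -
  have "sym ((real_base X act \<union> (real_base X act)\<inverse>)\<^sup>*)"
    by (intro sym_rtrancl) (auto simp: sym_def)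
  then show ?thesis
    unfolding equiv_def real_rel_def refl_on_def sym_def trans_def
    by (blast intro: rtrancl_trans)
qed

abbreviation real_class ::
  "(nat \<Rightarrow> 'x set) \<Rightarrow> (nat \<Rightarrow> nat \<Rightarrow> (nat \<Rightarrow> nat) \<Rightarrow> 'x \<Rightarrow> 'x) \<Rightarrow>
   (nat \<times> 'x \<times> (nat \<Rightarrow> real)) \<Rightarrow> (nat \<times> 'x \<times> (nat \<Rightarrow> real)) set" where
  "real_class X act p \<equiv> real_rel X act `` {p}"

lemma real_class_act:
  assumes "delta_mor m n \<theta>" "x \<in> X n" "act m n \<theta> x \<in> X m" "t \<in> standard_simplex m"
  shows "real_class X act (m, act m n \<theta> x, t) = real_class X act (n, x, push_simplex m \<theta> t)"
proof (rule equiv_class_eq[OF real_rel_equiv])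
  show "((m, act m n \<theta> x, t), n, x, push_simplex m \<theta> t) \<in> real_rel X act"
    unfolding real_rel_def using assms push_simplex_standard[OF assms(1,4)]
    by (auto simp: real_points_def real_base_def intro!: r_into_rtrancl)
qed

lemma real_rel_invariant:
  assumes \<Phi>: "\<And>m n \<theta> x t. delta_mor m n \<theta> \<Longrightarrow> x \<in> X n \<Longrightarrow> t \<in> standard_simplex m \<Longrightarrow>
      \<Phi> (m, act m n \<theta> x, t) = \<Phi> (n, x, push_simplex m \<theta> t)"
    and pq: "(p, q) \<in> real_rel X act"
  shows "\<Phi> p = \<Phi> q"
proof -
  have "(p, q) \<in> (real_base X act \<union> (real_base X act)\<inverse>)\<^sup>*"
    using pq by (simp add: real_rel_def)
  then show ?thesis
    by (induction rule: rtrancl_induct) (use \<Phi> in \<open>auto simp: real_base_def\<close>)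
qed

text \<open>\<open>realization_map\<close> and \<open>sing_geo\<close> evaluate at an arbitrary
  representative of a class; a function invariant under the generating relation does not see the
  choice.\<close>

lemma real_class_rep:
  assumes \<Phi>: "\<And>m n \<theta> x t. delta_mor m n \<theta> \<Longrightarrow> x \<in> X n \<Longrightarrow> t \<in> standard_simplex m \<Longrightarrow>
      \<Phi> (m, act m n \<theta> x, t) = \<Phi> (n, x, push_simplex m \<theta> t)"
    and p: "p \<in> real_points X"
  shows "\<Phi> (SOME q. q \<in> real_class X act p) = \<Phi> p"
proof -
  have "p \<in> real_class X act p"
    using equiv_class_self[OF real_rel_equiv p] .
  then have "(SOME q. q \<in> real_class X act p) \<in> real_class X act p"
    by (rule someI)
  then have "(p, SOME q. q \<in> real_class X act p) \<in> real_rel X act" by simp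
  from real_rel_invariant[where \<Phi> = \<Phi>, OF \<Phi> this] show ?thesis by simp
qed

abbreviation std_cell :: "nat \<Rightarrow> (nat \<Rightarrow> real) topology" where
  "std_cell n \<equiv> subtopology (powertop_real UNIV) (standard_simplex n)"

lemma realization_final:
  "realization X act = final_topology (real_points X // real_rel X act) (Sigma UNIV X)
     (\<lambda>i. std_cell (fst i)) (\<lambda>i t. real_class X act (fst i, snd i, t))"
  unfolding realization_def final_topology_def
  by (intro arg_cong[where f = topology] ext) (auto simp: topspace_standard_simplex)

lemma real_quotient_eq:
  "real_points X // real_rel X act =
     (\<Union>i\<in>Sigma UNIV X. (\<lambda>t. real_class X act (fst i, snd i, t)) ` topspace (std_cell (fst i)))"
  by (auto simp: quotient_def real_points_def topspace_standard_simplex image_iff) blast+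

lemma topspace_realization: "topspace (realization X act) = real_points X // real_rel X act"
  unfolding realization_final by (rule topspace_final_topology) (auto simp: real_quotient_eq)

lemma continuous_map_from_realization:
  assumes "\<And>n x. x \<in> X n \<Longrightarrow> continuous_map (std_cell n) T (\<lambda>t. f (real_class X act (n, x, t)))"
  shows "continuous_map (realization X act) T f"
  unfolding realization_final
  by (rule continuous_map_from_final[OF real_quotient_eq]) (use assms in auto)

lemma continuous_map_from_prod_realization:
  assumes "\<And>n x. x \<in> X n \<Longrightarrow> continuous_map (prod_topology unit_interval (std_cell n)) T
      (\<lambda>p. f (fst p, real_class X act (n, x, snd p)))"
  shows "continuous_map (prod_topology unit_interval (realization X act)) T f"
  unfolding realization_final
  by (rule continuous_map_from_prod_final[OF real_quotient_eq]) (use assms in auto)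

lemma continuous_map_into_realization:
  assumes x: "x \<in> X n" and val: "\<And>a. a \<in> topspace A \<Longrightarrow> g a \<in> standard_simplex n"
    and coord: "\<And>i. continuous_map A euclideanreal (\<lambda>a. g a i)"
  shows "continuous_map A (realization X act) (\<lambda>a. real_class X act (n, x, g a))"
proof -
  have 1: "continuous_map A (std_cell n) g"
    using val coord by (auto simp: continuous_map_in_subtopology continuous_map_componentwise_UNIV)
  have "continuous_map (std_cell (fst (n, x))) (realization X act) (\<lambda>t. real_class X act (fst (n, x), snd (n, x), t))"
    unfolding realization_final
    by (rule continuous_map_into_final) (auto simp: real_quotient_eq x)
  from continuous_map_compose[OF 1 this[unfolded fst_conv snd_conv]] show ?thesis
    by (simp add: o_def)
qed

lemma real_class_cases:
  assumes "c \<in> topspace (realization X act)"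
  obtains n x t where "x \<in> X n" "t \<in> standard_simplex n" "c = real_class X act (n, x, t)"
  using assms by (auto simp: topspace_realization real_quotient_eq topspace_standard_simplex)

abbreviation sing_class :: "'a set set \<Rightarrow> nat \<times> 'a list \<times> (nat \<Rightarrow> real) \<Rightarrow> (nat \<times> 'a list \<times> (nat \<Rightarrow> real)) set" where
  "sing_class K \<equiv> real_class (Sing K) Sing_act"

text \<open>The point of \<open>geo K\<close> named by a weighted tuple. Tuples in
  \<open>Sing K\<close> may repeat a vertex, whose weights then add up.\<close>

definition bary :: "nat \<times> 'a list \<times> (nat \<Rightarrow> real) \<Rightarrow> 'a \<Rightarrow> real" where
  "bary p v = (case p of (n, x, t) \<Rightarrow> \<Sum>i\<le>n. if x ! i = v then t i else 0)"

lemma Sing_act_in: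
  assumes "complex K" "delta_mor m n \<theta>" "x \<in> Sing K n"
  shows "Sing_act m n \<theta> x \<in> Sing K m"
proof -
  have l: "length x = Suc n" "set x \<in> K" using assms(3) by (auto simp: Sing_def)
  have "set (Sing_act m n \<theta> x) \<subseteq> set x"
    using assms(2) l by (auto simp: Sing_act_def delta_mor_def less_Suc_eq_le)
  moreover have "set (Sing_act m n \<theta> x) \<noteq> {}" by (simp add: Sing_act_def)
  ultimately have "set (Sing_act m n \<theta> x) \<in> K"
    using complex_subset[OF assms(1) l(2)] by blast
  then show ?thesis by (simp add: Sing_def Sing_act_def)
qed

lemma sing_class_act:
  assumes "complex K" "delta_mor m n \<theta>" "x \<in> Sing K n" "t \<in> standard_simplex m"
  shows "sing_class K (m, Sing_act m n \<theta> x, t) = sing_class K (n, x, push_simplex m \<theta> t)"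
  using real_class_act[where X = "Sing K" and act = Sing_act] Sing_act_in assms by metis

lemma continuous_map_into_sing:
  assumes "x \<in> Sing K n" "\<And>a. a \<in> topspace A \<Longrightarrow> g a \<in> standard_simplex n"
    "\<And>i. continuous_map A euclideanreal (\<lambda>a. g a i)"
  shows "continuous_map A (realization (Sing K) Sing_act) (\<lambda>a. sing_class K (n, x, g a))"
  using assms continuous_map_into_realization[where X = "Sing K"] by metis

lemma Sing_act_nth: "i \<le> m \<Longrightarrow> Sing_act m n \<theta> x ! i = x ! \<theta> i"
  unfolding Sing_act_def by (simp del: upt_Suc add: less_Suc_eq_le)

lemma bary_act:
  assumes "delta_mor m n \<theta>"
  shows "bary (m, Sing_act m n \<theta> x, t) = bary (n, x, push_simplex m \<theta> t)"
proof
  fix v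
  have "bary (n, x, push_simplex m \<theta> t) v =
      (\<Sum>j\<in>{..n}. \<Sum>i\<in>{i \<in> {..m}. \<theta> i = j}. if x ! \<theta> i = v then t i else 0)"
    unfolding bary_def push_simplex_def by (auto simp: atMost_def intro!: sum.cong)
  also have "\<dots> = (\<Sum>i\<le>m. if x ! \<theta> i = v then t i else 0)"
    using assms by (intro sum.group) (auto simp: delta_mor_def)
  finally show "bary (m, Sing_act m n \<theta> x, t) v = bary (n, x, push_simplex m \<theta> t) v"
    unfolding bary_def by (auto simp: Sing_act_nth intro!: sum.cong)
qed

lemma bary_gsimp:
  assumes x: "length x = Suc n" and t: "t \<in> standard_simplex n"
  shows "bary (n, x, t) \<in> gsimp (set x)"
proof -
  have t: "\<And>i. 0 \<le> t i" "(\<Sum>i\<le>n. t i) = 1" using t by (auto simp: standard_simplex_def)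
  have "0 \<le> bary (n, x, t) v" for v
    unfolding bary_def by (auto intro!: sum_nonneg t)
  moreover have "bary (n, x, t) v = 0" if "v \<notin> set x" for v
    using that x unfolding bary_def by (auto intro!: sum.neutral)
  moreover have "sum (bary (n, x, t)) (set x) = 1"
  proof -
    have "sum (bary (n, x, t)) (set x) = (\<Sum>i\<le>n. \<Sum>v\<in>set x. if x ! i = v then t i else 0)"
      unfolding bary_def prod.case by (rule sum.swap)
    also have "\<dots> = (\<Sum>i\<le>n. t i)"
      using x by (intro sum.cong refl) (simp add: sum.delta less_Suc_eq_le)
    finally show ?thesis using t by simp
  qed
  ultimately show ?thesis by (auto simp: gsimp_def gsupp_def)
qed

definition sing_geo :: "(nat \<times> 'a list \<times> (nat \<Rightarrow> real)) set \<Rightarrow> 'a \<Rightarrow> real" where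
  "sing_geo c = bary (SOME p. p \<in> c)"

lemma sing_geo_class:
  assumes "x \<in> Sing K n" "t \<in> standard_simplex n"
  shows "sing_geo (sing_class K (n, x, t)) = bary (n, x, t)"
  unfolding sing_geo_def using assms
  by (intro real_class_rep[where \<Phi> = bary]) (auto intro: bary_act simp: real_points_def)

lemma continuous_map_std_coord: "continuous_map (std_cell n) euclideanreal (\<lambda>t. t i)"
  by (intro continuous_map_from_subtopology continuous_map_product_projection) simp

lemma continuous_map_sing_geo:
  "continuous_map (realization (Sing K) Sing_act) (geo K) sing_geo"
proof (rule continuous_map_from_realization)
  fix n x assume x: "x \<in> Sing K n"
  have l: "length x = Suc n" "set x \<in> K" using x by (auto simp: Sing_def)
  have "continuous_map (std_cell n) (geo K) (\<lambda>t. bary (n, x, t))"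
  proof (rule continuous_map_into_geo[of "{set x}"])
    show "continuous_map (std_cell n) euclideanreal (\<lambda>t. bary (n, x, t) w)" for w
      unfolding bary_def prod.case
      by (intro continuous_map_sum) (auto simp: continuous_map_std_coord)
  qed (use l bary_gsimp[OF l(1)] in \<open>auto simp: topspace_standard_simplex\<close>)
  then show "continuous_map (std_cell n) (geo K) (\<lambda>t. sing_geo (sing_class K (n, x, t)))"
    by (rule continuous_map_eq) (auto simp: sing_geo_class[OF x] topspace_standard_simplex)
qed

text \<open>\<open>Sing K\<close> has a simplex for every tuple, so \<open>sing_geo\<close> is far
  from injective. A section sends a point to the tuple that lists its support in a fixed order. The
  other composite is joined to the identity inside the tuples \<open>x @ L (set x)\<close>, which
  belong to \<open>Sing K\<close> because their entries are those of \<open>x\<close>: weight is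
  shifted from the first block to the second.\<close>

lemma hinverse_sing_geo:
  assumes K: "complex K"
  obtains \<sigma> where "hinverse (realization (Sing K) Sing_act) (geo K) sing_geo \<sigma>"
proof -
  obtain L :: "'a set \<Rightarrow> 'a list" where
    L_set: "\<And>s. finite s \<Longrightarrow> set (L s) = s" and L_dist: "\<And>s. finite s \<Longrightarrow> distinct (L s)"
    and L_filter: "\<And>s t. finite s \<Longrightarrow> t \<subseteq> s \<Longrightarrow> L t = filter (\<lambda>v. v \<in> t) (L s)"
    by (rule coherent_enumeration) blast
  have L_len: "length (L s) = Suc (card s - 1)" if "finite s" "s \<noteq> {}" for s
    using that L_set L_dist distinct_card[of "L s"] by (metis Suc_diff_1 card_gt_0_iff)
  have L_sing: "L s \<in> Sing K (card s - 1)" if "s \<in> K" for s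
    using L_set L_len[of s] complex_finite[OF K that] complex_nonempty[OF K that] that by (simp add: Sing_def)
  define crd where "crd s y = (\<lambda>j. if j < length (L s) then y (L s ! j) else 0)" for s and y :: "'a \<Rightarrow> real"
  have crd_std: "crd s y \<in> standard_simplex (card s - 1)" if "finite s" "y \<in> gsimp s" for s y
  proof -
    have ne: "s \<noteq> {}" using that by (auto simp: gsimp_def)
    have y: "\<And>v. 0 \<le> y v" "sum y s = 1" using that by (auto simp: gsimp_def)
    have le1: "y v \<le> 1" for v
    proof (cases "v \<in> s")
      case True
      then show ?thesis using member_le_sum[of v s y] y that by auto
    next
      case False
      then have "y v = 0" using that(2) by (auto simp: gsimp_def gsupp_def)
      then show ?thesis by simp
    qed
    have "(\<Sum>j\<le>card s - 1. crd s y j) = (\<Sum>j<length (L s). y (L s ! j))"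
      unfolding crd_def L_len[OF that(1) ne] lessThan_Suc_atMost by (intro sum.cong) auto
    also have "\<dots> = sum y (set (L s))"
      using L_dist[OF that(1)]
      by (simp add: sum.distinct_set_conv_list sum_list_sum_nth atLeast0LessThan)
    finally show ?thesis
      using y le1 L_set that L_len[OF that(1) ne] by (auto simp: standard_simplex_def crd_def)
  qed
  \<comment> \<open>The order embedding of the sublist realises the face. The last clause says that
    pushing coordinates along it inserts zeros.\<close>
  have face: "\<exists>\<phi>. delta_mor (card t - 1) (card s - 1) \<phi> \<and> L t = Sing_act (card t - 1) (card s - 1) \<phi> (L s) \<and>
      (\<forall>y j. j < length (L s) \<longrightarrow> (\<forall>v. v \<notin> t \<longrightarrow> y v = 0) \<longrightarrow>
         (\<Sum>i\<in>{i. i \<le> card t - 1 \<and> \<phi> i = j}. y (L t ! i)) = (y (L s ! j) :: real))"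
    if s: "finite s" and t: "t \<subseteq> s" "t \<noteq> {}" for s t
  proof -
    have fin: "finite t" and ne: "s \<noteq> {}" using s t finite_subset by auto
    note Lt = L_filter[OF s t(1)]
    obtain \<phi> where \<phi>: "\<And>i. i < length (L t) \<Longrightarrow> \<phi> i < length (L s) \<and> L t ! i = L s ! \<phi> i"
      "\<And>i j. i \<le> j \<Longrightarrow> j < length (L t) \<Longrightarrow> \<phi> i \<le> \<phi> j"
      unfolding Lt by (rule filter_embedding) blast
    have lt: "length (L t) = Suc (card t - 1)" and ls: "length (L s) = Suc (card s - 1)"
      using L_len fin s t ne by auto
    have "delta_mor (card t - 1) (card s - 1) \<phi>"
      using \<phi> unfolding lt ls delta_mor_def by (auto simp: less_Suc_eq_le)
    moreover have "L t = Sing_act (card t - 1) (card s - 1) \<phi> (L s)"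
    proof (rule nth_equalityI)
      show "length (L t) = length (Sing_act (card t - 1) (card s - 1) \<phi> (L s))"
        by (simp add: lt Sing_act_def)
      show "L t ! i = Sing_act (card t - 1) (card s - 1) \<phi> (L s) ! i" if "i < length (L t)" for i
        using that \<phi>(1)[OF that] by (simp add: lt Sing_act_nth)
    qed
    moreover have "(\<Sum>i\<in>{i. i \<le> card t - 1 \<and> \<phi> i = j}. y (L t ! i)) = y (L s ! j)"
      if j: "j < length (L s)" and y: "\<forall>v. v \<notin> t \<longrightarrow> y v = 0" for j and y :: "'a \<Rightarrow> real"
    proof (cases "L s ! j \<in> t")
      case True
      then obtain i where i: "i < length (L t)" "L t ! i = L s ! j"
        using L_set[OF fin] by (metis in_set_conv_nth)
      have "\<phi> i = j"
        using \<phi>(1)[OF i(1)] i(2) j L_dist[OF s] by (metis nth_eq_iff_index_eq)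
      moreover have "i' = i" if "i' < length (L t)" "\<phi> i' = j" for i'
        using \<phi>(1)[OF that(1)] that i L_dist[OF fin] by (metis nth_eq_iff_index_eq)
      ultimately have "{i. i \<le> card t - 1 \<and> \<phi> i = j} = {i}"
        using i(1) unfolding lt less_Suc_eq_le by blast
      then show ?thesis using i by simp
    next
      case False
      have "\<phi> i \<noteq> j" if "i \<le> card t - 1" for i
      proof -
        have "i < length (L t)" using that lt by simp
        then have "L t ! i \<in> t" "L t ! i = L s ! \<phi> i" using \<phi>(1) L_set[OF fin] nth_mem by blast+
        then show ?thesis using False by auto
      qed
      then have "{i. i \<le> card t - 1 \<and> \<phi> i = j} = {}" by blast
      then show ?thesis using False y by (simp only: sum.empty) simp
    qed
    ultimately show ?thesis by blast
  qed
  define \<sigma> where "\<sigma> y = sing_class K (card (gsupp y) - 1, L (gsupp y), crd (gsupp y) y)" for y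
  \<comment> \<open>Any simplex containing \<open>y\<close> may replace its support, so that
    \<open>\<sigma>\<close> has one formula on each closed cell.\<close>
  have \<sigma>_eq: "\<sigma> y = sing_class K (card s - 1, L s, crd s y)" if s: "s \<in> K" and y: "y \<in> gsimp s" for s y
  proof -
    have fs: "finite s" "s \<noteq> {}" using complex_finite[OF K s] complex_nonempty[OF K s] by auto
    have t: "gsupp y \<subseteq> s" "gsupp y \<noteq> {}" using y gsimp_gsupp_ne by (auto simp: gsimp_def)
    let ?m = "card (gsupp y) - 1" and ?n = "card s - 1"
    obtain \<phi> where \<phi>: "delta_mor ?m ?n \<phi>" "L (gsupp y) = Sing_act ?m ?n \<phi> (L s)"
      "\<And>j. j < length (L s) \<Longrightarrow> (\<Sum>i\<in>{i. i \<le> ?m \<and> \<phi> i = j}. y (L (gsupp y) ! i)) = y (L s ! j)"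
      using face[OF fs(1) t] by (auto simp: gsupp_def)
    have ft: "finite (gsupp y)" using t fs finite_subset by blast
    have yt: "y \<in> gsimp (gsupp y)" using gsimp_supp[OF y fs(1) _ ft] by simp
    have lt: "length (L (gsupp y)) = Suc ?m" and ls: "length (L s) = Suc ?n"
      using L_len ft t fs by auto
    have "push_simplex ?m \<phi> (crd (gsupp y) y) = crd s y"
    proof
      fix j
      show "push_simplex ?m \<phi> (crd (gsupp y) y) j = crd s y j"
      proof (cases "j < length (L s)")
        case True
        have "push_simplex ?m \<phi> (crd (gsupp y) y) j = (\<Sum>i\<in>{i. i \<le> ?m \<and> \<phi> i = j}. y (L (gsupp y) ! i))"
          unfolding push_simplex_def crd_def lt by (intro sum.cong) auto
        then show ?thesis using \<phi>(3)[OF True] True by (simp add: crd_def)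
      next
        case False
        then have "{i. i \<le> ?m \<and> \<phi> i = j} = {}"
          using \<phi>(1) ls by (auto simp: delta_mor_def)
        then show ?thesis using False unfolding push_simplex_def crd_def by (simp only: sum.empty) simp
      qed
    qed
    then show ?thesis
      unfolding \<sigma>_def using sing_class_act[OF K \<phi>(1) L_sing[OF s] crd_std[OF ft yt]]
      by (simp only: \<phi>(2)[symmetric])
  qed
  have c\<sigma>: "continuous_map (geo K) (realization (Sing K) Sing_act) \<sigma>"
  proof (rule continuous_map_from_geo)
    fix s assume s: "s \<in> K"
    then have fs: "finite s" by (rule complex_finite[OF K])
    have "continuous_map (gcell s) (realization (Sing K) Sing_act)
        (\<lambda>y. sing_class K (card s - 1, L s, crd s y))"
      by (rule continuous_map_into_sing[OF L_sing[OF s]])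
        (use crd_std[OF fs] in \<open>auto simp: if_distrib continuous_map_gcell_coord crd_def cong: if_cong\<close>)
    then show "continuous_map (gcell s) (realization (Sing K) Sing_act) \<sigma>"
      by (rule continuous_map_eq) (auto simp: \<sigma>_eq[OF s])
  qed
  have \<pi>\<sigma>: "sing_geo (\<sigma> y) = y" if "y \<in> topspace (geo K)" for y
  proof -
    have y: "gsupp y \<in> K" "y \<in> gsimp (gsupp y)" using that in_geo_iff[OF K] by auto
    let ?s = "gsupp y"
    have fs: "finite ?s" "?s \<noteq> {}" using complex_finite[OF K y(1)] complex_nonempty[OF K y(1)] by auto
    have ls: "length (L ?s) = Suc (card ?s - 1)" using L_len[OF fs] .
    have "bary (card ?s - 1, L ?s, crd ?s y) v = y v" for v
    proof (cases "v \<in> ?s")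
      case True
      then obtain i where i: "i < length (L ?s)" "L ?s ! i = v"
        using L_set[OF fs(1)] by (metis in_set_conv_nth)
      have "bary (card ?s - 1, L ?s, crd ?s y) v = (\<Sum>j\<le>card ?s - 1. if j = i then y v else 0)"
        unfolding bary_def prod.case using i ls L_dist[OF fs(1)]
        by (intro sum.cong) (auto simp: crd_def nth_eq_iff_index_eq)
      then show ?thesis using i ls by simp
    next
      case False
      then have "L ?s ! j \<noteq> v" if "j \<le> card ?s - 1" for j
        using that ls L_set[OF fs(1)] nth_mem[of j "L ?s"] by auto
      then show ?thesis using False unfolding bary_def by (auto simp: gsupp_def intro!: sum.neutral)
    qed
    then show ?thesis
      unfolding \<sigma>_def using sing_geo_class[OF L_sing[OF y(1)] crd_std[OF fs(1) y(2)]] by auto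
  qed
  \<comment> \<open>Weights on \<open>x @ L (set x)\<close>: the share \<open>1 - s\<close> stays on
    the first \<open>Suc n\<close> entries, the share \<open>s\<close> is spread over the list of
    vertices according to the same point of \<open>geo K\<close>.\<close>
  define mix where "mix p = (case p of (s, n, x, t) \<Rightarrow>
      \<lambda>i. if i \<le> n then (1 - s) * t i else s * crd (set x) (bary (n, x, t)) (i - Suc n))"
    for p :: "real \<times> nat \<times> 'a list \<times> (nat \<Rightarrow> real)"
  \<comment> \<open>\<open>x\<close> has \<open>n + 1\<close> entries, so the concatenation has
    dimension \<open>n + length (L (set x))\<close>.\<close>
  define top where "top n x = n + length (L (set x))" for n :: nat and x
  define \<Phi> where "\<Phi> s p = (case p of (n, x, t) \<Rightarrow> sing_class K (top n x, x @ L (set x), mix (s, n, x, t)))"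
    for s p
  have cat_sing: "x @ L (set x) \<in> Sing K (top n x)" if "x \<in> Sing K n" for n x
    using that L_set[of "set x"] by (auto simp: Sing_def top_def)
  have mix_std: "mix (s, n, x, t) \<in> standard_simplex (top n x)"
    if s: "0 \<le> s" "s \<le> 1" and x: "x \<in> Sing K n" and t: "t \<in> standard_simplex n" for s n x t
  proof -
    have l: "length x = Suc n" using x by (simp add: Sing_def)
    let ?S = "set x" and ?b = "bary (n, x, t)"
    have ne: "?S \<noteq> {}" using l by auto
    have cs: "crd ?S ?b \<in> standard_simplex (card ?S - 1)"
      using crd_std[OF _ bary_gsimp[OF l t]] by simp
    have len: "length (L ?S) = Suc (card ?S - 1)" using L_len ne by auto
    let ?N = "Suc (card ?S - 1)"
    have c: "\<And>i. 0 \<le> crd ?S ?b i" "\<And>i. crd ?S ?b i \<le> 1" "\<And>i. card ?S - 1 < i \<Longrightarrow> crd ?S ?b i = 0"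
        "(\<Sum>i<?N. crd ?S ?b i) = 1"
      using cs by (auto simp: standard_simplex_def lessThan_Suc_atMost)
    have t': "\<And>i. 0 \<le> t i" "\<And>i. t i \<le> 1" "(\<Sum>i<Suc n. t i) = 1"
      using t by (auto simp: standard_simplex_def lessThan_Suc_atMost)
    have top: "Suc (top n x) = Suc n + ?N" by (simp add: top_def len)
    have "(\<Sum>i\<le>top n x. mix (s, n, x, t) i) = (\<Sum>i<Suc n + ?N. mix (s, n, x, t) i)"
      unfolding lessThan_Suc_atMost[symmetric] top ..
    also have "\<dots> = (\<Sum>i<Suc n. mix (s, n, x, t) i) + (\<Sum>i<?N. mix (s, n, x, t) (Suc n + i))"
      by (rule sum_lessThan_add)
    also have "\<dots> = (\<Sum>i<Suc n. (1 - s) * t i) + (\<Sum>i<?N. s * crd ?S ?b i)"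
      by (intro arg_cong2[where f = "(+)"] sum.cong) (auto simp: mix_def)
    also have "\<dots> = 1"
      unfolding sum_distrib_left[symmetric] using t' c by simp
    finally have "(\<Sum>i\<le>top n x. mix (s, n, x, t) i) = 1" .
    moreover have "mix (s, n, x, t) i = 0" if "top n x < i" for i
      using that c(3) by (auto simp: mix_def top_def len)
    moreover have "0 \<le> mix (s, n, x, t) i" "mix (s, n, x, t) i \<le> 1" for i
      using s t' c by (auto simp: mix_def intro!: mult_le_one)
    ultimately show ?thesis by (auto simp: standard_simplex_def)
  qed
  \<comment> \<open>Naturality: a morphism \<open>\<theta>\<close> acts on the first block and
    induces the embedding \<open>\<phi>\<close> on the second; together they form one morphism
    \<open>\<psi>\<close> between the concatenations.\<close>
  have \<Phi>_act: "\<Phi> s (m, Sing_act m n \<theta> x, t) = \<Phi> s (n, x, push_simplex m \<theta> t)"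
    if s: "0 \<le> s" "s \<le> 1" and \<theta>: "delta_mor m n \<theta>" and x: "x \<in> Sing K n" and t: "t \<in> standard_simplex m"
    for s m n \<theta> x t
  proof -
    let ?x = "Sing_act m n \<theta> x" and ?t = "push_simplex m \<theta> t"
    have x': "?x \<in> Sing K m" by (rule Sing_act_in[OF K \<theta> x])
    have l: "length x = Suc n" "length ?x = Suc m" using x x' by (auto simp: Sing_def)
    have sub: "set ?x \<subseteq> set x"
      using \<theta> l by (auto simp: Sing_act_def delta_mor_def less_Suc_eq_le)
    have ne: "set ?x \<noteq> {}" "set x \<noteq> {}" using l by auto
    obtain \<phi> where \<phi>: "delta_mor (card (set ?x) - 1) (card (set x) - 1) \<phi>"
      "L (set ?x) = Sing_act (card (set ?x) - 1) (card (set x) - 1) \<phi> (L (set x))"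
      "\<And>y j. j < length (L (set x)) \<Longrightarrow> (\<And>v. v \<notin> set ?x \<Longrightarrow> y v = 0) \<Longrightarrow>
         (\<Sum>i\<in>{i. i \<le> card (set ?x) - 1 \<and> \<phi> i = j}. y (L (set ?x) ! i)) = (y (L (set x) ! j) :: real)"
      using face[OF _ sub ne(1)] by auto
    have len: "length (L (set x)) = Suc (card (set x) - 1)" "length (L (set ?x)) = Suc (card (set ?x) - 1)"
      using L_len ne by auto
    have b: "bary (m, ?x, t) = bary (n, x, ?t)" by (rule bary_act[OF \<theta>])
    have b0: "bary (n, x, ?t) v = 0" if "v \<notin> set ?x" for v
      using bary_gsimp[OF l(2) t] that unfolding b by (auto simp: gsimp_def gsupp_def)
    define \<psi> where "\<psi> i = (if i \<le> m then \<theta> i else Suc n + \<phi> (i - Suc m))" for i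
    have \<psi>: "delta_mor (top m ?x) (top n x) \<psi>"
      using \<theta> \<phi>(1) unfolding delta_mor_def \<psi>_def top_def len
      by (auto simp: le_diff_conv2 not_le)
    have act: "Sing_act (top m ?x) (top n x) \<psi> (x @ L (set x)) = ?x @ L (set ?x)"
    proof (rule nth_equalityI)
      show "length (Sing_act (top m ?x) (top n x) \<psi> (x @ L (set x))) = length (?x @ L (set ?x))"
        using l by (simp add: Sing_act_def top_def)
      fix i assume "i < length (Sing_act (top m ?x) (top n x) \<psi> (x @ L (set x)))"
      then have i: "i \<le> top m ?x" by (simp add: Sing_act_def)
      show "Sing_act (top m ?x) (top n x) \<psi> (x @ L (set x)) ! i = (?x @ L (set ?x)) ! i"
      proof (cases "i \<le> m")
        case True
        then have "\<theta> i \<le> n" using \<theta> by (simp add: delta_mor_def)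
        then show ?thesis using True i l by (simp add: Sing_act_nth nth_append \<psi>_def)
      next
        case False
        then have "i - Suc m \<le> card (set ?x) - 1" using i by (simp add: top_def len)
        then have "L (set ?x) ! (i - Suc m) = L (set x) ! \<phi> (i - Suc m)"
          using \<phi>(2) Sing_act_nth by metis
        then show ?thesis using False i l by (simp add: Sing_act_nth nth_append \<psi>_def)
      qed
    qed
    have push: "push_simplex (top m ?x) \<psi> (mix (s, m, ?x, t)) = mix (s, n, x, ?t)"
    proof
      fix j
      show "push_simplex (top m ?x) \<psi> (mix (s, m, ?x, t)) j = mix (s, n, x, ?t) j"
      proof (cases "j \<le> n")
        case True
        have "{i. i \<le> top m ?x \<and> \<psi> i = j} = {i. i \<le> m \<and> \<theta> i = j}"
          using True by (auto simp: \<psi>_def top_def split: if_splits)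
        then show ?thesis
          using True unfolding push_simplex_def by (auto simp: mix_def sum_distrib_left intro!: sum.cong)
      next
        case False
        have eq: "{i. i \<le> top m ?x \<and> \<psi> i = j} = (\<lambda>i. Suc m + i) ` {i. i \<le> card (set ?x) - 1 \<and> \<phi> i = j - Suc n}"
        proof (intro equalityI subsetI)
          fix i assume i: "i \<in> {i. i \<le> top m ?x \<and> \<psi> i = j}"
          then have "\<not> i \<le> m" using False \<theta> by (auto simp: \<psi>_def delta_mor_def)
          then show "i \<in> (\<lambda>i. Suc m + i) ` {i. i \<le> card (set ?x) - 1 \<and> \<phi> i = j - Suc n}"
            using i by (intro image_eqI[of _ _ "i - Suc m"]) (auto simp: \<psi>_def top_def len)
        next
          fix i assume "i \<in> (\<lambda>i. Suc m + i) ` {i. i \<le> card (set ?x) - 1 \<and> \<phi> i = j - Suc n}"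
          then show "i \<in> {i. i \<le> top m ?x \<and> \<psi> i = j}"
            using False by (auto simp: \<psi>_def top_def len)
        qed
        have "push_simplex (top m ?x) \<psi> (mix (s, m, ?x, t)) j =
            (\<Sum>i\<in>{i. i \<le> card (set ?x) - 1 \<and> \<phi> i = j - Suc n}. s * bary (n, x, ?t) (L (set ?x) ! i))"
          unfolding push_simplex_def[of "top m ?x"] eq
          by (subst sum.reindex) (auto simp: mix_def crd_def len b intro!: sum.cong)
        also have "\<dots> = s * crd (set x) (bary (n, x, ?t)) (j - Suc n)"
        proof (cases "j - Suc n < length (L (set x))")
          case True
          then show ?thesis
            using \<phi>(3)[OF True, of "bary (n, x, ?t)"] b0 by (simp add: crd_def flip: sum_distrib_left)
        next
          case nle: False
          then have "{i. i \<le> card (set ?x) - 1 \<and> \<phi> i = j - Suc n} = {}"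
            using \<phi>(1) len by (auto simp: delta_mor_def)
          then show ?thesis using nle by (simp only: crd_def) simp
        qed
        finally show ?thesis using False by (simp add: mix_def)
      qed
    qed
    show ?thesis
      unfolding \<Phi>_def prod.case act[symmetric] push[symmetric]
      by (intro sing_class_act K \<psi> cat_sing x mix_std s x' t)
  qed
  have \<Phi>_rep: "\<Phi> s (SOME q. q \<in> sing_class K (n, x, t)) = \<Phi> s (n, x, t)"
    if "0 \<le> s" "s \<le> 1" "x \<in> Sing K n" "t \<in> standard_simplex n" for s n x t
    using that by (intro real_class_rep[where \<Phi> = "\<Phi> s"] \<Phi>_act) (auto simp: real_points_def)
  \<comment> \<open>At \<open>s = 0\<close> all weight lies on the face of the first block; at
    \<open>s = 1\<close> it lies on that of the second, whose inclusion is the shift by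
    \<open>Suc n\<close>.\<close>
  have \<Phi>0: "\<Phi> 0 (n, x, t) = sing_class K (n, x, t)" if x: "x \<in> Sing K n" and t: "t \<in> standard_simplex n" for n x t
  proof -
    have l: "length x = Suc n" using x by (simp add: Sing_def)
    have d: "delta_mor n (top n x) id" by (auto simp: delta_mor_def top_def)
    have a: "Sing_act n (top n x) id (x @ L (set x)) = x"
      using l by (intro nth_equalityI) (auto simp: Sing_act_def nth_append simp del: upt_Suc)
    have "push_simplex n id t = mix (0, n, x, t)"
    proof
      fix j
      have "{i. i \<le> n \<and> id i = j} = (if j \<le> n then {j} else {})" by auto
      then have "push_simplex n id t j = (if j \<le> n then t j else 0)"
        unfolding push_simplex_def by simp
      then show "push_simplex n id t j = mix (0, n, x, t) j" by (simp add: mix_def)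
    qed
    then show ?thesis
      using sing_class_act[OF K d cat_sing[OF x] t] unfolding a \<Phi>_def by simp
  qed
  have \<Phi>1: "\<Phi> 1 (n, x, t) = \<sigma> (bary (n, x, t))" if x: "x \<in> Sing K n" and t: "t \<in> standard_simplex n" for n x t
  proof -
    have l: "length x = Suc n" "set x \<in> K" using x by (auto simp: Sing_def)
    have ne: "set x \<noteq> {}" using l by auto
    let ?m = "card (set x) - 1" and ?b = "bary (n, x, t)"
    have len: "length (L (set x)) = Suc ?m" using L_len ne by auto
    have b: "?b \<in> gsimp (set x)" by (rule bary_gsimp[OF l(1) t])
    have d: "delta_mor ?m (top n x) (\<lambda>j. Suc n + j)" by (auto simp: delta_mor_def top_def len)
    have a: "Sing_act ?m (top n x) (\<lambda>j. Suc n + j) (x @ L (set x)) = L (set x)"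
      using l len by (intro nth_equalityI) (auto simp: Sing_act_def nth_append simp del: upt_Suc)
    have "push_simplex ?m (\<lambda>j. Suc n + j) (crd (set x) ?b) = mix (1, n, x, t)"
    proof
      fix j
      have "{i. i \<le> ?m \<and> Suc n + i = j} = (if n < j \<and> j - Suc n \<le> ?m then {j - Suc n} else {})"
        by auto
      then have "push_simplex ?m (\<lambda>j. Suc n + j) (crd (set x) ?b) j =
          (if n < j \<and> j - Suc n \<le> ?m then crd (set x) ?b (j - Suc n) else 0)"
        unfolding push_simplex_def by simp
      then show "push_simplex ?m (\<lambda>j. Suc n + j) (crd (set x) ?b) j = mix (1, n, x, t) j"
        by (auto simp: mix_def crd_def len)
    qed
    then show ?thesis
      using sing_class_act[OF K d cat_sing[OF x] crd_std[OF _ b]] \<sigma>_eq[OF l(2) b]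
      unfolding a \<Phi>_def by simp
  qed
  have "homotopic_with (\<lambda>_. True) (realization (Sing K) Sing_act) (realization (Sing K) Sing_act) id (\<sigma> \<circ> sing_geo)"
  proof (subst homotopic_with)
    let ?X = "realization (Sing K) Sing_act"
    let ?H = "\<lambda>p. \<Phi> (fst p) (SOME q. q \<in> snd p)"
    have "continuous_map (prod_topology unit_interval ?X) ?X ?H"
    proof (rule continuous_map_from_prod_realization)
      fix n x assume x: "x \<in> Sing K n"
      let ?P = "prod_topology unit_interval (std_cell n)"
      have cc: "continuous_map ?P euclideanreal (\<lambda>p. snd p i)" for i
        using continuous_map_compose[OF continuous_map_snd continuous_map_std_coord] by (auto simp: o_def)
      have "continuous_map ?P ?X (\<lambda>p. sing_class K (top n x, x @ L (set x), mix (fst p, n, x, snd p)))"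
      proof (rule continuous_map_into_sing[OF cat_sing[OF x]])
        show "mix (fst p, n, x, snd p) \<in> standard_simplex (top n x)" if "p \<in> topspace ?P" for p
          using that by (intro mix_std x) (auto simp: topspace_standard_simplex)
        have cb: "continuous_map ?P euclideanreal (\<lambda>p. crd (set x) (bary (n, x, snd p)) i)" for i
          unfolding crd_def bary_def prod.case
          by (cases "i < length (L (set x))") (auto intro!: continuous_map_sum cc simp: if_distrib cong: if_cong)
        show "continuous_map ?P euclideanreal (\<lambda>p. mix (fst p, n, x, snd p) i)" for i
          unfolding mix_def prod.case
          by (cases "i \<le> n") (auto intro!: continuous_intros continuous_map_interval_fst cc cb)
      qed
      then show "continuous_map ?P ?X (\<lambda>p. ?H (fst p, sing_class K (n, x, snd p)))"
      proof (rule continuous_map_eq)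
        fix p assume "p \<in> topspace ?P"
        then have p: "0 \<le> fst p" "fst p \<le> 1" "snd p \<in> standard_simplex n"
          by (auto simp: topspace_standard_simplex)
        show "sing_class K (top n x, x @ L (set x), mix (fst p, n, x, snd p)) = ?H (fst p, sing_class K (n, x, snd p))"
          unfolding fst_conv snd_conv \<Phi>_rep[OF p(1,2) x p(3)] by (simp only: \<Phi>_def prod.case)
      qed
    qed
    moreover have "?H (0, c) = c \<and> ?H (1, c) = \<sigma> (sing_geo c)" if cX: "c \<in> topspace ?X" for c
    proof -
      obtain n x t where x: "x \<in> Sing K n" and t: "t \<in> standard_simplex n" and c: "c = sing_class K (n, x, t)"
        using cX by (rule real_class_cases)
      show ?thesis
        using \<Phi>_rep[OF _ _ x t, of 0] \<Phi>_rep[OF _ _ x t, of 1] unfolding c fst_conv snd_conv sing_geo_class[OF x t] \<Phi>0[OF x t] \<Phi>1[OF x t]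
        by simp
    qed
    ultimately show "\<exists>h. continuous_map (prod_topology unit_interval ?X) ?X h \<and>
        (\<forall>x\<in>topspace ?X. h (0, x) = id x) \<and> (\<forall>x\<in>topspace ?X. h (1, x) = (\<sigma> \<circ> sing_geo) x) \<and>
        (\<forall>t\<in>{0..1::real}. True)"
      by (intro exI[of _ ?H]) auto
  qed simp
  moreover have "homotopic_with (\<lambda>_. True) (geo K) (geo K) (sing_geo \<circ> \<sigma>) id"
    using c\<sigma> \<pi>\<sigma> by (intro homotopic_with_equal continuous_map_compose[OF _ continuous_map_sing_geo]) auto
  ultimately have "hinverse (realization (Sing K) Sing_act) (geo K) sing_geo \<sigma>"
    using c\<sigma> continuous_map_sing_geo homotopic_with_symD unfolding hinverse_def by blast
  then show thesis by (rule that)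
qed

lemma Sing_map_in: "cpx_map K L f \<Longrightarrow> x \<in> Sing K n \<Longrightarrow> Sing_map f n x \<in> Sing L n"
  by (auto simp: Sing_def Sing_map_def cpx_map_def)

lemma realization_map_class:
  assumes K: "complex K" and L: "complex L" and f: "cpx_map K L f"
    and x: "x \<in> Sing K n" and t: "t \<in> standard_simplex n"
  shows "realization_map (Sing L) Sing_act (Sing_map f) (sing_class K (n, x, t)) = sing_class L (n, map f x, t)"
proof -
  let ?\<Phi> = "\<lambda>p. case p of (n, x, t) \<Rightarrow> sing_class L (n, Sing_map f n x, t)"
  have "?\<Phi> (m, Sing_act m n \<theta> x, t) = ?\<Phi> (n, x, push_simplex m \<theta> t)"
    if "delta_mor m n \<theta>" "x \<in> Sing K n" "t \<in> standard_simplex m" for m n \<theta> x t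
  proof -
    have "\<theta> i < length x" if "i \<le> m" for i
      using \<open>delta_mor m n \<theta>\<close> \<open>x \<in> Sing K n\<close> that by (auto simp: delta_mor_def Sing_def less_Suc_eq_le)
    then have "Sing_map f m (Sing_act m n \<theta> x) = Sing_act m n \<theta> (Sing_map f n x)"
      by (auto simp: Sing_map_def Sing_act_def)
    then show ?thesis
      using sing_class_act[OF L that(1) Sing_map_in[OF f that(2)] that(3)] by simp
  qed
  then have "?\<Phi> (SOME q. q \<in> sing_class K (n, x, t)) = ?\<Phi> (n, x, t)"
    using x t by (intro real_class_rep[where \<Phi> = ?\<Phi>]) (auto simp: real_points_def)
  then show ?thesis
    by (simp add: realization_map_def Sing_map_def)
qed

text \<open>\<open>sing_geo\<close> is a natural homotopy equivalence, so it cancels on both sides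
  of its naturality square. From here on weak equivalences are treated in
  \<open>geo\<close>.\<close>

lemma cpx_weq_iff_geo:
  assumes K: "complex K" and L: "complex L" and f: "cpx_map K L f"
  shows "cpx_weq K L f \<longleftrightarrow> weak_homotopy_equivalence (geo K) (geo L) (gmap f)"
proof -
  let ?K = "realization (Sing K) Sing_act" and ?L = "realization (Sing L) Sing_act"
  let ?f = "realization_map (Sing L) Sing_act (Sing_map f)"
  obtain \<sigma> where \<sigma>: "hinverse ?K (geo K) sing_geo \<sigma>" using hinverse_sing_geo[OF K] .
  obtain \<tau> where \<tau>: "hinverse ?L (geo L) sing_geo \<tau>" using hinverse_sing_geo[OF L] .
  have cf: "continuous_map ?K ?L ?f"
  proof (rule continuous_map_from_realization)
    fix n x assume x: "x \<in> Sing K n"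
    have "continuous_map (std_cell n) ?L (\<lambda>t. sing_class L (n, Sing_map f n x, t))"
      by (rule continuous_map_into_sing[OF Sing_map_in[OF f x]])
        (auto simp: topspace_standard_simplex continuous_map_std_coord)
    then show "continuous_map (std_cell n) ?L (\<lambda>t. ?f (sing_class K (n, x, t)))"
      by (rule continuous_map_eq)
        (auto simp: realization_map_class[OF K L f x] topspace_standard_simplex Sing_map_def)
  qed
  have sq: "sing_geo (?f c) = gmap f (sing_geo c)" if "c \<in> topspace ?K" for c
    using that
  proof (rule real_class_cases)
    fix n x t assume x: "x \<in> Sing K n" and t: "t \<in> standard_simplex n" and c: "c = sing_class K (n, x, t)"
    have l: "length x = Suc n" using x by (simp add: Sing_def)
    have fx: "map f x \<in> Sing L n" using Sing_map_in[OF f x] by (simp add: Sing_map_def)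
    have sub: "gsupp (bary (n, x, t)) \<subseteq> set x" using bary_gsimp[OF l t] by (simp add: gsimp_def)
    have "bary (n, map f x, t) w = gmap f (bary (n, x, t)) w" for w
    proof -
      have "gmap f (bary (n, x, t)) w = (\<Sum>v\<in>set x. if f v = w then bary (n, x, t) v else 0)"
        using sub by (intro gmap_eq) auto
      also have "\<dots> = (\<Sum>v\<in>set x. \<Sum>i\<le>n. if x ! i = v then if f (x ! i) = w then t i else 0 else 0)"
        unfolding bary_def prod.case
      proof (intro sum.cong refl)
        show "(if f v = w then \<Sum>i\<le>n. if x ! i = v then t i else 0 else 0) =
            (\<Sum>i\<le>n. if x ! i = v then if f (x ! i) = w then t i else 0 else 0)" for v
          by (cases "f v = w") (auto intro!: sum.cong sum.neutral)
      qed
      also have "\<dots> = (\<Sum>i\<le>n. \<Sum>v\<in>set x. if x ! i = v then if f (x ! i) = w then t i else 0 else 0)"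
        by (rule sum.swap)
      also have "\<dots> = bary (n, map f x, t) w"
        unfolding bary_def prod.case using l by (intro sum.cong) (auto simp: sum.delta)
      finally show ?thesis ..
    qed
    then show ?thesis
      unfolding c realization_map_class[OF K L f x t] sing_geo_class[OF x t] sing_geo_class[OF fx t]
      by auto
  qed
  have h: "homotopic_with (\<lambda>_. True) ?K (geo L) (sing_geo \<circ> ?f) (gmap f \<circ> sing_geo)"
    using cf sq by (intro homotopic_with_equal continuous_map_compose[OF _ continuous_map_sing_geo]) auto
  have "cpx_weq K L f \<longleftrightarrow> weak_homotopy_equivalence ?K (geo L) (sing_geo \<circ> ?f)"
    unfolding cpx_weq_def using whe_comp_hinverse_left[OF \<tau> cf] ..
  also have "\<dots> \<longleftrightarrow> weak_homotopy_equivalence ?K (geo L) (gmap f \<circ> sing_geo)"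
    using h whe_homotopic homotopic_with_symD by blast
  also have "\<dots> \<longleftrightarrow> weak_homotopy_equivalence (geo K) (geo L) (gmap f)"
    by (rule whe_comp_hinverse_right[OF \<sigma> continuous_map_gmap[OF K L f]])
  finally show ?thesis .
qed

section \<open>Strong deformation retracts\<close>

lemma continuous_map_geo_mono: "A \<subseteq> X \<Longrightarrow> continuous_map (geo A) (geo X) (\<lambda>x. x)"
  by (intro continuous_map_from_geo continuous_map_gcell_geo) auto

lemma topspace_geo_mono: "A \<subseteq> X \<Longrightarrow> topspace (geo A) \<subseteq> topspace (geo X)"
  by (auto simp: topspace_geo)

lemma openin_geo: "openin (geo K) U \<longleftrightarrow> U \<subseteq> (\<Union>s\<in>K. gsimp s) \<and> (\<forall>s\<in>K. openin (gcell s) (gsimp s \<inter> U))"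
  unfolding geo_def openin_final_topology by (simp add: Int_def)

lemma closedin_geo_imp:
  assumes "closedin (geo K) C" "s \<in> K"
  shows "closedin (powertop_real UNIV) (C \<inter> gsimp s)"
proof -
  have "closedin (gcell s) {x \<in> topspace (gcell s). x \<in> C}"
    using continuous_map_gcell_geo[OF assms(2)] assms(1) by (rule closedin_continuous_map_preimage)
  moreover have "{x \<in> topspace (gcell s). x \<in> C} = C \<inter> gsimp s" by auto
  ultimately show ?thesis
    using closedin_trans_full[OF _ closedin_gsimp] by metis
qed

text \<open>Inside a simplex of \<open>X\<close> the set is a union over the finitely many faces
  that lie in \<open>A\<close>. Hence \<open>geo A\<close> carries the subspace topology, and a map
  into \<open>geo X\<close> with values in \<open>geo A\<close> may be corestricted.\<close>

lemma closedin_geo_subcomplex: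
  assumes A: "complex A" and X: "complex X" and AX: "A \<subseteq> X" and C: "closedin (geo A) C"
  shows "closedin (geo X) C"
proof -
  have CA: "C \<subseteq> topspace (geo A)" using C by (rule closedin_subset)
  have "openin (gcell s) (gsimp s \<inter> (topspace (geo X) - C))" if s: "s \<in> X" for s
  proof -
    let ?T = "{t \<in> A. t \<subseteq> s}"
    have fin: "finite ?T" using complex_finite[OF X s] by (auto intro: finite_subset[of _ "Pow s"])
    have "C \<inter> gsimp s = (\<Union>t\<in>?T. C \<inter> gsimp t)"
    proof (intro equalityI subsetI)
      fix x assume x: "x \<in> C \<inter> gsimp s"
      then have "gsupp x \<in> A" "x \<in> gsimp (gsupp x)" using CA in_geo_iff[OF A] by auto
      moreover have "gsupp x \<subseteq> s" using x by (auto simp: gsimp_def)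
      ultimately show "x \<in> (\<Union>t\<in>?T. C \<inter> gsimp t)" using x by auto
    qed (use gsimp_mono complex_finite[OF X s] in auto)
    moreover have "closedin (powertop_real UNIV) (\<Union>t\<in>?T. C \<inter> gsimp t)"
      using fin closedin_geo_imp[OF C] by (intro closedin_Union) auto
    ultimately have cl: "closedin (powertop_real UNIV) (C \<inter> gsimp s)"
      by simp
    have "gsimp s \<inter> (topspace (geo X) - C) = gsimp s \<inter> (topspace (powertop_real UNIV) - C \<inter> gsimp s)"
      using s by (auto simp: topspace_geo)
    then show ?thesis
      using openin_diff[OF openin_topspace cl] by (auto simp: openin_subtopology Int_commute)
  qed
  then have "openin (geo X) (topspace (geo X) - C)"
    unfolding openin_geo by (auto simp: topspace_geo)
  then show ?thesis
    unfolding closedin_def using CA topspace_geo_mono[OF AX] by auto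
qed

lemma continuous_map_into_subcomplex:
  assumes "complex A" "complex X" "A \<subseteq> X" and f: "continuous_map Z (geo X) f"
    and fA: "\<And>z. z \<in> topspace Z \<Longrightarrow> f z \<in> topspace (geo A)"
  shows "continuous_map Z (geo A) f"
  unfolding continuous_map_closedin
  using fA closedin_continuous_map_preimage[OF f closedin_geo_subcomplex[OF assms(1-3)]] by auto

definition sdr :: "'v set set \<Rightarrow> 'v set set \<Rightarrow> bool" where
  "sdr A X \<longleftrightarrow> A \<subseteq> X \<and> (\<exists>r. continuous_map (geo X) (geo A) r \<and>
     homotopic_with (\<lambda>k. \<forall>a\<in>topspace (geo A). k a = a) (geo X) (geo X) id r)"

lemma sdr_hinverse:
  assumes "sdr A X"
  obtains r where "hinverse (geo A) (geo X) id r"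
proof -
  obtain r where r: "continuous_map (geo X) (geo A) r"
    "homotopic_with (\<lambda>k. \<forall>a\<in>topspace (geo A). k a = a) (geo X) (geo X) id r"
    and AX: "A \<subseteq> X" using assms by (auto simp: sdr_def)
  have inc: "continuous_map (geo A) (geo X) id" using continuous_map_geo_mono[OF AX] by (simp add: id_def)
  have "r a = a" if "a \<in> topspace (geo A)" for a
    using homotopic_with_imp_property[OF r(2)] that by auto
  then have "homotopic_with (\<lambda>_. True) (geo A) (geo A) (r \<circ> id) id"
    by (intro homotopic_with_equal continuous_map_compose[OF inc r(1)]) auto
  moreover have "homotopic_with (\<lambda>_. True) (geo X) (geo X) (id \<circ> r) id"
    using homotopic_with_symD[OF homotopic_with_mono[OF r(2)]] by simp
  ultimately have "hinverse (geo A) (geo X) id r"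
    unfolding hinverse_def using inc r by blast
  then show thesis by (rule that)
qed

lemma sdr_trans:
  assumes "sdr A B" "sdr B X"
  shows "sdr A X"
proof -
  obtain r where r: "continuous_map (geo B) (geo A) r"
    "homotopic_with (\<lambda>k. \<forall>a\<in>topspace (geo A). k a = a) (geo B) (geo B) id r"
    and AB: "A \<subseteq> B" using assms(1) by (auto simp: sdr_def)
  obtain q where q: "continuous_map (geo X) (geo B) q"
    "homotopic_with (\<lambda>k. \<forall>a\<in>topspace (geo B). k a = a) (geo X) (geo X) id q"
    and BX: "B \<subseteq> X" using assms(2) by (auto simp: sdr_def)
  let ?P = "\<lambda>k. \<forall>a\<in>topspace (geo A). k a = a"
  have qb: "q b = b" if "b \<in> topspace (geo B)" for b
    using homotopic_with_imp_property[OF q(2)] that by auto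
  have inc: "continuous_map (geo B) (geo X) id" using continuous_map_geo_mono[OF BX] by (simp add: id_def)
  have AB': "topspace (geo A) \<subseteq> topspace (geo B)" by (rule topspace_geo_mono[OF AB])
  have 1: "homotopic_with ?P (geo X) (geo X) id q"
    using AB' by (intro homotopic_with_mono[OF q(2)]) auto
  have 2: "homotopic_with ?P (geo X) (geo B) (id \<circ> q) (r \<circ> q)"
    using AB' qb by (intro homotopic_with_compose_continuous_map_right[OF r(2) q(1)]) auto
  have 3: "homotopic_with ?P (geo X) (geo X) (id \<circ> (id \<circ> q)) (id \<circ> (r \<circ> q))"
    by (rule homotopic_with_compose_continuous_map_left[OF 2 inc]) auto
  have "homotopic_with ?P (geo X) (geo X) id (r \<circ> q)"
    using homotopic_with_trans[OF 1, of "r \<circ> q"] 3 by simp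
  then show ?thesis
    unfolding sdr_def using AB BX continuous_map_compose[OF q(1) r(1)] by auto
qed

section \<open>Retractions onto full subcomplexes\<close>

abbreviation full :: "'v set set \<Rightarrow> 'v set \<Rightarrow> 'v set set" where
  "full X V \<equiv> {s \<in> X. s \<subseteq> V}"

lemma complex_full: "complex X \<Longrightarrow> complex (full X V)"
  unfolding complex_def by blast

text \<open>A dismantling performed stage by stage: the move of \<open>v\<close> to
  \<open>\<delta> v\<close> has to be possible only once the vertices of smaller
  \<open>\<sigma>\<close> have moved. Simplices off \<open>D\<close> have no moving vertex and are
  fixed throughout.\<close>

lemma sdr_ordered:
  assumes X: "complex X"
    and oc: "\<And>s j. s \<in> X \<Longrightarrow> mixed id (\<lambda>v. if v \<in> D then \<delta> v else v) \<sigma> s j \<in> X"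
    and \<delta>: "\<And>s v. s \<in> X \<Longrightarrow> v \<in> s \<Longrightarrow> v \<in> D \<Longrightarrow> \<delta> v \<notin> D"
  shows "sdr (full X (- D)) X"
proof -
  let ?h = "\<lambda>v. if v \<in> D then \<delta> v else v" and ?A = "full X (- D)"
  have A: "complex ?A" by (rule complex_full[OF X])
  have map: "cpx_map X ?A ?h"
    unfolding cpx_map_def
  proof
    fix s assume s: "s \<in> X"
    have fin: "finite s" "s \<noteq> {}" using complex_finite[OF X s] complex_nonempty[OF X s] by auto
    \<comment> \<open>At the last stage every vertex has arrived, so the final vertex map is
      simplicial.\<close>
    have "?h ` s \<subseteq> mixed id ?h \<sigma> s (Max (\<sigma> ` s))"
      using fin unfolding mixed_def by auto
    then have "?h ` s \<in> X" using complex_subset[OF X oc[OF s]] fin by blast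
    then show "?h ` s \<in> ?A" using \<delta>[OF s] by auto
  qed
  have "homotopic_with (\<lambda>k. \<forall>a\<in>topspace (geo ?A). k a = a) (geo X) (geo X) (gmap id) (gmap ?h)"
  proof (rule homotopic_ordered[OF X X oc])
    fix k assume k: "\<And>x. x \<in> topspace (geo X) \<Longrightarrow>
        (\<exists>j. gsupp (k x) \<subseteq> mixed id ?h \<sigma> (gsupp x) j) \<and> ((\<forall>v\<in>gsupp x. id v = ?h v) \<longrightarrow> k x = gmap id x)"
    show "\<forall>a\<in>topspace (geo ?A). k a = a"
    proof
      fix a assume a: "a \<in> topspace (geo ?A)"
      then have "gsupp a \<in> ?A" using in_geo_iff[OF A] by blast
      then have "\<forall>v\<in>gsupp a. id v = ?h v" by auto
      moreover have "a \<in> topspace (geo X)" using a topspace_geo_mono[of ?A X] by auto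
      ultimately have "k a = gmap id a" using k by blast
      then show "k a = a" using gmap_id_on[of a id] finite_gsupp_geo[OF A a] by simp
    qed
  qed
  then have "homotopic_with (\<lambda>k. \<forall>a\<in>topspace (geo ?A). k a = a) (geo X) (geo X) id (gmap ?h)"
  proof (rule homotopic_with_eq)
    show "id x = gmap id x" if "x \<in> topspace (geo X)" for x
      using gmap_id_on[of x id] finite_gsupp_geo[OF X that] by simp
    show "(\<forall>a\<in>topspace (geo ?A). h a = a) = (\<forall>a\<in>topspace (geo ?A). k a = a)"
      if "\<And>x. x \<in> topspace (geo X) \<Longrightarrow> h x = k x" for h k
      using that topspace_geo_mono[of ?A X] by (auto simp: subset_iff)
  qed auto
  then show ?thesis
    unfolding sdr_def using continuous_map_gmap[OF X A map] by auto
qed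

text \<open>A point \<open>x\<close> has mass \<open>u\<close> on \<open>C\<close>.  While \<open>u \<le> 1/2\<close> that mass is pushed off \<open>C\<close>
  and the deformation of \<open>U\<close> into \<open>U - C\<close> is run up to time \<open>2u\<close>; for \<open>u \<ge> 1/2\<close> it is run
  to its end.\<close>

lemma sdr_push:
  assumes X: "complex X" and CU: "\<And>s. s \<in> X \<Longrightarrow> s \<inter> C \<noteq> {} \<Longrightarrow> s \<subseteq> U"
    and G: "homotopic_with (\<lambda>k. k ` topspace (geo (full X (U - C))) \<subseteq> topspace (geo (full X (U - C))))
        (geo (full X U)) (geo (full X U)) id g"
    and g: "g ` topspace (geo (full X U)) \<subseteq> topspace (geo (full X (U - C)))"
  shows "sdr (full X (- C)) X"
proof -
  let ?U = "full X U" and ?W = "full X (U - C)" and ?A = "full X (- C)"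
  have cA: "complex ?A" by (rule complex_full[OF X])
  obtain H where H: "continuous_map (prod_topology unit_interval (geo ?U)) (geo ?U) H"
    "\<And>x. H (0, x) = x" "\<And>x. H (1, x) = g x"
    "\<And>t x. t \<in> {0..1} \<Longrightarrow> x \<in> topspace (geo ?W) \<Longrightarrow> H (t, x) \<in> topspace (geo ?W)"
    using G unfolding homotopic_with_def by (auto simp: image_subset_iff)
  define u where "u x = (\<Sum>v\<in>gsupp x. if v \<in> C then x v else 0)" for x :: "'a \<Rightarrow> real"
  \<comment> \<open>With \<open>a = u x\<close>, the part on \<open>C\<close> shrinks and the rest
    grows so that total mass is kept; this balance is the last clause of \<open>bnd\<close>. For
    \<open>a \<le> 1/2\<close> the factor on \<open>C\<close> is \<open>1 - t\<close> and reaches 0.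
    For \<open>a \<ge> 1/2\<close> only the mass \<open>t * (1 - a)\<close> moves, which vanishes at
    \<open>a = 1\<close>, where nothing off \<open>C\<close> could receive it. The bounds
    \<open>1/2\<close> keep the denominators away from 0.\<close>
  define \<xi> where "\<xi> p v = snd p v * (if v \<in> C
      then 1 - fst p * min 1 ((1 - u (snd p)) / max (u (snd p)) (1/2))
      else 1 + fst p * min 1 (u (snd p) / max (1 - u (snd p)) (1/2)))" for p :: "real \<times> ('a \<Rightarrow> real)" and v
  \<comment> \<open>A point without mass on \<open>C\<close> need not lie over \<open>U\<close>,
    where \<open>H\<close> lives. On simplices meeting \<open>C\<close> the two clauses agree at
    \<open>u = 0\<close> because \<open>H (0, x) = x\<close>.\<close>
  define F where "F p = (if u (snd p) = 0 then snd p else H (fst p * min 1 (2 * u (snd p)), \<xi> p))"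
    for p :: "real \<times> ('a \<Rightarrow> real)"
  have u_eq: "u x = (\<Sum>v\<in>s. if v \<in> C then x v else 0)" if "x \<in> gsimp s" "finite s" for x s
    unfolding u_def using that by (intro sum_gsupp) (auto simp: gsimp_def)
  have u01: "0 \<le> u x \<and> u x \<le> 1" if "x \<in> gsimp s" "finite s" for x s
  proof -
    have nn: "0 \<le> x v" for v using that by (auto simp: gsimp_def)
    have "u x \<le> sum x s" unfolding u_eq[OF that] by (rule sum_mono) (auto simp: nn)
    moreover have "sum x s = 1" using that by (simp add: gsimp_def)
    moreover have "0 \<le> u x" unfolding u_def by (rule sum_nonneg) (auto simp: nn)
    ultimately show ?thesis by simp
  qed
  have bnd: "0 \<le> min 1 ((1 - a) / max a (1/2)) \<and> min 1 ((1 - a) / max a (1/2)) \<le> 1 \<and>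
      0 \<le> min 1 (a / max (1 - a) (1/2)) \<and> min 1 (a / max (1 - a) (1/2)) \<le> 1 \<and>
      a * min 1 ((1 - a) / max a (1/2)) = (1 - a) * min 1 (a / max (1 - a) (1/2))"
    if "0 \<le> a" "a \<le> 1" for a :: real
  proof (cases "a \<le> 1/2")
    case True
    then have "max a (1/2) = 1/2" "max (1 - a) (1/2) = 1 - a" "1 - a > 0" by auto
    moreover have "min 1 ((1 - a) / (1/2)) = 1" using True by simp
    moreover have "a / (1 - a) \<le> 1" using True by (simp add: divide_le_eq)
    then have "min 1 (a / (1 - a)) = a / (1 - a)" by simp
    ultimately show ?thesis using that by simp
  next
    case False
    then have "max a (1/2) = a" "max (1 - a) (1/2) = 1/2" "a > 0" by auto
    moreover have "min 1 (a / (1/2)) = 1" using False by simp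
    moreover have "(1 - a) / a \<le> 1" using False by (simp add: divide_le_eq)
    then have "min 1 ((1 - a) / a) = (1 - a) / a" by simp
    ultimately show ?thesis using that by simp
  qed
  have \<xi>_in: "\<xi> (t, x) \<in> gsimp s" if t: "0 \<le> t" "t \<le> 1" and x: "x \<in> gsimp s" and s: "finite s" for t x s
  proof -
    have x0: "\<And>v. 0 \<le> x v" "sum x s = 1" "\<And>v. v \<notin> s \<Longrightarrow> x v = 0" using x by (auto simp: gsimp_def gsupp_def)
    let ?a = "u x"
    have a: "0 \<le> ?a" "?a \<le> 1" using u01[OF x s] by auto
    let ?c = "1 - t * min 1 ((1 - ?a) / max ?a (1/2))" and ?d = "1 + t * min 1 (?a / max (1 - ?a) (1/2))"
    have c: "0 \<le> ?c" using bnd[OF a] t by (simp add: mult_le_one)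
    have d: "0 \<le> ?d" using bnd[OF a] t by simp
    have split: "sum x s = ?a + (\<Sum>v\<in>s. if v \<in> C then 0 else x v)"
      unfolding u_eq[OF x s] by (simp add: sum.distrib[symmetric] if_distrib cong: if_cong)
    have "sum (\<xi> (t, x)) s = (\<Sum>v\<in>s. ?c * (if v \<in> C then x v else 0) + ?d * (if v \<in> C then 0 else x v))"
      by (intro sum.cong) (auto simp: \<xi>_def)
    also have "\<dots> = ?c * ?a + ?d * (1 - ?a)"
      using split x0(2) by (simp add: sum.distrib sum_distrib_left[symmetric] u_eq[OF x s])
    also have "\<dots> = 1 - t * (?a * min 1 ((1 - ?a) / max ?a (1/2))) + t * ((1 - ?a) * min 1 (?a / max (1 - ?a) (1/2)))"
      by (simp add: algebra_simps)
    also have "\<dots> = 1" using bnd[OF a] by simp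
    finally have "sum (\<xi> (t, x)) s = 1" .
    moreover have "0 \<le> \<xi> (t, x) v" for v
      by (cases "v \<in> C") (simp_all only: \<xi>_def fst_conv snd_conv if_True if_False mult_nonneg_nonneg[OF x0(1)] c d)
    ultimately show ?thesis using x0(3) by (auto simp: gsimp_def gsupp_def \<xi>_def)
  qed
  have u0: "\<xi> (t, x) = x" if "u x = 0" "x \<in> gsimp s" "finite s" for t x s
  proof -
    have nn: "\<And>v. 0 \<le> x v" using that by (auto simp: gsimp_def)
    have "x v = 0" if "v \<in> C" for v
    proof (cases "v \<in> s")
      case True
      have "(if v \<in> C then x v else 0) = 0"
        using \<open>u x = 0\<close> True nn unfolding u_eq[OF \<open>x \<in> gsimp s\<close> \<open>finite s\<close>]
        by (subst (asm) sum_nonneg_eq_0_iff) (auto simp: \<open>finite s\<close>)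
      then show ?thesis using that by simp
    next
      case False
      then show ?thesis using \<open>x \<in> gsimp s\<close> by (auto simp: gsimp_def gsupp_def)
    qed
    then show ?thesis using \<open>u x = 0\<close> by (auto simp: \<xi>_def fun_eq_iff)
  qed
  have uC: "gsupp x \<inter> C \<noteq> {}" if "u x \<noteq> 0" for x
  proof
    assume "gsupp x \<inter> C = {}"
    then have "u x = 0" unfolding u_def by (intro sum.neutral) auto
    then show False using that by simp
  qed
  have uA: "u x = 0" if "x \<in> topspace (geo ?A)" for x
    using uC[of x] in_geo_iff[OF cA, of x] that by auto
  have cF: "continuous_map (prod_topology unit_interval (geo X)) (geo X) F"
  proof (rule continuous_map_from_prod_geo)
    fix s assume s: "s \<in> X"
    have fin: "finite s" by (rule complex_finite[OF X s])
    let ?P = "prod_topology unit_interval (gcell s)"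
    show "continuous_map ?P (geo X) F"
    proof (cases "s \<inter> C = {}")
      case True
      have csnd: "continuous_map ?P (geo X) snd"
        using continuous_map_compose[OF continuous_map_snd continuous_map_gcell_geo[OF s]] by (simp add: o_def)
      have "u x = 0" if "x \<in> gsimp s" for x
        unfolding u_eq[OF that fin] using True by (intro sum.neutral) auto
      then show ?thesis
        by (intro continuous_map_eq[OF csnd]) (auto simp: F_def)
    next
      case False
      then have sU: "s \<in> ?U" using CU[OF s] s by auto
      have cu: "continuous_map ?P euclideanreal (\<lambda>p. u (snd p))"
      proof (rule continuous_map_eq)
        show "continuous_map ?P euclideanreal (\<lambda>p. \<Sum>v\<in>s. if v \<in> C then snd p v else 0)"
          by (intro continuous_map_sum fin) (auto simp: continuous_map_prod_gcell_coord)
      qed (auto simp: u_eq[OF _ fin] cong: if_cong)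
      have c\<xi>: "continuous_map ?P (geo ?U) \<xi>"
      proof (rule continuous_map_into_geo[of "{s}"])
        show "\<exists>\<tau>\<in>{s}. \<xi> p \<in> gsimp \<tau>" if "p \<in> topspace ?P" for p
          using that \<xi>_in[of "fst p" "snd p" s] fin by auto
        have ne: "max a (1/2) \<noteq> 0" for a :: real by (simp add: max_def)
        show "continuous_map ?P euclideanreal (\<lambda>p. \<xi> p v)" for v
          unfolding \<xi>_def using ne
          by (cases "v \<in> C") (auto intro!: continuous_map_real_mult continuous_map_diff continuous_map_add
              continuous_map_real_min continuous_map_real_divide continuous_map_real_max cu
              continuous_map_interval_fst continuous_map_prod_gcell_coord)
      qed (use sU in auto)
      have ct: "continuous_map ?P unit_interval (\<lambda>p. fst p * min 1 (2 * u (snd p)))"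
      proof -
        have "continuous_map ?P euclideanreal (\<lambda>p. fst p * min 1 (2 * u (snd p)))"
          by (auto intro!: continuous_map_real_mult continuous_map_real_min cu continuous_map_interval_fst)
        then show ?thesis
          unfolding continuous_map_unit_interval using u01[OF _ fin] by (auto intro!: mult_le_one)
      qed
      have "continuous_map ?P (geo X) (\<lambda>p. H (fst p * min 1 (2 * u (snd p)), \<xi> p))"
        using continuous_map_compose[OF continuous_map_pair_interval[OF H(1) ct c\<xi>] continuous_map_geo_mono[of ?U X]]
        by (auto simp: o_def)
      then show ?thesis
      proof (rule continuous_map_eq)
        show "H (fst p * min 1 (2 * u (snd p)), \<xi> p) = F p" if "p \<in> topspace ?P" for p
          using that u0[of "snd p" s "fst p"] fin H(2) by (auto simp: F_def)
      qed
    qed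
  qed
  have F1: "F (1, x) \<in> topspace (geo ?A)" if x: "x \<in> topspace (geo X)" for x
  proof (cases "u x = 0")
    case True
    have gx: "gsupp x \<in> X" "x \<in> gsimp (gsupp x)" using x in_geo_iff[OF X] by auto
    have fx: "finite (gsupp x)" by (rule complex_finite[OF X gx(1)])
    have "x v = 0" if "v \<in> C" for v
    proof -
      have "\<xi> (1, x) v = 0" using True that by (simp add: \<xi>_def)
      then show ?thesis using u0[OF True gx(2) fx, of 1] by simp
    qed
    then have "gsupp x \<in> ?A" using gx by (auto simp: gsupp_def)
    then show ?thesis using True gx in_geo_iff[OF cA] by (simp add: F_def)
  next
    case False
    have gx: "gsupp x \<in> X" "x \<in> gsimp (gsupp x)" using x in_geo_iff[OF X] by auto
    have fx: "finite (gsupp x)" by (rule complex_finite[OF X gx(1)])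
    have a: "0 \<le> u x" "u x \<le> 1" using u01[OF gx(2) fx] by auto
    have gU: "gsupp x \<in> ?U" using CU[OF gx(1)] uC[OF False] gx by auto
    have \<xi>U: "\<xi> (1, x) \<in> gsimp (gsupp x)" using \<xi>_in[OF _ _ gx(2) fx] by simp
    have "F (1, x) \<in> topspace (geo ?W)"
    proof (cases "u x \<le> 1/2")
      case True
      then have "min 1 ((1 - u x) / max (u x) (1/2)) = 1" by (simp add: max_def)
      then have "\<xi> (1, x) v = 0" if "v \<in> C" for v using that by (simp add: \<xi>_def)
      then have sub: "gsupp (\<xi> (1, x)) \<subseteq> gsupp x - C" using \<xi>U by (auto simp: gsimp_def gsupp_def)
      have "gsupp x - C \<in> ?W"
        using complex_subset[OF X gx(1), of "gsupp x - C"] gsimp_gsupp_ne[OF \<xi>U] sub gU by auto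
      moreover have "\<xi> (1, x) \<in> gsimp (gsupp x - C)" using gsimp_supp[OF \<xi>U fx sub] fx by simp
      ultimately have "\<xi> (1, x) \<in> topspace (geo ?W)" by (auto simp: topspace_geo)
      then show ?thesis using H(4) a False by (auto simp: F_def)
    next
      case big: False
      have "\<xi> (1, x) \<in> topspace (geo ?U)" using \<xi>U gU by (auto simp: topspace_geo)
      then show ?thesis using big g H(3) by (auto simp: F_def)
    qed
    then show ?thesis using topspace_geo_mono[of ?W ?A] by auto
  qed
  have "continuous_map (geo X) (geo X) (\<lambda>x. F (1, x))"
    by (intro continuous_map_pair_interval[OF cF]) auto
  then have r: "continuous_map (geo X) (geo ?A) (\<lambda>x. F (1, x))"
    using F1 by (intro continuous_map_into_subcomplex[OF cA X]) auto
  have "homotopic_with (\<lambda>k. \<forall>a\<in>topspace (geo ?A). k a = a) (geo X) (geo X) id (\<lambda>x. F (1, x))"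
  proof (subst homotopic_with)
    show "(\<forall>a\<in>topspace (geo ?A). h a = a) = (\<forall>a\<in>topspace (geo ?A). k a = a)"
      if "\<And>x. x \<in> topspace (geo X) \<Longrightarrow> h x = k x" for h k
      using that topspace_geo_mono[of ?A X] by (auto simp: subset_iff)
    have "F (0, x) = x" for x by (auto simp: F_def H(2) \<xi>_def fun_eq_iff)
    then show "\<exists>h. continuous_map (prod_topology unit_interval (geo X)) (geo X) h \<and>
        (\<forall>x\<in>topspace (geo X). h (0, x) = id x) \<and> (\<forall>x\<in>topspace (geo X). h (1, x) = F (1, x)) \<and>
        (\<forall>t\<in>{0..1}. \<forall>a\<in>topspace (geo ?A). h (t, a) = a)"
      using cF uA by (intro exI[of _ F]) (auto simp: F_def)
  qed
  then show ?thesis unfolding sdr_def using r by auto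
qed

text \<open>The outermost deformation comes first: after \<open>H m\<close> has carried stage
  \<open>Suc m\<close> into stage \<open>m\<close>, the remaining time is left to the earlier
  ones.\<close>

primrec telescope :: "(nat \<Rightarrow> real \<times> 'x \<Rightarrow> 'x) \<Rightarrow> nat \<Rightarrow> real \<times> 'x \<Rightarrow> 'x" where
  "telescope H 0 p = snd p"
| "telescope H (Suc m) p = (if fst p \<le> - real m then H m (min 1 (max 0 (fst p + real m + 1)), snd p)
     else telescope H m (fst p, H m (1, snd p)))"

text \<open>The \<open>m\<close>-th deformation is run during the time interval \<open>[-m-1, -m]\<close>, so that on each
  stage of the filtration nothing happens before a fixed time; \<open>[0,1]\<close> is mapped to
  \<open>[-\<infinity>, 0]\<close> by \<open>t \<mapsto> 1 - 1/t\<close>.\<close>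

lemma sdr_union:
  assumes cpx: "\<And>m. complex (X m)" and sdr: "\<And>m. sdr (X m) (X (Suc m))"
  shows "sdr (X 0) (\<Union>m. X m)"
proof -
  let ?X = "\<Union>m. X m" and ?T = "\<lambda>m. topspace (geo (X m))"
  have sub: "X m \<subseteq> X (Suc m)" for m using sdr by (auto simp: sdr_def)
  have mono: "X m \<subseteq> X m'" if "m \<le> m'" for m m' using sub that by (rule lift_Suc_mono_le)
  have "\<exists>H. continuous_map (prod_topology unit_interval (geo (X (Suc m)))) (geo (X (Suc m))) H \<and>
      (\<forall>x. H (0, x) = x) \<and> continuous_map (geo (X (Suc m))) (geo (X m)) (\<lambda>x. H (1, x)) \<and>
      (\<forall>t\<in>{0..1}. \<forall>a\<in>?T m. H (t, a) = a)" for m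
  proof -
    obtain r H where "continuous_map (geo (X (Suc m))) (geo (X m)) r"
      "continuous_map (prod_topology unit_interval (geo (X (Suc m)))) (geo (X (Suc m))) H"
      "\<forall>x. H (0, x) = id x" "\<forall>x. H (1, x) = r x" "\<forall>t\<in>{0..1}. \<forall>a\<in>?T m. H (t, a) = a"
      using sdr[of m] unfolding sdr_def homotopic_with_def by blast
    then show ?thesis by (intro exI[of _ H]) auto
  qed
  then obtain H where
    H: "\<And>m. continuous_map (prod_topology unit_interval (geo (X (Suc m)))) (geo (X (Suc m))) (H m)"
    and H0: "\<And>m x. H m (0, x) = x"
    and H1: "\<And>m. continuous_map (geo (X (Suc m))) (geo (X m)) (\<lambda>x. H m (1, x))"
    and Hrel: "\<And>m t a. t \<in> {0..1} \<Longrightarrow> a \<in> ?T m \<Longrightarrow> H m (t, a) = a"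
    by metis
  let ?\<Phi> = "telescope H"
  have H1T: "H m (1, x) \<in> ?T m" if "x \<in> ?T (Suc m)" for m x
    using H1[of m] that by (auto simp: continuous_map_def)
  have early: "?\<Phi> m (\<tau>, x) = x" if "x \<in> ?T m" "\<tau> \<le> - real m" for m \<tau> x
    using that by (cases m) (auto simp: H0)
  \<comment> \<open>A point of stage \<open>m\<close> is fixed by \<open>H m\<close> and is at rest
    up to time \<open>-m\<close>, so all later telescopes agree on it.\<close>
  have stable: "?\<Phi> (Suc m) (\<tau>, x) = ?\<Phi> m (\<tau>, x)" if "x \<in> ?T m" for m \<tau> x
    using that early[OF that, of \<tau>] Hrel[of _ x m] by simp
  have stable': "?\<Phi> m' (\<tau>, x) = ?\<Phi> m (\<tau>, x)" if "m \<le> m'" "x \<in> ?T m" for m m' \<tau> x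
    using that(1)
  proof (induction rule: dec_induct)
    case (step n)
    then show ?case using stable[of x n \<tau>] that(2) topspace_geo_mono[OF mono[of m n]] by auto
  qed simp
  have rel: "?\<Phi> m (\<tau>, a) = a" if "a \<in> ?T 0" for m \<tau> a
    using stable'[of 0 m a \<tau>] that by simp
  have late: "?\<Phi> m (\<tau>, x) \<in> ?T 0" if "0 \<le> \<tau>" "x \<in> ?T m" for m \<tau> x
    using that
  proof (induction m arbitrary: x)
    case (Suc m)
    show ?case
    proof (cases "\<tau> \<le> - real m")
      case True
      then have "m = 0" "\<tau> = 0" using Suc.prems by auto
      then show ?thesis using H1T[OF Suc.prems(2)] by simp
    qed (use Suc H1T in auto)
  qed simp
  have cont: "continuous_map (prod_topology euclideanreal (geo (X m))) (geo (X m)) (?\<Phi> m)" for m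
  proof (induction m)
    case 0
    have "?\<Phi> 0 = snd" by (simp add: fun_eq_iff)
    then show ?case by (simp only: continuous_map_snd)
  next
    case (Suc m)
    let ?P = "prod_topology euclideanreal (geo (X (Suc m)))"
    have "continuous_map ?P (geo (X (Suc m))) (\<lambda>p. if fst p \<le> - real m
        then H m (min 1 (max 0 (fst p + real m + 1)), snd p) else ?\<Phi> m (fst p, H m (1, snd p)))"
    proof (rule continuous_map_cases_le)
      show "continuous_map ?P euclideanreal fst" by (rule continuous_map_fst)
      show "continuous_map ?P euclideanreal (\<lambda>p. - real m)" by simp
      have "continuous_map ?P unit_interval (\<lambda>p. min 1 (max 0 (fst p + real m + 1)))"
        unfolding continuous_map_unit_interval
        by (auto intro!: continuous_map_real_min continuous_map_real_max continuous_map_add continuous_map_fst)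
      from continuous_map_pair_interval[OF H this continuous_map_snd]
      show "continuous_map (subtopology ?P {x \<in> topspace ?P. fst x \<le> - real m}) (geo (X (Suc m)))
          (\<lambda>p. H m (min 1 (max 0 (fst p + real m + 1)), snd p))"
        by (rule continuous_map_from_subtopology)
      have "continuous_map ?P (prod_topology euclideanreal (geo (X m))) (\<lambda>p. (fst p, H m (1, snd p)))"
        by (intro continuous_map_pairedI continuous_map_fst continuous_map_compose[OF continuous_map_snd H1, unfolded o_def])
      from continuous_map_compose[OF continuous_map_compose[OF this Suc] continuous_map_geo_mono[OF sub]]
      show "continuous_map (subtopology ?P {x \<in> topspace ?P. - real m \<le> fst x}) (geo (X (Suc m)))
          (\<lambda>p. ?\<Phi> m (fst p, H m (1, snd p)))"
        by (intro continuous_map_from_subtopology) (simp add: o_def)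
      show "H m (min 1 (max 0 (fst p + real m + 1)), snd p) = ?\<Phi> m (fst p, H m (1, snd p))"
        if "p \<in> topspace ?P" "fst p = - real m" for p
        using that early[of "H m (1, snd p)" m "fst p"] H1T[of "snd p" m] by auto
    qed
    then show ?case by (rule continuous_map_eq) auto
  qed
  \<comment> \<open>\<open>1 - 1/t\<close> equals \<open>-m\<close> at \<open>t = 1/(m+1)\<close>.
    Capping there changes nothing on stage \<open>m\<close>, which is at rest until then, and
    removes the singularity at \<open>t = 0\<close>.\<close>
  define tm where "tm m t = 1 - 1 / max t (1 / (real m + 1))" for m t
  define lev where "lev x = (LEAST m. x \<in> ?T m)" for x
  define \<Psi> where "\<Psi> p = ?\<Phi> (lev (snd p)) (tm (lev (snd p)) (fst p), snd p)" for p
  have \<Psi>_eq: "\<Psi> (t, x) = ?\<Phi> m (tm m t, x)" if t: "0 \<le> t" and x: "x \<in> ?T m" for t x m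
  proof -
    let ?l = "lev x"
    have l: "x \<in> ?T ?l" "?l \<le> m" unfolding lev_def using x by (auto intro: LeastI Least_le)
    have le: "1 / (real m + 1) \<le> 1 / (real ?l + 1)" using l(2) by (simp add: frac_le)
    have "?\<Phi> m (tm m t, x) = ?\<Phi> ?l (tm m t, x)" by (rule stable'[OF l(2,1)])
    also have "\<dots> = ?\<Phi> ?l (tm ?l t, x)"
    proof (cases "1 / (real ?l + 1) \<le> t")
      case True
      then have "max t (1 / (real m + 1)) = t" "max t (1 / (real ?l + 1)) = t" using le by auto
      then show ?thesis by (simp only: tm_def)
    next
      case False
      then have "tm ?l t = - real ?l" by (simp add: tm_def max_def)
      moreover have "0 < max t (1 / (real m + 1))" "max t (1 / (real m + 1)) \<le> 1 / (real ?l + 1)"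
        using False le by (auto simp: less_max_iff_disj)
      then have "1 / (1 / (real ?l + 1)) \<le> 1 / max t (1 / (real m + 1))"
        by (intro divide_left_mono) auto
      then have "tm m t \<le> - real ?l" by (simp add: tm_def)
      ultimately show ?thesis using early[OF l(1)] by simp
    qed
    finally show ?thesis by (simp add: \<Psi>_def)
  qed
  have c\<Psi>: "continuous_map (prod_topology unit_interval (geo ?X)) (geo ?X) \<Psi>"
  proof (rule continuous_map_from_prod_geo)
    fix s assume "s \<in> ?X"
    then obtain m where s: "s \<in> X m" by auto
    let ?P = "prod_topology unit_interval (gcell s)"
    have "1 / (real m + 1) > 0" by simp
    then have "max t (1 / (real m + 1)) \<noteq> 0" for t by linarith
    then have "continuous_map ?P euclideanreal (\<lambda>p. tm m (fst p))"
      unfolding tm_def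
      by (auto intro!: continuous_map_diff continuous_map_real_divide continuous_map_real_max continuous_map_interval_fst)
    then have "continuous_map ?P (prod_topology euclideanreal (geo (X m))) (\<lambda>p. (tm m (fst p), snd p))"
      using continuous_map_compose[OF continuous_map_snd continuous_map_gcell_geo[OF s]]
      by (intro continuous_map_pairedI) (auto simp: o_def)
    from continuous_map_compose[OF continuous_map_compose[OF this cont] continuous_map_geo_mono[of "X m" ?X]]
    have "continuous_map ?P (geo ?X) (\<lambda>p. ?\<Phi> m (tm m (fst p), snd p))" by (auto simp: o_def)
    then show "continuous_map ?P (geo ?X) \<Psi>"
    proof (rule continuous_map_eq)
      show "?\<Phi> m (tm m (fst p), snd p) = \<Psi> p" if "p \<in> topspace ?P" for p
      proof -
        have "snd p \<in> ?T m" "0 \<le> fst p" using that s by (auto simp: topspace_geo)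
        then show ?thesis using \<Psi>_eq[of "fst p" "snd p" m] by simp
      qed
    qed
  qed
  have xT: "\<exists>m. x \<in> ?T m" if "x \<in> topspace (geo ?X)" for x
    using that by (auto simp: topspace_geo)
  have \<Psi>0: "\<Psi> (0, x) = x" if "x \<in> topspace (geo ?X)" for x
    using xT[OF that] \<Psi>_eq[of 0 x] early by (auto simp: tm_def)
  have \<Psi>1: "\<Psi> (1, x) \<in> ?T 0" if x: "x \<in> topspace (geo ?X)" for x
  proof -
    obtain m where "x \<in> ?T m" using xT[OF x] by auto
    moreover have "max 1 (1 / (real m + 1)) = 1" by auto
    then have "tm m 1 = 0" by (simp add: tm_def)
    ultimately show ?thesis using \<Psi>_eq[of 1 x m] late[of 0 x m] by simp
  qed
  have cX: "complex ?X" using cpx unfolding complex_def by blast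
  have X0: "X 0 \<subseteq> ?X" by auto
  have "continuous_map (geo ?X) (geo ?X) (\<lambda>x. \<Psi> (1, x))"
    by (intro continuous_map_pair_interval[OF c\<Psi>]) auto
  then have r: "continuous_map (geo ?X) (geo (X 0)) (\<lambda>x. \<Psi> (1, x))"
    using \<Psi>1 by (intro continuous_map_into_subcomplex[OF cpx cX X0]) auto
  have "homotopic_with (\<lambda>k. \<forall>a\<in>?T 0. k a = a) (geo ?X) (geo ?X) id (\<lambda>x. \<Psi> (1, x))"
  proof (subst homotopic_with)
    show "(\<forall>a\<in>?T 0. h a = a) = (\<forall>a\<in>?T 0. k a = a)"
      if "\<And>x. x \<in> topspace (geo ?X) \<Longrightarrow> h x = k x" for h k
      using that topspace_geo_mono[OF X0] by (auto simp: subset_iff)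
    show "\<exists>h. continuous_map (prod_topology unit_interval (geo ?X)) (geo ?X) h \<and>
        (\<forall>x\<in>topspace (geo ?X). h (0, x) = id x) \<and> (\<forall>x\<in>topspace (geo ?X). h (1, x) = \<Psi> (1, x)) \<and>
        (\<forall>t\<in>{0..1}. \<forall>a\<in>?T 0. h (t, a) = a)"
      using c\<Psi> \<Psi>0 \<Psi>_eq rel by (intro exI[of _ \<Psi>]) auto
  qed
  then show ?thesis unfolding sdr_def using r X0 by auto
qed

section \<open>Barycentric subdivision\<close>

definition chain :: "'a set set \<Rightarrow> bool" where
  "chain C \<longleftrightarrow> (\<forall>S\<in>C. \<forall>T\<in>C. S \<subseteq> T \<or> T \<subseteq> S)"

lemma chain_subset: "chain C \<Longrightarrow> D \<subseteq> C \<Longrightarrow> chain D"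
  unfolding chain_def by blast

lemma chain_Union_in: "finite C \<Longrightarrow> C \<noteq> {} \<Longrightarrow> chain C \<Longrightarrow> \<Union>C \<in> C"
proof (induction C rule: finite_ne_induct)
  case (insert S C)
  then have "\<Union>C \<in> C" using chain_subset[of "insert S C" C] by blast
  then have "S \<subseteq> \<Union>C \<or> \<Union>C \<subseteq> S" using insert.prems unfolding chain_def by blast
  then show ?case
  proof
    assume "S \<subseteq> \<Union>C"
    then have "\<Union>(insert S C) = \<Union>C" by blast
    then show ?thesis using \<open>\<Union>C \<in> C\<close> by simp
  next
    assume "\<Union>C \<subseteq> S"
    then have "\<Union>(insert S C) = S" by blast
    then show ?thesis by simp
  qed
qed simp

definition sd :: "'a set set \<Rightarrow> 'a set set set" where
  "sd K = {C. finite C \<and> C \<noteq> {} \<and> C \<subseteq> K \<and> chain C}"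

lemma complex_sd: "complex (sd K)"
  unfolding complex_def
proof (intro conjI ballI allI impI)
  fix C D :: "'a set set"
  assume C: "C \<in> sd K" and D: "D \<subseteq> C \<and> D \<noteq> {}"
  have "finite D" using C D finite_subset[of D C] by (simp add: sd_def)
  moreover have "chain D" using C D chain_subset[of C D] by (simp add: sd_def)
  ultimately show "D \<in> sd K" using C D by (auto simp: sd_def)
qed (auto simp: sd_def)

definition sd_bary :: "('a set \<Rightarrow> real) \<Rightarrow> 'a \<Rightarrow> real" where
  "sd_bary x v = (\<Sum>\<sigma>\<in>gsupp x. if v \<in> \<sigma> then x \<sigma> / real (card \<sigma>) else 0)"

text \<open>The coordinates in the barycentric subdivision: up to the factor \<open>card \<sigma>\<close>, the gap
  between the values on \<open>\<sigma>\<close> and those off \<open>\<sigma>\<close>.\<close>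

definition sd_coord :: "('a \<Rightarrow> real) \<Rightarrow> 'a set \<Rightarrow> real" where
  "sd_coord t \<sigma> = (if finite \<sigma> \<and> \<sigma> \<noteq> {}
     then real (card \<sigma>) * max 0 (Min (t ` \<sigma>) - Max (insert 0 (t ` (gsupp t - \<sigma>)))) else 0)"

text \<open>With \<open>m \<tau> = x \<tau> / card \<tau>\<close>, the value of
  \<open>sd_bary x\<close> at \<open>v\<close> is the sum of \<open>m\<close> over the members of
  the support chain that contain \<open>v\<close>. For \<open>\<sigma>\<close> in the chain the
  least value on \<open>\<sigma>\<close> sums over \<open>\<tau> \<supseteq> \<sigma>\<close>, the
  largest value off \<open>\<sigma>\<close> over \<open>\<tau> \<supset> \<sigma>\<close>, and the
  gap is \<open>m \<sigma>\<close>. For other \<open>\<sigma>\<close> there is no gap.\<close>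

lemma sd_coord_bary_aux:
  fixes x :: "'a set \<Rightarrow> real"
  assumes nn: "\<And>\<sigma>. 0 \<le> x \<sigma>" and fin: "finite (gsupp x)" and ch: "chain (gsupp x)"
    and fC: "\<And>\<sigma>. \<sigma> \<in> gsupp x \<Longrightarrow> finite \<sigma> \<and> \<sigma> \<noteq> {}"
  shows "sd_coord (sd_bary x) \<sigma> = x \<sigma>"
proof -
  let ?C = "gsupp x" and ?t = "sd_bary x"
  define m where "m \<tau> = x \<tau> / real (card \<tau>)" for \<tau>
  have m_nn: "0 \<le> m \<tau>" for \<tau> by (simp add: m_def nn)
  have m_pos: "0 < m \<tau>" if "\<tau> \<in> ?C" for \<tau>
    using that fC[OF that] nn[of \<tau>] by (auto simp: m_def gsupp_def card_gt_0_iff)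
  have t_eq: "?t v = sum m {\<tau> \<in> ?C. v \<in> \<tau>}" for v
    unfolding sd_bary_def m_def using fin by (simp add: sum.inter_filter)
  have supp_t: "gsupp ?t = \<Union>?C"
  proof (intro equalityI subsetI)
    fix v assume "v \<in> gsupp ?t"
    then have "sum m {\<tau> \<in> ?C. v \<in> \<tau>} \<noteq> 0" by (simp add: gsupp_def t_eq)
    then have "{\<tau> \<in> ?C. v \<in> \<tau>} \<noteq> {}" by (metis sum.empty)
    then show "v \<in> \<Union>?C" by blast
  next
    fix v assume "v \<in> \<Union>?C"
    then obtain \<tau> where \<tau>: "\<tau> \<in> ?C" "v \<in> \<tau>" by blast
    have "0 < sum m {\<tau> \<in> ?C. v \<in> \<tau>}"
      using fin \<tau> m_pos by (intro sum_pos) auto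
    then show "v \<in> gsupp ?t" by (simp add: gsupp_def t_eq)
  qed
  have fU: "finite (\<Union>?C)" using fin fC by auto
  \<comment> \<open>The members of a chain that do not contain \<open>\<sigma>\<close> have a
    largest one, and a vertex of \<open>\<sigma>\<close> outside it avoids them all.\<close>
  have avoid: "\<exists>v\<in>\<sigma>. \<forall>\<tau>\<in>D. v \<notin> \<tau>" if D: "D \<subseteq> ?C" "\<And>\<tau>. \<tau> \<in> D \<Longrightarrow> \<not> \<sigma> \<subseteq> \<tau>" and "\<sigma> \<noteq> {}" for \<sigma> D
  proof (cases "D = {}")
    case False
    have "\<Union>D \<in> D" using chain_Union_in[OF finite_subset[OF D(1) fin] False chain_subset[OF ch D(1)]] .
    then show ?thesis using D(2)[of "\<Union>D"] by blast
  qed (use that in auto)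
  show ?thesis
  proof (cases "\<sigma> \<in> ?C")
    case True
    have f: "finite \<sigma>" "\<sigma> \<noteq> {}" using fC[OF True] by auto
    let ?a = "sum m {\<tau> \<in> ?C. \<sigma> \<subseteq> \<tau>}" and ?b = "sum m {\<tau> \<in> ?C. \<sigma> \<subset> \<tau>}"
    obtain v where v: "v \<in> \<sigma>" "\<And>\<tau>. \<tau> \<in> ?C \<Longrightarrow> \<not> \<sigma> \<subseteq> \<tau> \<Longrightarrow> v \<notin> \<tau>"
      using avoid[of "{\<tau> \<in> ?C. \<not> \<sigma> \<subseteq> \<tau>}" \<sigma>] f by blast
    have "Min (?t ` \<sigma>) = ?a"
    proof (rule Min_eqI)
      show "?a \<le> y" if "y \<in> ?t ` \<sigma>" for y
        using that fin m_nn by (auto simp: t_eq intro!: sum_mono2)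
      have "{\<tau> \<in> ?C. v \<in> \<tau>} = {\<tau> \<in> ?C. \<sigma> \<subseteq> \<tau>}" using v by blast
      then show "?a \<in> ?t ` \<sigma>" using v(1) by (auto simp: t_eq intro!: image_eqI[of _ _ v])
    qed (use f in auto)
    moreover have "Max (insert 0 (?t ` (gsupp ?t - \<sigma>))) = ?b"
    proof (rule Max_eqI)
      have b0: "0 \<le> ?b" by (intro sum_nonneg m_nn)
      show "y \<le> ?b" if y: "y \<in> insert 0 (?t ` (gsupp ?t - \<sigma>))" for y
      proof (cases "y = 0")
        case False
        then obtain w where w: "w \<notin> \<sigma>" "y = ?t w" using y by auto
        have "{\<tau> \<in> ?C. w \<in> \<tau>} \<subseteq> {\<tau> \<in> ?C. \<sigma> \<subset> \<tau>}"
          using w(1) True ch unfolding chain_def by blast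
        then show ?thesis using fin m_nn unfolding w(2) t_eq by (intro sum_mono2) auto
      qed (use b0 in auto)
      show "?b \<in> insert 0 (?t ` (gsupp ?t - \<sigma>))"
      proof (cases "{\<tau> \<in> ?C. \<sigma> \<subset> \<tau>} = {}")
        case True
        then have "?b = 0" by (simp only: sum.empty)
        then show ?thesis by simp
      next
        case False
        let ?D = "{\<tau> \<in> ?C. \<sigma> \<subset> \<tau>}"
        have fD: "finite ?D" using fin by simp
        \<comment> \<open>The maximum is attained at a vertex off \<open>\<sigma>\<close> of the
          smallest member above \<open>\<sigma>\<close>.\<close>
        obtain \<tau>0 where \<tau>0: "\<tau>0 \<in> ?D" "\<And>\<tau>. \<tau> \<in> ?D \<Longrightarrow> \<not> \<tau> \<subset> \<tau>0"
          using finite_has_minimal[OF fD False] by (metis psubset_eq)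
        then obtain w where w: "w \<in> \<tau>0" "w \<notin> \<sigma>" by blast
        have "{\<tau> \<in> ?C. w \<in> \<tau>} = ?D"
          using w \<tau>0 True ch unfolding chain_def by blast
        then have "?t w = ?b" by (simp add: t_eq)
        moreover have "w \<in> gsupp ?t - \<sigma>" using w \<tau>0(1) by (auto simp: supp_t)
        ultimately show ?thesis by (metis imageI insertCI)
      qed
    qed (use fU in \<open>auto simp: supp_t\<close>)
    moreover have "?a = ?b + m \<sigma>"
    proof -
      have "{\<tau> \<in> ?C. \<sigma> \<subseteq> \<tau>} = insert \<sigma> {\<tau> \<in> ?C. \<sigma> \<subset> \<tau>}" using True by blast
      then show ?thesis using fin by simp
    qed
    ultimately show ?thesis
      using f m_nn[of \<sigma>] by (simp add: sd_coord_def) (simp add: m_def)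
  next
    case False
    then have x0: "x \<sigma> = 0" by (simp add: gsupp_def)
    have "Min (?t ` \<sigma>) \<le> Max (insert 0 (?t ` (gsupp ?t - \<sigma>)))" if f: "finite \<sigma>" "\<sigma> \<noteq> {}"
    proof -
      have fM: "finite (insert 0 (?t ` (gsupp ?t - \<sigma>)))" using fU by (simp add: supp_t)
      show ?thesis
      proof (cases "\<sigma> \<subseteq> \<Union>?C")
        case False
        then obtain v where "v \<in> \<sigma>" "?t v = 0" using supp_t by (auto simp: gsupp_def)
        then have "Min (?t ` \<sigma>) \<le> 0" using f by (metis Min_le finite_imageI imageI)
        also have "0 \<le> Max (insert 0 (?t ` (gsupp ?t - \<sigma>)))" using fM by simp
        finally show ?thesis .
      next
        case sub: True
        then have "?C \<noteq> {}" using f by auto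
        then have "\<Union>?C \<in> {\<tau> \<in> ?C. \<sigma> \<subseteq> \<tau>}" using chain_Union_in[OF fin _ ch] sub by auto
        then have ne: "{\<tau> \<in> ?C. \<sigma> \<subseteq> \<tau>} \<noteq> {}" by blast
        have fD: "finite {\<tau> \<in> ?C. \<sigma> \<subseteq> \<tau>}" using fin by simp
        \<comment> \<open>The smallest member containing \<open>\<sigma>\<close> is strictly larger.
          A vertex \<open>w\<close> of it off \<open>\<sigma>\<close> has at least the value of a
          suitable \<open>v\<close> in \<open>\<sigma>\<close>, which closes the gap.\<close>
        obtain \<tau>0 where \<tau>0: "\<tau>0 \<in> ?C" "\<sigma> \<subseteq> \<tau>0" "\<And>\<tau>. \<tau> \<in> ?C \<Longrightarrow> \<sigma> \<subseteq> \<tau> \<Longrightarrow> \<not> \<tau> \<subset> \<tau>0"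
          using finite_has_minimal[OF fD ne] by (metis (no_types, lifting) mem_Collect_eq psubset_eq)
        have "\<sigma> \<noteq> \<tau>0" using False \<tau>0(1) by auto
        then obtain w where w: "w \<in> \<tau>0" "w \<notin> \<sigma>" using \<tau>0(2) by blast
        obtain v where v: "v \<in> \<sigma>" "\<And>\<tau>. \<tau> \<in> ?C \<Longrightarrow> \<not> \<sigma> \<subseteq> \<tau> \<Longrightarrow> v \<notin> \<tau>"
          using avoid[of "{\<tau> \<in> ?C. \<not> \<sigma> \<subseteq> \<tau>}" \<sigma>] f by blast
        have "{\<tau> \<in> ?C. v \<in> \<tau>} \<subseteq> {\<tau> \<in> ?C. w \<in> \<tau>}"
        proof
          fix \<tau> assume \<tau>: "\<tau> \<in> {\<tau> \<in> ?C. v \<in> \<tau>}"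
          then have "\<sigma> \<subseteq> \<tau>" using v(2) by blast
          then have "\<tau>0 \<subseteq> \<tau>" using \<tau>0 \<tau> ch unfolding chain_def by blast
          then show "\<tau> \<in> {\<tau> \<in> ?C. w \<in> \<tau>}" using w \<tau> by blast
        qed
        then have "?t v \<le> ?t w" unfolding t_eq using fin m_nn by (intro sum_mono2) auto
        moreover have "Min (?t ` \<sigma>) \<le> ?t v" using f v(1) by simp
        moreover have "?t w \<le> Max (insert 0 (?t ` (gsupp ?t - \<sigma>)))"
          using w \<tau>0(1) fM by (intro Max_ge) (auto simp: supp_t)
        ultimately show ?thesis by linarith
      qed
    qed
    then show ?thesis using x0 by (auto simp: sd_coord_def)
  qed
qed

text \<open>Layers are peeled off: subtracting the minimum over the support \<open>S\<close> leaves
  a function of smaller support, and the removed layer is a mass of \<open>card S\<close> times the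
  minimum, placed at the barycentre of \<open>S\<close>.\<close>

lemma sd_bary_surj_aux:
  fixes t :: "'a \<Rightarrow> real"
  assumes "finite (gsupp t)" "\<And>v. 0 \<le> t v"
  shows "\<exists>x. (\<forall>\<sigma>. 0 \<le> x \<sigma>) \<and> finite (gsupp x) \<and> chain (gsupp x) \<and>
     (\<forall>\<sigma>\<in>gsupp x. \<sigma> \<noteq> {} \<and> \<sigma> \<subseteq> gsupp t) \<and> sd_bary x = t"
  using assms
proof (induction "card (gsupp t)" arbitrary: t rule: less_induct)
  case less
  let ?S = "gsupp t"
  show ?case
  proof (cases "?S = {}")
    case True
    then have "sd_bary (\<lambda>_. 0) = t" by (auto simp: gsupp_def sd_bary_def fun_eq_iff)
    then show ?thesis by (intro exI[of _ "\<lambda>_. 0"]) (auto simp: gsupp_def chain_def)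
  next
    case False
    define m where "m = Min (t ` ?S)"
    have m_le: "m \<le> t v" if "v \<in> ?S" for v using that less.prems(1) by (auto simp: m_def)
    have "m \<in> t ` ?S" unfolding m_def using False less.prems(1) by (intro Min_in) auto
    then obtain v0 where v0: "v0 \<in> ?S" "t v0 = m" by auto
    have m_pos: "0 < m" using v0 less.prems(2)[of v0] by (auto simp: gsupp_def)
    define t' where "t' v = (if v \<in> ?S then t v - m else 0)" for v
    have "gsupp t' \<subseteq> ?S" by (auto simp: t'_def gsupp_def)
    moreover have "v0 \<notin> gsupp t'" using v0 by (simp add: t'_def gsupp_def)
    ultimately have sub: "gsupp t' \<subset> ?S" using v0(1) by blast
    then have "card (gsupp t') < card ?S" using less.prems(1) by (simp add: psubset_card_mono)
    moreover have "finite (gsupp t')" using sub less.prems(1) finite_subset by blast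
    moreover have "0 \<le> t' v" for v using m_le by (simp add: t'_def)
    ultimately obtain x where x: "\<forall>\<sigma>. 0 \<le> x \<sigma>" "finite (gsupp x)" "chain (gsupp x)"
      "\<forall>\<sigma>\<in>gsupp x. \<sigma> \<noteq> {} \<and> \<sigma> \<subseteq> gsupp t'" "sd_bary x = t'"
      using less.hyps[of t'] by blast
    have xS: "x ?S = 0" using x(4) sub by (auto simp: gsupp_def)
    define y where "y = x(?S := real (card ?S) * m)"
    have cS: "card ?S \<noteq> 0" using False less.prems(1) by simp
    have gy: "gsupp y = insert ?S (gsupp x)" using m_pos cS by (auto simp: y_def gsupp_def)
    have SN: "?S \<notin> gsupp x" using xS by (simp add: gsupp_def)
    have "sd_bary y = t"
    proof
      fix v
      have "sd_bary y v = (if v \<in> ?S then y ?S / real (card ?S) else 0) +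
          (\<Sum>\<sigma>\<in>gsupp x. if v \<in> \<sigma> then y \<sigma> / real (card \<sigma>) else 0)"
        unfolding sd_bary_def gy using x(2) SN by simp
      also have "(\<Sum>\<sigma>\<in>gsupp x. if v \<in> \<sigma> then y \<sigma> / real (card \<sigma>) else 0) = sd_bary x v"
        unfolding sd_bary_def using SN by (intro sum.cong) (auto simp: y_def)
      also have "\<dots> = t' v" using x(5) by simp
      finally have v: "sd_bary y v = (if v \<in> ?S then y ?S / real (card ?S) else 0) + t' v" .
      have yS: "y ?S / real (card ?S) = m" using cS by (simp add: y_def)
      show "sd_bary y v = t v"
      proof (cases "v \<in> ?S")
        case True
        then show ?thesis by (simp add: v yS t'_def)
      next
        case False
        then have "t v = 0" by (simp add: gsupp_def)
        then show ?thesis using False by (simp add: v t'_def)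
      qed
    qed
    moreover have "chain (gsupp y)"
      using x(3,4) sub unfolding gy chain_def by blast
    moreover have "\<forall>\<sigma>. 0 \<le> y \<sigma>" using x(1) m_pos by (simp add: y_def)
    moreover have "finite (gsupp y)" using x(2) by (simp add: gy)
    moreover have "\<forall>\<sigma>\<in>gsupp y. \<sigma> \<noteq> {} \<and> \<sigma> \<subseteq> ?S" using x(4) sub False unfolding gy by blast
    ultimately show ?thesis by blast
  qed
qed

lemma continuous_map_Min:
  assumes "finite S" "S \<noteq> {}" "\<And>v. v \<in> S \<Longrightarrow> continuous_map X euclideanreal (\<lambda>x. f x v)"
  shows "continuous_map X euclideanreal (\<lambda>x. Min (f x ` S))"
  using assms
proof (induction S rule: finite_ne_induct)
  case (insert v S)
  then have "continuous_map X euclideanreal (\<lambda>x. min (f x v) (Min (f x ` S)))"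
    by (intro continuous_map_real_min) auto
  then show ?case using insert by simp
qed simp

lemma continuous_map_Max0:
  assumes "finite S" "\<And>v. v \<in> S \<Longrightarrow> continuous_map X euclideanreal (\<lambda>x. f x v)"
  shows "continuous_map X euclideanreal (\<lambda>x. Max (insert (0::real) (f x ` S)))"
  using assms
proof (induction S rule: finite_induct)
  case (insert v S)
  then have "continuous_map X euclideanreal (\<lambda>x. max (f x v) (Max (insert 0 (f x ` S))))"
    by (intro continuous_map_real_max) auto
  moreover have "Max (insert 0 (f x ` insert v S)) = max (f x v) (Max (insert 0 (f x ` S)))" for x
    using insert(1) by (subst Max_insert[symmetric]) (auto simp: insert_commute)
  ultimately show ?case by simp
qed simp

text \<open>The two maps are inverse bijections. Continuity of the inverse comes from its formula in
  minima and maxima of coordinates, together with the fact that over one simplex only finitely many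
  chains of faces occur.\<close>

lemma hinverse_sd:
  assumes K: "complex K"
  shows "hinverse (geo (sd K)) (geo K) sd_bary sd_coord"
proof -
  have C: "finite C \<and> C \<noteq> {} \<and> C \<subseteq> K \<and> chain C" if "C \<in> sd K" for C using that by (simp add: sd_def)
  have bary_in: "sd_bary x \<in> gsimp (\<Union>C)" if Cs: "C \<in> sd K" and x: "x \<in> gsimp C" for x C
  proof -
    note C' = C[OF Cs]
    have fU: "finite (\<Union>C)" using C' by (auto intro: complex_finite[OF K])
    have x0: "\<And>\<sigma>. 0 \<le> x \<sigma>" "gsupp x \<subseteq> C" "sum x C = 1" using x by (auto simp: gsimp_def)
    have eq: "sd_bary x v = (\<Sum>\<sigma>\<in>C. if v \<in> \<sigma> then x \<sigma> / real (card \<sigma>) else 0)" for v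
      unfolding sd_bary_def using C' x0 by (intro sum_gsupp) auto
    have "sum (sd_bary x) (\<Union>C) = (\<Sum>\<sigma>\<in>C. \<Sum>v\<in>\<Union>C. if v \<in> \<sigma> then x \<sigma> / real (card \<sigma>) else 0)"
      unfolding eq by (rule sum.swap)
    also have "\<dots> = sum x C"
    proof (intro sum.cong refl)
      fix \<sigma> assume \<sigma>: "\<sigma> \<in> C"
      then have "{v \<in> \<Union>C. v \<in> \<sigma>} = \<sigma>" by blast
      moreover have "finite \<sigma>" "\<sigma> \<noteq> {}" using \<sigma> C' complex_finite[OF K] complex_nonempty[OF K] by auto
      ultimately show "(\<Sum>v\<in>\<Union>C. if v \<in> \<sigma> then x \<sigma> / real (card \<sigma>) else 0) = x \<sigma>"
        using fU by (simp add: sum.inter_filter[symmetric])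
    qed
    finally have "sum (sd_bary x) (\<Union>C) = 1" using x0 by simp
    moreover have "0 \<le> sd_bary x v" for v
      unfolding eq using x0 by (intro sum_nonneg) auto
    moreover have "sd_bary x v = 0" if "v \<notin> \<Union>C" for v
      unfolding eq using that by (intro sum.neutral) auto
    ultimately show ?thesis by (auto simp: gsimp_def gsupp_def)
  qed
  have c1: "continuous_map (geo (sd K)) (geo K) sd_bary"
  proof (rule continuous_map_from_geo)
    fix D assume D: "D \<in> sd K"
    note D' = C[OF D]
    show "continuous_map (gcell D) (geo K) sd_bary"
    proof (rule continuous_map_into_geo[of "{\<Union>D}"])
      show "{\<Union>D} \<subseteq> K" using D' chain_Union_in[of D] by auto
      have "continuous_map (gcell D) euclideanreal (\<lambda>x. \<Sum>\<sigma>\<in>D. if v \<in> \<sigma> then x \<sigma> / real (card \<sigma>) else 0)" for v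
      proof (intro continuous_map_sum)
        show "continuous_map (gcell D) euclideanreal (\<lambda>x. if v \<in> \<sigma> then x \<sigma> / real (card \<sigma>) else 0)" for \<sigma>
          by (cases "v \<in> \<sigma> \<and> card \<sigma> \<noteq> 0")
            (auto intro!: continuous_map_real_divide continuous_map_gcell_coord)
      qed (use D' in auto)
      then show "continuous_map (gcell D) euclideanreal (\<lambda>x. sd_bary x v)" for v
      proof (rule continuous_map_eq)
        show "(\<Sum>\<sigma>\<in>D. if v \<in> \<sigma> then x \<sigma> / real (card \<sigma>) else 0) = sd_bary x v"
          if "x \<in> topspace (gcell D)" for x v
          unfolding sd_bary_def using D' that
          by (intro sum_gsupp[symmetric]) (auto simp: gsimp_def)
      qed
    qed (use bary_in[OF D] in auto)
  qed
  have inv1: "sd_coord (sd_bary x) = x" if "x \<in> topspace (geo (sd K))" for x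
  proof -
    have "gsupp x \<in> sd K" "x \<in> gsimp (gsupp x)" using that in_geo_iff[OF complex_sd] by auto
    then show ?thesis
      using C[of "gsupp x"] complex_finite[OF K] complex_nonempty[OF K]
      by (intro ext sd_coord_bary_aux) (auto simp: gsimp_def)
  qed
  have surj: "\<exists>x\<in>topspace (geo (sd K)). sd_bary x = t \<and> gsupp x \<subseteq> Pow (gsupp t)" if t: "t \<in> topspace (geo K)" for t
  proof -
    have t': "gsupp t \<in> K" "t \<in> gsimp (gsupp t)" using t in_geo_iff[OF K] by auto
    have ft: "finite (gsupp t)" by (rule complex_finite[OF K t'(1)])
    obtain x where x: "\<forall>\<sigma>. 0 \<le> x \<sigma>" "finite (gsupp x)" "chain (gsupp x)"
      "\<forall>\<sigma>\<in>gsupp x. \<sigma> \<noteq> {} \<and> \<sigma> \<subseteq> gsupp t" "sd_bary x = t"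
      using sd_bary_surj_aux[OF ft] t' by (force simp: gsimp_def)
    have "gsupp x \<subseteq> K" using x(4) complex_subset[OF K t'(1)] by blast
    moreover have "gsupp x \<noteq> {}"
    proof
      assume "gsupp x = {}"
      then have "t v = 0" for v unfolding x(5)[symmetric] sd_bary_def by simp
      then show False using gsimp_gsupp_ne[OF t'(2)] by (simp add: gsupp_def)
    qed
    ultimately have gx: "gsupp x \<in> sd K" using x by (simp add: sd_def)
    have "1 = sum t (gsupp t)" using t' by (simp add: gsimp_def)
    also have "\<dots> = (\<Sum>\<sigma>\<in>gsupp x. \<Sum>v\<in>gsupp t. if v \<in> \<sigma> then x \<sigma> / real (card \<sigma>) else 0)"
      unfolding x(5)[symmetric] sd_bary_def[of x] by (rule sum.swap)
    also have "\<dots> = sum x (gsupp x)"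
    proof (intro sum.cong refl)
      fix \<sigma> assume \<sigma>: "\<sigma> \<in> gsupp x"
      then have "{v \<in> gsupp t. v \<in> \<sigma>} = \<sigma>" "finite \<sigma>" "\<sigma> \<noteq> {}" using x(4) ft finite_subset by blast+
      then show "(\<Sum>v\<in>gsupp t. if v \<in> \<sigma> then x \<sigma> / real (card \<sigma>) else 0) = x \<sigma>"
        using ft by (simp add: sum.inter_filter[symmetric])
    qed
    finally have "x \<in> gsimp (gsupp x)" using x(1) by (simp add: gsimp_def)
    then show ?thesis using gx x(4,5) by (intro bexI[of _ x]) (auto simp: topspace_geo)
  qed
  have c2: "continuous_map (geo K) (geo (sd K)) sd_coord"
  proof (rule continuous_map_from_geo)
    fix s assume s: "s \<in> K"
    have fs: "finite s" by (rule complex_finite[OF K s])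
    show "continuous_map (gcell s) (geo (sd K)) sd_coord"
    proof (rule continuous_map_into_geo[of "{D \<in> sd K. D \<subseteq> Pow s}"])
      show "finite {D \<in> sd K. D \<subseteq> Pow s}"
        using fs by (auto intro: finite_subset[of _ "Pow (Pow s)"])
      fix t assume "t \<in> topspace (gcell s)"
      then have t: "t \<in> gsimp s" by simp
      then obtain x where x: "x \<in> topspace (geo (sd K))" "sd_bary x = t" "gsupp x \<subseteq> Pow (gsupp t)"
        using surj[of t] s by (auto simp: topspace_geo)
      have "sd_coord t = x" using inv1[OF x(1)] x(2) by simp
      then show "\<exists>\<tau>\<in>{D \<in> sd K. D \<subseteq> Pow s}. sd_coord t \<in> gsimp \<tau>"
        using x t in_geo_iff[OF complex_sd, of x K] by (intro bexI[of _ "gsupp x"]) (auto simp: gsimp_def dest!: subsetD)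
    next
      fix \<sigma>
      show "continuous_map (gcell s) euclideanreal (\<lambda>t. sd_coord t \<sigma>)"
      proof (cases "finite \<sigma> \<and> \<sigma> \<noteq> {}")
        case True
        have "continuous_map (gcell s) euclideanreal
            (\<lambda>t. real (card \<sigma>) * max 0 (Min (t ` \<sigma>) - Max (insert 0 (t ` (s - \<sigma>)))))"
          using True fs
          by (intro continuous_map_real_mult continuous_map_real_max continuous_map_diff
              continuous_map_Min continuous_map_Max0 continuous_map_gcell_coord) auto
        then show ?thesis
        proof (rule continuous_map_eq)
          fix t assume "t \<in> topspace (gcell s)"
          then have "gsupp t \<subseteq> s" by (simp add: gsimp_def)
          \<comment> \<open>The index set becomes independent of \<open>t\<close>: the added
            coordinates are 0, a value already present.\<close>
          then have "insert 0 (t ` (s - \<sigma>)) = insert 0 (t ` (gsupp t - \<sigma>))" by (auto simp: gsupp_def)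
          then show "real (card \<sigma>) * max 0 (Min (t ` \<sigma>) - Max (insert 0 (t ` (s - \<sigma>)))) = sd_coord t \<sigma>"
            using True by (simp add: sd_coord_def)
        qed
      next
        case False
        then have "sd_coord t \<sigma> = 0" for t by (auto simp: sd_coord_def)
        then show ?thesis by simp
      qed
    qed auto
  qed
  have inv2: "sd_bary (sd_coord t) = t" if "t \<in> topspace (geo K)" for t
    using surj[OF that] inv1 by force
  have "homotopic_with (\<lambda>_. True) (geo (sd K)) (geo (sd K)) (sd_coord \<circ> sd_bary) id"
    using inv1 by (intro homotopic_with_equal continuous_map_compose[OF c1 c2]) auto
  moreover have "homotopic_with (\<lambda>_. True) (geo K) (geo K) (sd_bary \<circ> sd_coord) id"
    using inv2 by (intro homotopic_with_equal continuous_map_compose[OF c2 c1]) auto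
  ultimately show ?thesis using c1 c2 by (simp add: hinverse_def)
qed

section \<open>The blow-up of the subdivision\<close>

text \<open>\<open>sd K\<close> is flag but has no canonical simplicial map to \<open>K\<close>.
  Recording a vertex of each face supplies one, \<open>fst\<close>, while membership remains a
  condition on pairs; compared with \<open>sd K\<close>, each vertex is replaced by a simplex of
  copies.\<close>

definition blow :: "'a set set \<Rightarrow> ('a \<times> 'a set) set set" where
  "blow K = {s. finite s \<and> s \<noteq> {} \<and> (\<forall>p\<in>s. fst p \<in> snd p \<and> snd p \<in> K) \<and> chain (snd ` s)}"

lemma complex_blow: "complex (blow K)"
  unfolding complex_def
proof (intro conjI ballI allI impI)
  fix s t :: "('a \<times> 'a set) set"
  assume s: "s \<in> blow K" and t: "t \<subseteq> s \<and> t \<noteq> {}"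
  have "finite t" using s t finite_subset[of t s] by (simp add: blow_def)
  moreover have "chain (snd ` t)" using s t chain_subset[of "snd ` s" "snd ` t"] by (auto simp: blow_def)
  ultimately show "t \<in> blow K" using s t by (auto simp: blow_def)
qed (auto simp: blow_def)

text \<open>Apart from finiteness, the conditions in \<open>blow\<close> concern at most two
  elements at a time.\<close>

lemma Cl_skel1_blow: "Cl (skel1 (blow K)) \<subseteq> blow K"
proof
  fix s assume s: "s \<in> Cl (skel1 (blow K))"
  then have f: "finite s" "s \<noteq> {}" and p: "\<And>u v. u \<in> s \<Longrightarrow> v \<in> s \<Longrightarrow> {u, v} \<in> blow K"
    by (auto simp: Cl_def skel1_def)
  have "fst u \<in> snd u \<and> snd u \<in> K" if "u \<in> s" for u using p[OF that that] by (simp add: blow_def)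
  moreover have "chain (snd ` s)"
    using p unfolding blow_def chain_def by blast
  ultimately show "s \<in> blow K" using f by (auto simp: blow_def)
qed

text \<open>\<open>snd\<close> has the section \<open>j\<close>; on a simplex the copies selected by
  \<open>j\<close> may be added, so the composite is contiguous to the identity. The linear map of
  \<open>fst\<close> and the subdivision homeomorphism after \<open>snd\<close> both send a simplex
  into the largest face of its chain, hence are homotopic.\<close>

lemma hinverse_blow:
  assumes K: "complex K"
  obtains g where "cpx_map (blow K) K fst" "hinverse (geo (blow K)) (geo K) (gmap fst) g"
proof -
  define j where "j \<sigma> = (SOME v. v \<in> \<sigma>, \<sigma>)" for \<sigma> :: "'a set"
  have j_in: "fst (j \<sigma>) \<in> \<sigma>" if "\<sigma> \<in> K" for \<sigma>
    using complex_nonempty[OF K that] by (auto simp: j_def some_in_eq)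
  have m1: "cpx_map (blow K) (sd K) snd"
    by (auto simp: cpx_map_def blow_def sd_def)
  have m2: "cpx_map (sd K) (blow K) j"
  proof -
    have "snd ` j ` C = C" for C by (force simp: j_def)
    then show ?thesis using j_in by (auto simp: cpx_map_def blow_def sd_def) (auto simp: j_def)
  qed
  have top: "\<Union>(snd ` s) \<in> K" "fst ` s \<subseteq> \<Union>(snd ` s)" if "s \<in> blow K" for s
    using that chain_Union_in[of "snd ` s"] by (auto simp: blow_def)
  have m3: "cpx_map (blow K) K fst"
    unfolding cpx_map_def
  proof
    show "fst ` s \<in> K" if "s \<in> blow K" for s
      using complex_subset[OF K top[OF that]] that by (auto simp: blow_def)
  qed
  note c1 = continuous_map_gmap[OF complex_blow complex_sd m1] and c2 = continuous_map_gmap[OF complex_sd complex_blow m2]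
  have e1: "hinverse (geo (blow K)) (geo (sd K)) (gmap snd) (gmap j)"
    unfolding hinverse_def
  proof (intro conjI c1 c2)
    have "gmap snd (gmap j x) = x" if "x \<in> topspace (geo (sd K))" for x
      using gmap_gmap[of x snd j] gmap_id_on[of x "snd \<circ> j"] finite_gsupp_geo[OF complex_sd that]
      by (simp add: j_def)
    then show "homotopic_with (\<lambda>_. True) (geo (sd K)) (geo (sd K)) (gmap snd \<circ> gmap j) id"
      by (intro homotopic_with_equal continuous_map_compose[OF c2 c1]) auto
    have "homotopic_with (\<lambda>_. True) (geo (blow K)) (geo (blow K)) (gmap id) (gmap (j \<circ> snd))"
    proof (rule homotopic_ordered[OF complex_blow complex_blow])
      fix s i assume s: "s \<in> blow K"
      have s': "finite s" "s \<noteq> {}" "chain (snd ` s)" "\<And>p. p \<in> s \<Longrightarrow> fst p \<in> snd p \<and> snd p \<in> K"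
        using s by (auto simp: blow_def)
      have "mixed id (j \<circ> snd) (\<lambda>_. 0) s i \<subseteq> s \<union> (j \<circ> snd) ` s" by (auto simp: mixed_def)
      moreover have "s \<union> (j \<circ> snd) ` s \<in> blow K"
      proof -
        have "snd ` (s \<union> (j \<circ> snd) ` s) = snd ` s" by (force simp: j_def)
        then show ?thesis using s' j_in by (auto simp: blow_def) (auto simp: j_def)
      qed
      moreover have "mixed id (j \<circ> snd) (\<lambda>_. 0) s i \<noteq> {}" using s'(2) by (auto simp: mixed_def)
      ultimately show "mixed id (j \<circ> snd) (\<lambda>_. 0) s i \<in> blow K"
        using complex_subset[OF complex_blow] by blast
    qed simp
    from homotopic_with_symD[OF this]
    show "homotopic_with (\<lambda>_. True) (geo (blow K)) (geo (blow K)) (gmap j \<circ> gmap snd) id"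
    proof (rule homotopic_with_eq)
      fix x assume x: "x \<in> topspace (geo (blow K))"
      note f = finite_gsupp_geo[OF complex_blow x]
      show "(gmap j \<circ> gmap snd) x = gmap (j \<circ> snd) x" using gmap_gmap[OF f] by simp
      show "id x = gmap id x" using gmap_id_on[OF f, of id] by simp
    qed auto
  qed
  have e2: "hinverse (geo (blow K)) (geo K) (sd_bary \<circ> gmap snd) (gmap j \<circ> sd_coord)"
    by (rule hinverse_comp[OF e1 hinverse_sd[OF K]])
  have "homotopic_with (\<lambda>_. True) (geo (blow K)) (geo K) (sd_bary \<circ> gmap snd) (gmap fst)"
  proof (rule homotopic_straight_line[OF K])
    show "continuous_map (geo (blow K)) (geo K) (sd_bary \<circ> gmap snd)"
      using e2 by (simp add: hinverse_def)
    show "continuous_map (geo (blow K)) (geo K) (gmap fst)"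
      by (rule continuous_map_gmap[OF complex_blow K m3])
    fix s assume s: "s \<in> blow K"
    have fs: "finite s" by (rule complex_finite[OF complex_blow s])
    have fU: "finite (\<Union>(snd ` s))" by (rule complex_finite[OF K top(1)[OF s]])
    show "\<exists>\<tau>\<in>K. \<forall>x\<in>gsimp s. (sd_bary \<circ> gmap snd) x \<in> gsimp \<tau> \<and> gmap fst x \<in> gsimp \<tau>"
    proof (intro bexI[OF _ top(1)[OF s]] ballI conjI)
      fix x assume x: "x \<in> gsimp s"
      show "gmap fst x \<in> gsimp (\<Union>(snd ` s))" by (rule gmap_gsimp[OF fs x top(2)[OF s] fU])
      have y: "gmap snd x \<in> gsimp (snd ` s)" by (rule gmap_gsimp[OF fs x]) (use fs in auto)
      have z: "sd_bary (gmap snd x) \<in> topspace (geo K)"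
      proof -
        have "snd ` s \<in> sd K" using m1 s by (simp add: cpx_map_def)
        then have "gmap snd x \<in> topspace (geo (sd K))" using y by (auto simp: topspace_geo)
        moreover have "continuous_map (geo (sd K)) (geo K) sd_bary"
          using hinverse_sd[OF K] by (simp add: hinverse_def)
        ultimately show ?thesis by (auto simp: continuous_map_def)
      qed
      have "gsupp (sd_bary (gmap snd x)) \<subseteq> \<Union>(snd ` s)"
      proof
        fix v assume "v \<in> gsupp (sd_bary (gmap snd x))"
        then have "(\<Sum>\<sigma>\<in>gsupp (gmap snd x). if v \<in> \<sigma> then gmap snd x \<sigma> / real (card \<sigma>) else 0) \<noteq> 0"
          by (simp add: gsupp_def sd_bary_def)
        then obtain \<sigma> where "\<sigma> \<in> gsupp (gmap snd x)" "(if v \<in> \<sigma> then gmap snd x \<sigma> / real (card \<sigma>) else 0) \<noteq> 0"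
          by (rule sum.not_neutral_contains_not_neutral)
        then have "v \<in> \<sigma>" "\<sigma> \<in> gsupp (gmap snd x)" by (auto split: if_splits)
        moreover have "gsupp (gmap snd x) \<subseteq> snd ` s" using y by (simp add: gsimp_def)
        ultimately show "v \<in> \<Union>(snd ` s)" by blast
      qed
      moreover have "sd_bary (gmap snd x) \<in> gsimp (gsupp (sd_bary (gmap snd x)))"
        using z in_geo_iff[OF K] by blast
      ultimately show "(sd_bary \<circ> gmap snd) x \<in> gsimp (\<Union>(snd ` s))"
        using gsimp_mono[OF _ _ fU] by auto
    qed
  qed
  from hinverse_homotopic[OF e2 this] m3 show thesis by (intro that)
qed

section \<open>Free cell complexes\<close>

text \<open>In \<open>Cell n k f g c\<close> the map \<open>f\<close> attaches the double
  subdivision of a horn, \<open>g\<close> maps the whole doubly subdivided simplex to the base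
  complex, and \<open>c\<close> is a vertex of it. With \<open>f\<close> and \<open>g\<close> in the
  name, cells for different lifting problems stay apart outside their horns.\<close>

datatype 'a vtx =
    Base 'a "'a set"
  | Cell nat nat "nat set set \<Rightarrow> 'a vtx" "nat set set \<Rightarrow> 'a" "nat set set"

text \<open>For \<open>S \<subseteq> {..n}\<close> and \<open>k \<le> n\<close> the condition says
  that \<open>S\<close> misses a vertex other than \<open>k\<close>, that is, lies in a face of the
  horn opposite to \<open>k\<close>-avoiding removal: one of the faces indexed by
  \<open>i \<noteq> k\<close>.\<close>

definition horn_face :: "nat \<Rightarrow> nat \<Rightarrow> nat set set" where
  "horn_face n k = {S. insert k S \<noteq> {..n}}"

definition sd2_horn :: "nat \<Rightarrow> nat \<Rightarrow> nat set set set" where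
  "sd2_horn n k = {c \<in> sd2_verts n. c \<subseteq> horn_face n k}"

primrec vproj :: "'a vtx \<Rightarrow> 'a" where
  "vproj (Base v \<sigma>) = v"
| "vproj (Cell n k f g c) = g c"

text \<open>Besides the levels of the attached vertices the dimension \<open>n\<close> is counted
  in, so that all cells of one level have bounded dimension although infinitely many dimensions
  occur overall.\<close>

primrec level :: "'a vtx \<Rightarrow> nat" where
  "level (Base v \<sigma>) = 0"
| "level (Cell n k f g c) = Suc (max n (Max (insert 0 ((\<lambda>d. level (f d)) ` sd2_horn n k))))"

text \<open>Characteristic map of a cell, on the vertices of the double subdivision.\<close>

definition att :: "nat \<Rightarrow> nat \<Rightarrow> (nat set set \<Rightarrow> 'a vtx) \<Rightarrow> (nat set set \<Rightarrow> 'a) \<Rightarrow> nat set set \<Rightarrow> 'a vtx" where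
  "att n k f g c = (if c \<in> sd2_horn n k then f c else Cell n k f g c)"

definition cchain :: "nat \<Rightarrow> nat set set set \<Rightarrow> bool" where
  "cchain n C \<longleftrightarrow> C \<noteq> {} \<and> C \<subseteq> sd2_verts n \<and> chain C"

text \<open>Starting from \<open>blow K\<close>, a double subdivision of a simplex is glued on freely along every
  map from the double subdivision of one of its horns, over \<open>K\<close>.  The vertices are
  well-founded names, so all stages of the construction are obtained at once.\<close>

inductive_set cell_cpx :: "'a set set \<Rightarrow> 'a vtx set set" for K :: "'a set set" where
  base: "s \<in> blow K \<Longrightarrow> (\<lambda>p. Base (fst p) (snd p)) ` s \<in> cell_cpx K"
| cell: "1 \<le> n \<Longrightarrow> k \<le> n \<Longrightarrow> \<forall>C. cchain n C \<and> C \<subseteq> sd2_horn n k \<longrightarrow> f ` C \<in> cell_cpx K \<Longrightarrow>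
    g \<in> Ex2Sing K n \<Longrightarrow> \<forall>c. c \<notin> sd2_horn n k \<longrightarrow> f c = undefined \<Longrightarrow>
    \<forall>c\<in>sd2_horn n k. vproj (f c) = g c \<Longrightarrow> cchain n C \<Longrightarrow> att n k f g ` C \<in> cell_cpx K"

lemma finite_sd2_verts: "finite (sd2_verts n)"
  by (rule finite_subset[of _ "Pow (Pow {..n})"]) (auto simp: sd2_verts_def)

lemma finite_sd2_horn: "finite (sd2_horn n k)"
  using finite_sd2_verts by (auto simp: sd2_horn_def)

lemma sd2_vertsD:
  assumes "c \<in> sd2_verts n"
  shows "c \<noteq> {}" "finite c" "\<And>S. S \<in> c \<Longrightarrow> S \<noteq> {} \<and> S \<subseteq> {..n} \<and> finite S" "chain c"
proof -
  show "c \<noteq> {}" "chain c" "\<And>S. S \<in> c \<Longrightarrow> S \<noteq> {} \<and> S \<subseteq> {..n} \<and> finite S"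
    using assms finite_subset[of _ "{..n}"] by (auto simp: sd2_verts_def chain_def)
  show "finite c"
    by (rule finite_subset[of _ "Pow {..n}"]) (use assms in \<open>auto simp: sd2_verts_def\<close>)
qed

lemma sd2_vertsI:
  assumes "c \<noteq> {}" "\<And>S. S \<in> c \<Longrightarrow> S \<noteq> {} \<and> S \<subseteq> {..n}" "chain c"
  shows "c \<in> sd2_verts n"
  using assms by (auto simp: sd2_verts_def chain_def)

lemma level_cell: "n < level (Cell n k f g c)" "d \<in> sd2_horn n k \<Longrightarrow> level (f d) < level (Cell n k f g c)"
proof -
  show "n < level (Cell n k f g c)" by simp
  assume d: "d \<in> sd2_horn n k"
  have "level (f d) \<le> Max (insert 0 ((\<lambda>d. level (f d)) ` sd2_horn n k))"
    using d finite_sd2_horn by (intro Max_ge) auto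
  then show "level (f d) < level (Cell n k f g c)" by simp
qed

lemma level_cell_cong: "level (Cell n k f g c) = level (Cell n k f g c')"
  by simp

lemma vproj_att:
  assumes "\<forall>c\<in>sd2_horn n k. vproj (f c) = g c"
  shows "vproj (att n k f g c) = g c"
  using assms by (simp add: att_def)

lemma cchain_subset: "cchain n C \<Longrightarrow> D \<subseteq> C \<Longrightarrow> D \<noteq> {} \<Longrightarrow> cchain n D"
  unfolding cchain_def using chain_subset by blast

lemma subset_image_conv: "t \<subseteq> h ` C \<Longrightarrow> t = h ` {c \<in> C. h c \<in> t}"
  by blast

lemma complex_cell_cpx: "complex (cell_cpx K)"
  unfolding complex_def
proof (intro conjI ballI allI impI)
  fix s assume "s \<in> cell_cpx K"
  then show "finite s"
  proof cases
    case (base s')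
    then show ?thesis by (simp add: blow_def)
  next
    case (cell n k f g C)
    then have "finite C" using finite_subset[OF _ finite_sd2_verts[of n]] by (simp add: cchain_def)
    then show ?thesis using cell by simp
  qed
  show "s \<noteq> {}" using \<open>s \<in> cell_cpx K\<close> by cases (auto simp: blow_def cchain_def)
next
  fix s t assume "s \<in> cell_cpx K" and t: "t \<subseteq> s \<and> t \<noteq> {}"
  from this(1) show "t \<in> cell_cpx K"
  proof cases
    case (base s')
    then obtain t' where t': "t' \<subseteq> s'" "t = (\<lambda>p. Base (fst p) (snd p)) ` t'"
      using t unfolding base(1) subset_image_iff by blast
    then have "t' \<in> blow K" using complex_subset[OF complex_blow base(2)] t by auto
    then show ?thesis using t' cell_cpx.base by blast
  next
    case (cell n k f g C)
    let ?D = "{c \<in> C. att n k f g c \<in> t}"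
    have eq: "t = att n k f g ` ?D" using t cell(1) subset_image_conv by blast
    then have "?D \<noteq> {}" using t by auto
    then have "cchain n ?D" using cchain_subset[OF cell(8)] by auto
    then show ?thesis using cell_cpx.cell[OF cell(2-7)] eq by metis
  qed
qed

lemma vproj_cell_cpx:
  assumes K: "complex K" and s: "s \<in> cell_cpx K"
  shows "vproj ` s \<in> K"
  using s
proof cases
  case (base s')
  have "vproj ` s = fst ` s'" using base by (force simp: image_iff)
  moreover have "fst ` s' \<in> K" using hinverse_blow[OF K] base(2) by (auto simp: cpx_map_def)
  ultimately show ?thesis by simp
next
  case (cell n k f g C)
  have "vproj ` s = g ` C" using cell vproj_att[OF cell(7)] by (auto simp: image_image)
  then show ?thesis using cell(5,8) by (auto simp: Ex2Sing_def cchain_def chain_def)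
qed

text \<open>The gluing data of a cell are stored in the name of each of its vertices; this collects
  what can be recovered from one such name.\<close>

definition cell_ok :: "'a set set \<Rightarrow> nat \<Rightarrow> nat \<Rightarrow> (nat set set \<Rightarrow> 'a vtx) \<Rightarrow> (nat set set \<Rightarrow> 'a) \<Rightarrow> bool" where
  "cell_ok K n k f g \<longleftrightarrow> 1 \<le> n \<and> k \<le> n \<and> g \<in> Ex2Sing K n \<and> (\<forall>c. c \<notin> sd2_horn n k \<longrightarrow> f c = undefined) \<and>
     (\<forall>c\<in>sd2_horn n k. f c \<in> verts (cell_cpx K)) \<and> (\<forall>C. cchain n C \<longrightarrow> att n k f g ` C \<in> cell_cpx K)"

text \<open>A vertex of highest level determines the cell that contains the simplex. In the
  induction, either the cell at hand contributes a vertex of its own to \<open>t\<close>, and since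
  its horn vertices have strictly lower level the top vertex is one of its own too; or
  \<open>t\<close> lies in its horn and the induction hypothesis applies.\<close>

lemma cell_cpx_top:
  assumes "s \<in> cell_cpx K" "t \<subseteq> s" "Cell n k f g c \<in> t" "\<And>v. v \<in> t \<Longrightarrow> level v \<le> level (Cell n k f g c)"
  shows "cell_ok K n k f g \<and> c \<notin> sd2_horn n k \<and> (\<exists>C. cchain n C \<and> c \<in> C \<and> t = att n k f g ` C)"
  using assms
proof (induction arbitrary: t)
  case (base s)
  then show ?case by auto
next
  case (cell n' k' f' g' C)
  let ?a = "att n' k' f' g'"
  show ?case
  proof (cases "\<exists>c'. Cell n' k' f' g' c' \<in> t")
    case True
    then have le: "level (Cell n' k' f' g' c) \<le> level (Cell n k f g c)"
      using cell.prems(3) level_cell_cong by metis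
    obtain c' where c': "c' \<in> C" "Cell n k f g c = ?a c'" using cell.prems(1,2) by blast
    have c'N: "c' \<notin> sd2_horn n' k'"
    proof
      assume h: "c' \<in> sd2_horn n' k'"
      then have "level (Cell n k f g c) < level (Cell n' k' f' g' c)"
        using c'(2) level_cell(2)[OF h, of f' g' c] by (simp add: att_def)
      then show False using le leD by blast
    qed
    then have eq: "n = n'" "k = k'" "f = f'" "g = g'" "c = c'" using c'(2) by (auto simp: att_def)
    let ?D = "{c \<in> C. ?a c \<in> t}"
    have t: "t = ?a ` ?D" using cell.prems(1) subset_image_conv by blast
    have cD: "c \<in> ?D" using c' eq cell.prems(2) by auto
    moreover have "cchain n' ?D" by (rule cchain_subset[OF cell.hyps(6)]) (use cD in auto)
    moreover have "cell_ok K n' k' f' g'"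
      unfolding cell_ok_def
    proof (intro conjI ballI allI impI)
      show "f' d \<in> verts (cell_cpx K)" if d: "d \<in> sd2_horn n' k'" for d
      proof -
        have "cchain n' {d}" using d by (auto simp: cchain_def sd2_horn_def chain_def)
        then have "f' ` {d} \<in> cell_cpx K" using cell.IH d by blast
        then show ?thesis by (auto simp: verts_def)
      qed
      show "?a ` C \<in> cell_cpx K" if "cchain n' C" for C
        by (rule cell_cpx.cell[OF cell.hyps(1,2) _ cell.hyps(3-5) that]) (use cell.IH in blast)
    qed (use cell.hyps in auto)
    ultimately show ?thesis using t c'N eq by blast
  next
    case False
    let ?D = "{c \<in> C. ?a c \<in> t}"
    have t: "t = ?a ` ?D" using cell.prems(1) subset_image_conv by blast
    have D: "?D \<subseteq> sd2_horn n' k'" using False by (auto simp: att_def split: if_splits)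
    have "?D \<noteq> {}" using t cell.prems(2) by blast
    then have D': "cchain n' ?D" by (intro cchain_subset[OF cell.hyps(6)]) auto
    have fD: "t = f' ` ?D" using t D by (force simp: att_def)
    show ?thesis
      using cell.IH[rule_format, OF conjI[OF D' D]] cell.prems(2,3) unfolding fD[symmetric] by blast
  qed
qed

lemma cell_cpx_level0:
  assumes "s \<in> cell_cpx K" "t \<subseteq> s" "t \<noteq> {}" "\<And>v. v \<in> t \<Longrightarrow> level v = 0"
  shows "t \<in> (`) (\<lambda>p. Base (fst p) (snd p)) ` blow K"
  using assms
proof (induction arbitrary: t)
  case (base s)
  then obtain t' where t': "t' \<subseteq> s" "t = (\<lambda>p. Base (fst p) (snd p)) ` t'"
    unfolding subset_image_iff by blast
  then have "t' \<in> blow K" using complex_subset[OF complex_blow base(1)] base.prems(2) by auto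
  then show ?case using t' by blast
next
  case (cell n' k' f' g' C)
  let ?a = "att n' k' f' g'"
  let ?D = "{c \<in> C. ?a c \<in> t}"
  have t: "t = ?a ` ?D" using cell.prems(1) subset_image_conv by blast
  have D: "?D \<subseteq> sd2_horn n' k'"
  proof
    fix d assume "d \<in> ?D"
    then have "level (?a d) = 0" using cell.prems(3) by blast
    then show "d \<in> sd2_horn n' k'" by (auto simp: att_def split: if_splits)
  qed
  have "?D \<noteq> {}" using t cell.prems(2) by blast
  then have D': "cchain n' ?D" by (intro cchain_subset[OF cell.hyps(6)]) auto
  have fD: "t = f' ` ?D" using t D by (force simp: att_def)
  show ?case
    using cell.IH[rule_format, OF conjI[OF D' D]] cell.prems(2,3) unfolding fD[symmetric] by blast
qed

text \<open>Values of \<open>\<phi>\<close> in the horn are read through the attaching map, which is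
  how vertices reach lower levels.\<close>

definition on_cells :: "nat \<Rightarrow> (nat \<Rightarrow> nat \<Rightarrow> nat set set \<Rightarrow> nat set set) \<Rightarrow> 'a vtx \<Rightarrow> 'a vtx" where
  "on_cells M \<phi> v = (if level v = M then case v of Base a b \<Rightarrow> v | Cell n k f g c \<Rightarrow> att n k f g (\<phi> n k c) else v)"

text \<open>Orders the moves: in one simplex of a cell the chains \<open>c\<close> are nested, so
  cardinality distinguishes them and agrees with inclusion.\<close>

definition cell_size :: "nat \<Rightarrow> 'a vtx \<Rightarrow> nat" where
  "cell_size M v = (if level v = M then case v of Base a b \<Rightarrow> 0 | Cell n k f g c \<Rightarrow> card c else 0)"

definition cell_mix :: "(nat set set \<Rightarrow> nat set set) \<Rightarrow> (nat set set \<Rightarrow> nat set set) \<Rightarrow>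
    nat \<Rightarrow> nat \<Rightarrow> nat set set set \<Rightarrow> nat \<Rightarrow> nat set set set" where
  "cell_mix \<phi>0 \<phi>1 n k C j = C \<inter> sd2_horn n k \<union> \<phi>1 ` {c \<in> C - sd2_horn n k. card c \<le> j} \<union>
     \<phi>0 ` {c \<in> C - sd2_horn n k. j \<le> card c}"

text \<open>By \<open>cell_cpx_top\<close> a simplex with a vertex of the top level \<open>M\<close>
  lies in one cell, where it is a chain \<open>C\<close>. The condition on \<open>mixed\<close> then
  says that the set \<open>cell_mix\<close> made from \<open>C\<close> is again a chain. Horn
  vertices have lower level and do not move.\<close>

lemma mixed_cell_cpx:
  assumes s: "s \<in> cell_cpx K" and le: "\<And>v. v \<in> s \<Longrightarrow> level v \<le> M" and M: "0 < M"
    and \<phi>: "\<And>n k f g C. 1 \<le> n \<Longrightarrow> n < M \<Longrightarrow> k \<le> n \<Longrightarrow> cchain n C \<Longrightarrow> s = att n k f g ` C \<Longrightarrow>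
        (\<And>c. level (Cell n k f g c) = M) \<Longrightarrow> cchain n (cell_mix (\<phi>0 n k) (\<phi>1 n k) n k C j)"
  shows "mixed (on_cells M \<phi>0) (on_cells M \<phi>1) (cell_size M) s j \<in> cell_cpx K"
proof (cases "\<exists>v\<in>s. level v = M")
  case False
  then have "on_cells M \<phi> v = v" "cell_size M v = 0" if "v \<in> s" for v \<phi>
    using that by (auto simp: on_cells_def cell_size_def)
  then have "mixed (on_cells M \<phi>0) (on_cells M \<phi>1) (cell_size M) s j = s"
    unfolding mixed_def by force
  then show ?thesis using s by simp
next
  case True
  then obtain v where v: "v \<in> s" "level v = M" by blast
  then obtain n k f g c where vc: "v = Cell n k f g c" using M by (cases v) auto
  let ?a = "att n k f g"
  obtain C where ok: "cell_ok K n k f g" and C: "cchain n C" "s = ?a ` C"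
    using cell_cpx_top[OF s order_refl, of n k f g c] v le vc by auto
  have rM: "level (Cell n k f g c) = M" for c using v vc level_cell_cong by metis
  have nM: "n < M" using level_cell(1)[of n k f g c] rM by simp
  have low: "on_cells M \<phi> (?a d) = ?a d" "cell_size M (?a d) = 0" if "d \<in> sd2_horn n k" for d \<phi>
    using that level_cell(2)[OF that, of f g c] rM by (auto simp: on_cells_def cell_size_def att_def)
  have high: "on_cells M \<phi> (?a d) = ?a (\<phi> n k d)" "cell_size M (?a d) = card d" if "d \<notin> sd2_horn n k" for d \<phi>
    using that rM[of d] by (auto simp: on_cells_def cell_size_def att_def simp del: level.simps)
  have "mixed (on_cells M \<phi>0) (on_cells M \<phi>1) (cell_size M) s j = ?a ` cell_mix (\<phi>0 n k) (\<phi>1 n k) n k C j"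
    (is "?l = ?r")
  proof (intro equalityI subsetI)
    fix w assume "w \<in> ?l"
    then obtain d where d: "d \<in> C" "w = on_cells M \<phi>1 (?a d) \<and> cell_size M (?a d) \<le> j \<or>
        w = on_cells M \<phi>0 (?a d) \<and> j \<le> cell_size M (?a d)"
      unfolding mixed_def C(2) by blast
    then show "w \<in> ?r"
      using low[of d] high[of d] unfolding cell_mix_def by (cases "d \<in> sd2_horn n k") auto
  next
    fix w assume "w \<in> ?r"
    then consider d where "d \<in> C" "d \<in> sd2_horn n k" "w = ?a d"
      | d where "d \<in> C" "d \<notin> sd2_horn n k" "card d \<le> j" "w = ?a (\<phi>1 n k d)"
      | d where "d \<in> C" "d \<notin> sd2_horn n k" "j \<le> card d" "w = ?a (\<phi>0 n k d)"
      unfolding cell_mix_def by blast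
    then show "w \<in> ?l"
    proof cases
      case 1
      then have "w = on_cells M \<phi>1 (?a d)" "cell_size M (?a d) \<le> j" using low[of d] by auto
      then show ?thesis using 1 unfolding mixed_def C(2) by blast
    next
      case 2
      then have "w = on_cells M \<phi>1 (?a d)" "cell_size M (?a d) \<le> j" using high[of d] by auto
      then show ?thesis using 2 unfolding mixed_def C(2) by blast
    next
      case 3
      then have "w = on_cells M \<phi>0 (?a d)" "j \<le> cell_size M (?a d)" using high[of d] by auto
      then show ?thesis using 3 unfolding mixed_def C(2) by blast
    qed
  qed
  moreover have "cchain n (cell_mix (\<phi>0 n k) (\<phi>1 n k) n k C j)"
    using ok by (intro \<phi>[OF _ nM _ C rM]) (auto simp: cell_ok_def)
  ultimately show ?thesis using ok by (auto simp: cell_ok_def)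
qed

section \<open>Clique complexes and what they share with the cell complex\<close>

lemma complex_Cl_skel1:
  assumes "complex X"
  shows "complex (Cl (skel1 X))"
  unfolding complex_def
proof (intro conjI ballI allI impI)
  fix s t assume "s \<in> Cl (skel1 X)" "t \<subseteq> s \<and> t \<noteq> {}"
  then show "t \<in> Cl (skel1 X)" using finite_subset[of t s] unfolding Cl_def by blast
qed (auto simp: Cl_def)

lemma in_Cl_skel1:
  assumes X: "complex X"
  shows "s \<in> Cl (skel1 X) \<longleftrightarrow> finite s \<and> s \<noteq> {} \<and> (\<forall>u\<in>s. \<forall>v\<in>s. {u, v} \<in> X)"
proof
  assume "finite s \<and> s \<noteq> {} \<and> (\<forall>u\<in>s. \<forall>v\<in>s. {u, v} \<in> X)"
  moreover from this have "{u, v} \<in> skel1 X" if "u \<in> s" "v \<in> s" for u v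
    using that by (auto simp: skel1_def card_insert_if)
  ultimately show "s \<in> Cl (skel1 X)" unfolding Cl_def verts_def by blast
qed (auto simp: Cl_def skel1_def)

lemma subset_Cl_skel1:
  assumes "complex X"
  shows "X \<subseteq> Cl (skel1 X)"
proof
  fix s assume s: "s \<in> X"
  have "{u, v} \<in> X" if "u \<in> s" "v \<in> s" for u v
    using complex_subset[OF assms s, of "{u, v}"] that by simp
  then show "s \<in> Cl (skel1 X)"
    unfolding in_Cl_skel1[OF assms] using complex_finite[OF assms s] complex_nonempty[OF assms s] by blast
qed

text \<open>What is used about \<open>cell_cpx K\<close> and its clique complex alike.  The second assumption
  holds for clique complexes because a pair from \<open>mixed h0 h1 \<sigma> s j\<close> lies in
  \<open>mixed h0 h1 \<sigma> {u, v} j\<close> for an edge \<open>{u, v}\<close> of \<open>s\<close>.\<close>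

definition cell_like :: "'a set set \<Rightarrow> 'a vtx set set \<Rightarrow> bool" where
  "cell_like K X \<longleftrightarrow> complex X \<and> cell_cpx K \<subseteq> X \<and>
     (\<forall>(h0 :: 'a vtx \<Rightarrow> 'a vtx) h1 \<sigma> V.
        (\<forall>s\<in>full (cell_cpx K) V. \<forall>j. mixed h0 h1 \<sigma> s j \<in> cell_cpx K) \<longrightarrow>
        (\<forall>s\<in>full X V. \<forall>j. mixed h0 h1 \<sigma> s j \<in> X)) \<and>
     (\<forall>s\<in>X. \<forall>u\<in>s. \<forall>v\<in>s. {u, v} \<in> cell_cpx K) \<and>
     full X {v. level v \<le> 0} = (`) (\<lambda>p. Base (fst p) (snd p)) ` blow K"

lemma cell_cpx_level0_full:
  "full (cell_cpx K) {v. level v \<le> 0} = (`) (\<lambda>p. Base (fst p) (snd p)) ` blow K"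
proof (intro equalityI subsetI)
  fix s assume s: "s \<in> full (cell_cpx K) {v. level v \<le> 0}"
  then show "s \<in> (`) (\<lambda>p. Base (fst p) (snd p)) ` blow K"
    using complex_nonempty[OF complex_cell_cpx, of s K] by (intro cell_cpx_level0[of s]) auto
qed (auto intro: cell_cpx.base)

lemma cell_like_cell_cpx: "cell_like K (cell_cpx K)"
proof -
  have "{u, v} \<in> cell_cpx K" if "s \<in> cell_cpx K" "u \<in> s" "v \<in> s" for s u v
    using complex_subset[OF complex_cell_cpx that(1), of "{u, v}"] that by simp
  then show ?thesis
    unfolding cell_like_def by (intro conjI complex_cell_cpx cell_cpx_level0_full) auto
qed

lemma cell_like_Cl: "cell_like K (Cl (skel1 (cell_cpx K)))"
  unfolding cell_like_def
proof (intro conjI allI impI ballI)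
  let ?Q = "cell_cpx K" and ?b = "\<lambda>p. Base (fst p) (snd p)"
  note Q = complex_cell_cpx[of K]
  show "complex (Cl (skel1 ?Q))" by (rule complex_Cl_skel1[OF Q])
  show "?Q \<subseteq> Cl (skel1 ?Q)" by (rule subset_Cl_skel1[OF Q])
  show "{u, v} \<in> ?Q" if "s \<in> Cl (skel1 ?Q)" "u \<in> s" "v \<in> s" for s u v
    using that in_Cl_skel1[OF Q] by blast
  fix h0 h1 :: "'a vtx \<Rightarrow> 'a vtx" and \<sigma> V s j
  assume oc: "\<forall>s\<in>full ?Q V. \<forall>j. mixed h0 h1 \<sigma> s j \<in> ?Q" and s: "s \<in> full (Cl (skel1 ?Q)) V"
  have s': "finite s" "s \<noteq> {}" "\<And>u v. u \<in> s \<Longrightarrow> v \<in> s \<Longrightarrow> {u, v} \<in> ?Q" "s \<subseteq> V"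
    using s in_Cl_skel1[OF Q] by auto
  have "finite (mixed h0 h1 \<sigma> s j)" using s'(1) by (simp add: mixed_def)
  moreover have "mixed h0 h1 \<sigma> s j \<noteq> {}"
  proof -
    obtain v where "v \<in> s" using s'(2) by blast
    then show ?thesis using linear[of "\<sigma> v" j] by (auto simp: mixed_def)
  qed
  moreover have "{a, b} \<in> ?Q" if a: "a \<in> mixed h0 h1 \<sigma> s j" and b: "b \<in> mixed h0 h1 \<sigma> s j" for a b
  proof -
    obtain u where u: "u \<in> s" "a \<in> mixed h0 h1 \<sigma> {u} j" using a unfolding mixed_def by blast
    obtain v where v: "v \<in> s" "b \<in> mixed h0 h1 \<sigma> {v} j" using b unfolding mixed_def by blast
    have "mixed h0 h1 \<sigma> {u, v} j \<in> ?Q" using oc s'(3)[OF u(1) v(1)] u v s'(4) by auto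
    moreover have "{a, b} \<subseteq> mixed h0 h1 \<sigma> {u, v} j" using u(2) v(2) unfolding mixed_def by blast
    ultimately show ?thesis using complex_subset[OF Q] by blast
  qed
  ultimately show "mixed h0 h1 \<sigma> s j \<in> Cl (skel1 ?Q)" using in_Cl_skel1[OF Q] by blast
next
  let ?Q = "cell_cpx K" and ?b = "\<lambda>p. Base (fst p) (snd p)"
  note Q = complex_cell_cpx[of K]
  show "full (Cl (skel1 ?Q)) {v. level v \<le> 0} = (`) ?b ` blow K"
  proof (intro equalityI subsetI)
    fix s assume "s \<in> full (Cl (skel1 ?Q)) {v. level v \<le> 0}"
    then have "s \<in> Cl (skel1 ?Q)" and s0: "\<And>v. v \<in> s \<Longrightarrow> level v = 0" by auto
    then have s: "finite s" "s \<noteq> {}" "\<And>u v. u \<in> s \<Longrightarrow> v \<in> s \<Longrightarrow> {u, v} \<in> ?Q"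
      unfolding in_Cl_skel1[OF Q] by blast+
    define t where "t = {p. ?b p \<in> s}"
    have "v \<in> ?b ` t" if "v \<in> s" for v
      using s0[OF that] that by (cases v) (auto simp: t_def image_iff)
    then have st: "s = ?b ` t" by (auto simp: t_def)
    have inj: "inj ?b" by (auto simp: inj_def prod_eq_iff)
    \<comment> \<open>On level 0 the cliques are those of the blow-up, which is flag, once the
      injective renaming by \<open>Base\<close> is undone on edges.\<close>
    have edge: "{p, q} \<in> blow K" if "p \<in> t" "q \<in> t" for p q
    proof -
      have "{?b p, ?b q} \<in> ?Q" using that s(3) by (simp add: t_def)
      then have "{?b p, ?b q} \<in> (`) ?b ` blow K"
        by (rule cell_cpx_level0) auto
      then obtain e where "e \<in> blow K" and e: "{?b p, ?b q} = ?b ` e" by blast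
      have "?b ` e = ?b ` {p, q}" unfolding e[symmetric] by (simp only: image_insert image_empty)
      then have "e = {p, q}" by (rule iffD1[OF inj_image_eq_iff[OF inj]])
      then show ?thesis using \<open>e \<in> blow K\<close> by simp
    qed
    have "finite t" using s(1) inj unfolding st by (metis finite_imageD inj_on_subset subset_UNIV)
    moreover have "t \<noteq> {}" using s(2) st by auto
    ultimately have "t \<in> Cl (skel1 (blow K))" using edge in_Cl_skel1[OF complex_blow] by blast
    then have "t \<in> blow K" using Cl_skel1_blow by blast
    then show "s \<in> (`) ?b ` blow K" using st by blast
  next
    fix s assume "s \<in> (`) ?b ` blow K"
    then have "s \<in> full ?Q {v. level v \<le> 0}" unfolding cell_cpx_level0_full .
    then show "s \<in> full (Cl (skel1 ?Q)) {v. level v \<le> 0}" using subset_Cl_skel1[OF Q] by blast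
  qed
qed

section \<open>Retraction of cell complexes\<close>

text \<open>Vertices of a cell outside the horn are of two kinds: chains that meet the horn, the
  rim, and chains disjoint from it, the core. A chain comparable to one inside the horn must meet
  the horn, so the core is not adjacent to the horn.\<close>

definition is_core :: "'a vtx \<Rightarrow> bool" where
  "is_core v = (case v of Base a b \<Rightarrow> False | Cell n k f g c \<Rightarrow> c \<inter> horn_face n k = {})"

lemma cell_likeD:
  assumes "cell_like K X"
  shows "complex X" "\<And>s u v. s \<in> X \<Longrightarrow> u \<in> s \<Longrightarrow> v \<in> s \<Longrightarrow> {u, v} \<in> cell_cpx K"
    "full X {v. level v \<le> 0} = (`) (\<lambda>p. Base (fst p) (snd p)) ` blow K"
proof -
  note a = assms[unfolded cell_like_def]
  show "complex X" by (rule conjunct1[OF a])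
  show "full X {v. level v \<le> 0} = (`) (\<lambda>p. Base (fst p) (snd p)) ` blow K"
    by (rule a[THEN conjunct2, THEN conjunct2, THEN conjunct2, THEN conjunct2])
  have "\<forall>s\<in>X. \<forall>u\<in>s. \<forall>v\<in>s. {u, v} \<in> cell_cpx K"
    using assms unfolding cell_like_def by (elim conjE)
  then show "\<And>s u v. s \<in> X \<Longrightarrow> u \<in> s \<Longrightarrow> v \<in> s \<Longrightarrow> {u, v} \<in> cell_cpx K" by blast
qed

lemma sd2_horn_iff: "c \<in> sd2_verts n \<Longrightarrow> c \<in> sd2_horn n k \<longleftrightarrow> c \<subseteq> horn_face n k"
  by (simp add: sd2_horn_def)

lemma cell_like_vertex:
  assumes X: "cell_like K X" and s: "s \<in> X" "v \<in> s" and lv: "0 < level v"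
  obtains n k f g c where "v = Cell n k f g c" "cell_ok K n k f g" "1 \<le> n" "n < level v" "k \<le> n"
    "c \<in> sd2_verts n" "\<not> c \<subseteq> horn_face n k" "c \<notin> sd2_horn n k"
proof -
  obtain n k f g c where vc: "v = Cell n k f g c" using lv by (cases v) auto
  \<comment> \<open>A single vertex is treated as a degenerate edge, since edges of \<open>X\<close>
    are known to lie in \<open>cell_cpx K\<close>.\<close>
  have "{v, v} \<in> cell_cpx K" by (rule cell_likeD(2)[OF X s(1,2,2)])
  then have "{v} \<in> cell_cpx K" by simp
  from cell_cpx_top[OF this order_refl, of n k f g c]
  obtain C where C: "cell_ok K n k f g" "c \<notin> sd2_horn n k" "cchain n C" "c \<in> C"
    by (auto simp: vc)
  then have c: "c \<in> sd2_verts n" by (auto simp: cchain_def)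
  then show thesis
    using C level_cell(1)[of n k f g c] vc by (intro that[of n k f g c]) (auto simp: cell_ok_def sd2_horn_iff)
qed

lemma sd2_verts_inter:
  assumes "c \<in> sd2_verts n" "c \<inter> H \<noteq> {}"
  shows "c \<inter> H \<in> sd2_verts n"
  using assms sd2_vertsD[OF assms(1)] chain_subset[of c "c \<inter> H"] by (intro sd2_vertsI) auto

lemma mixed_cong:
  assumes "\<And>v. v \<in> s \<Longrightarrow> h0 v = h0' v" "\<And>v. v \<in> s \<Longrightarrow> h1 v = h1' v"
  shows "mixed h0 h1 \<sigma> s j = mixed h0' h1' \<sigma> s j"
  using assms by (auto simp: mixed_def)

text \<open>Each vertex deformation below is checked on \<open>cell_cpx K\<close> and transferred to
  the clique complex by this.\<close>

lemma cell_like_mixed: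
  assumes X: "cell_like K X" and s: "s \<in> full X V"
    and oc: "\<And>s j. s \<in> full (cell_cpx K) V \<Longrightarrow> mixed h0 h1 \<sigma> s j \<in> cell_cpx K"
  shows "mixed h0 h1 \<sigma> s j \<in> X"
proof -
  note XV = X[unfolded cell_like_def, THEN conjunct2, THEN conjunct2, THEN conjunct1,
      THEN spec[of _ h0], THEN spec[of _ h1], THEN spec[of _ \<sigma>], THEN spec[of _ V]]
  have "\<forall>s\<in>full (cell_cpx K) V. \<forall>j. mixed h0 h1 \<sigma> s j \<in> cell_cpx K" using oc by blast
  then have "\<forall>s\<in>full X V. \<forall>j. mixed h0 h1 \<sigma> s j \<in> X" by (rule mp[OF XV])
  then show ?thesis using s by (elim ballE allE) auto
qed

text \<open>A vertex \<open>c\<close> of a cell meeting the horn is dominated by its part in the horn once the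
  smaller such \<open>c\<close> have been removed.\<close>

lemma sdr_rim:
  assumes X: "cell_like K X"
  shows "sdr (full X {v. level v \<le> m}) (full X {v. level v \<le> Suc m \<and> \<not> (level v = Suc m \<and> is_core v)})"
proof -
  let ?M = "Suc m"
  let ?V = "{v. level v \<le> ?M \<and> \<not> (level v = ?M \<and> is_core v)}"
  let ?Y = "full X ?V" and ?D = "{v. level v = ?M}"
  let ?\<phi> = "\<lambda>n k c. c \<inter> horn_face n k"
  let ?h = "\<lambda>v. if v \<in> ?D then on_cells ?M ?\<phi> v else v"
  have cX: "complex X" by (rule cell_likeD(1)[OF X])
  have Q: "cell_like K (cell_cpx K)" by (rule cell_like_cell_cpx)
  \<comment> \<open>A rim vertex moves to its part in the horn, which the attaching map sends to a
    lower level.\<close>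
  have down: "level (?h v) \<le> m" if s: "s \<in> ?Y" "v \<in> s" and lv: "level v = ?M" for s v
  proof -
    have sX: "s \<in> X" using s by blast
    have lv0: "0 < level v" using lv by simp
    obtain n k f g c where v: "v = Cell n k f g c" "cell_ok K n k f g"
      "c \<in> sd2_verts n" "c \<notin> sd2_horn n k"
      using cell_like_vertex[OF X sX s(2) lv0] by metis
    have "\<not> is_core v" using s lv by blast
    then have "c \<inter> horn_face n k \<noteq> {}" by (simp add: is_core_def v(1))
    then have h: "c \<inter> horn_face n k \<in> sd2_horn n k"
      using sd2_verts_inter[OF v(3)] by (simp add: sd2_horn_def)
    then have "?h v = f (c \<inter> horn_face n k)"
      using lv by (simp add: on_cells_def v(1) att_def del: level.simps)
    then show ?thesis using level_cell(2)[OF h, of f g c] lv unfolding v(1) by simp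
  qed
  have "sdr (full ?Y (- ?D)) ?Y"
  proof (rule sdr_ordered[where \<sigma> = "cell_size ?M"])
    show "complex ?Y" by (rule complex_full[OF cX])
    show "on_cells ?M ?\<phi> v \<notin> ?D" if "s \<in> ?Y" "v \<in> s" "v \<in> ?D" for s v
      using down[OF that(1,2)] that(3) by auto
    fix s j assume s: "s \<in> ?Y"
    have "mixed id ?h (cell_size ?M) s j \<in> X"
    proof (rule cell_like_mixed[OF X s])
      fix s j assume s: "s \<in> full (cell_cpx K) ?V"
      have eq: "mixed id ?h (cell_size ?M) s j =
          mixed (on_cells ?M (\<lambda>n k c. c)) (on_cells ?M ?\<phi>) (cell_size ?M) s j"
      proof (rule mixed_cong)
        fix v assume v: "v \<in> s"
        show "?h v = on_cells ?M ?\<phi> v" by (simp add: on_cells_def)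
        show "id v = on_cells ?M (\<lambda>n k c. c) v"
        proof (cases "level v = ?M")
          case True
          have sQ: "s \<in> cell_cpx K" using s by blast
          have lv0: "0 < level v" using True by simp
          obtain n k f g c where "v = Cell n k f g c" "c \<notin> sd2_horn n k"
            using cell_like_vertex[OF Q sQ v lv0] by metis
          then show ?thesis by (simp add: on_cells_def att_def)
        qed (simp add: on_cells_def)
      qed
      show "mixed id ?h (cell_size ?M) s j \<in> cell_cpx K"
        unfolding eq
      proof (rule mixed_cell_cpx)
        show "s \<in> cell_cpx K" "\<And>v. v \<in> s \<Longrightarrow> level v \<le> ?M" "0 < ?M" using s by auto
        fix n k f g C
        assume n: "1 \<le> n" "n < ?M" "k \<le> n" and C: "cchain n C" "s = att n k f g ` C"
          and lv: "\<And>c. level (Cell n k f g c) = ?M"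
        let ?H = "horn_face n k"
        let ?E = "cell_mix (\<lambda>c. c) (\<lambda>c. c \<inter> ?H) n k C j"
        have Cs: "C \<subseteq> sd2_verts n" "chain C" "C \<noteq> {}" using C by (auto simp: cchain_def)
        have meet: "c \<inter> ?H \<noteq> {}" if "c \<in> C" for c
        proof (cases "c \<in> sd2_horn n k")
          case True
          then show ?thesis using sd2_vertsD(1)[of c n] by (auto simp: sd2_horn_def)
        next
          case False
          then have "Cell n k f g c \<in> s" using C(2) that by (force simp: att_def)
          then have "\<not> is_core (Cell n k f g c)" using s lv by blast
          then show ?thesis by (simp add: is_core_def)
        qed
        have "?E \<noteq> {}"
        proof -
          obtain c where "c \<in> C" using Cs(3) by blast
          then show ?thesis using linear[of "card c" j] unfolding cell_mix_def by blast
        qed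
        moreover have "?E \<subseteq> sd2_verts n"
          using Cs(1) sd2_verts_inter[of _ n ?H] meet unfolding cell_mix_def by blast
        moreover have "chain ?E"
        proof -
          have ab: "a \<subseteq> b \<or> b \<subseteq> a" if "a \<in> C" "b \<in> C" for a b using Cs(2) that unfolding chain_def by blast
          \<comment> \<open>In a chain cardinality decides inclusion, so the moved chains of size at
            most \<open>j\<close> come from below the unmoved ones of size at least
            \<open>j\<close>.\<close>
          have le: "a \<subseteq> b" if "a \<in> C" "b \<in> C" "card a \<le> card b" for a b
            using ab[OF that(1,2)] that(3) sd2_vertsD(2)[of a n] Cs(1) that(1)
            by (metis card_subset_eq card_mono le_antisym order_refl subsetD)
          \<comment> \<open>A chain outside the horn is not contained in one inside it, so
            comparability leaves only the other inclusion.\<close>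
          have horn: "d \<subseteq> c \<inter> ?H" if "d \<in> C" "d \<in> sd2_horn n k" "c \<in> C" "c \<notin> sd2_horn n k" for c d
            using ab[OF that(1,3)] that Cs(1) by (auto simp: sd2_horn_def)
          have "a \<subseteq> b \<or> b \<subseteq> a" if "a \<in> ?E" "b \<in> ?E" for a b
          proof -
            have cases: "(a \<in> C \<and> a \<in> sd2_horn n k) \<or> (\<exists>c\<in>C. c \<notin> sd2_horn n k \<and> card c \<le> j \<and> a = c \<inter> ?H)
                \<or> (a \<in> C \<and> a \<notin> sd2_horn n k \<and> j \<le> card a)" if "a \<in> ?E" for a
              using that unfolding cell_mix_def by blast
            show ?thesis
              using cases[OF that(1)] cases[OF that(2)]
            proof (elim disjE bexE conjE)
              fix c d assume "c \<in> C" "a = c \<inter> ?H" "d \<in> C" "b = d \<inter> ?H"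
              then show ?thesis using ab[of c d] by blast
            next
              fix c assume "c \<in> C" "card c \<le> j" "a = c \<inter> ?H" "b \<in> C" "j \<le> card b"
              then show ?thesis using le[of c b] by auto
            next
              fix c assume "c \<in> C" "card c \<le> j" "b = c \<inter> ?H" "a \<in> C" "j \<le> card a"
              then show ?thesis using le[of c a] by auto
            qed (use ab horn in blast)+
          qed
          then show ?thesis unfolding chain_def by blast
        qed
        ultimately show "cchain n ?E" by (simp add: cchain_def)
      qed
    qed
    moreover have "mixed id ?h (cell_size ?M) s j \<subseteq> ?V"
    proof
      fix w assume "w \<in> mixed id ?h (cell_size ?M) s j"
      then consider "w \<in> s" | v where "v \<in> s" "level v = ?M" "w = ?h v"
        unfolding mixed_def by (auto split: if_splits)
      then show "w \<in> ?V"
      proof cases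
        case 1
        then show ?thesis using s by blast
      next
        case 2
        then show ?thesis using down[OF s 2(1,2)] by auto
      qed
    qed
    ultimately show "mixed id ?h (cell_size ?M) s j \<in> ?Y" by blast
  qed
  moreover have "full ?Y (- ?D) = full X {v. level v \<le> m}"
    by (auto simp: subset_iff) (metis le_SucI le_SucE)+
  ultimately show ?thesis by simp
qed

section \<open>Poset maps acting on the cells of one level\<close>

text \<open>Monotone maps on the chains outside the horn that respect the pair of a cell and its
  rim. The range \<open>n < M\<close> suffices because a cell of level \<open>M\<close> has smaller
  dimension.\<close>

definition cell_shape :: "nat \<Rightarrow> (nat \<Rightarrow> nat \<Rightarrow> nat set set \<Rightarrow> nat set set) \<Rightarrow> bool" where
  "cell_shape M \<phi> \<longleftrightarrow> (\<forall>n k c. 1 \<le> n \<and> n < M \<and> k \<le> n \<and> c \<in> sd2_verts n \<and> \<not> c \<subseteq> horn_face n k \<longrightarrow>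
     \<phi> n k c \<in> sd2_verts n \<and> \<not> \<phi> n k c \<subseteq> horn_face n k \<and>
     (c \<inter> horn_face n k \<noteq> {} \<longrightarrow> \<phi> n k c \<inter> horn_face n k \<noteq> {}) \<and>
     (\<forall>c'\<in>sd2_verts n. c \<subseteq> c' \<longrightarrow> \<phi> n k c \<subseteq> \<phi> n k c'))"

definition cell_below :: "nat \<Rightarrow> (nat \<Rightarrow> nat \<Rightarrow> nat set set \<Rightarrow> nat set set) \<Rightarrow>
    (nat \<Rightarrow> nat \<Rightarrow> nat set set \<Rightarrow> nat set set) \<Rightarrow> bool" where
  "cell_below M \<phi> \<psi> \<longleftrightarrow> (\<forall>n k c. 1 \<le> n \<and> n < M \<and> k \<le> n \<and> c \<in> sd2_verts n \<and> \<not> c \<subseteq> horn_face n k \<longrightarrow>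
     \<phi> n k c \<subseteq> \<psi> n k c)"

lemma cell_shapeD:
  assumes "cell_shape M \<phi>" "1 \<le> n" "n < M" "k \<le> n" "c \<in> sd2_verts n" "\<not> c \<subseteq> horn_face n k"
  shows "\<phi> n k c \<in> sd2_verts n" "\<not> \<phi> n k c \<subseteq> horn_face n k"
    "c \<inter> horn_face n k \<noteq> {} \<Longrightarrow> \<phi> n k c \<inter> horn_face n k \<noteq> {}"
    "\<And>c'. c' \<in> sd2_verts n \<Longrightarrow> c \<subseteq> c' \<Longrightarrow> \<phi> n k c \<subseteq> \<phi> n k c'"
proof -
  note a = mp[OF assms(1)[unfolded cell_shape_def, THEN spec[of _ n], THEN spec[of _ k], THEN spec[of _ c]]]
  have "1 \<le> n \<and> n < M \<and> k \<le> n \<and> c \<in> sd2_verts n \<and> \<not> c \<subseteq> horn_face n k" using assms by simp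
  note b = a[OF this]
  show "\<phi> n k c \<in> sd2_verts n" by (rule conjunct1[OF b])
  show "\<not> \<phi> n k c \<subseteq> horn_face n k" by (rule conjunct1[OF conjunct2[OF b]])
  show "\<phi> n k c \<inter> horn_face n k \<noteq> {}" if "c \<inter> horn_face n k \<noteq> {}" using b that by (elim conjE) (erule mp)
  have "\<forall>c'\<in>sd2_verts n. c \<subseteq> c' \<longrightarrow> \<phi> n k c \<subseteq> \<phi> n k c'" using b by (elim conjE)
  then show "\<phi> n k c \<subseteq> \<phi> n k c'" if "c' \<in> sd2_verts n" "c \<subseteq> c'" for c' using that by simp
qed

lemma cell_belowD:
  assumes "cell_below M \<phi> \<psi>" "1 \<le> n" "n < M" "k \<le> n" "c \<in> sd2_verts n" "\<not> c \<subseteq> horn_face n k"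
  shows "\<phi> n k c \<subseteq> \<psi> n k c"
  using assms unfolding cell_below_def by simp

abbreviation new_part :: "'a vtx set set \<Rightarrow> nat \<Rightarrow> 'a vtx set set" where
  "new_part X M \<equiv> full X {v. level v = M}"

abbreviation rim_part :: "'a vtx set set \<Rightarrow> nat \<Rightarrow> 'a vtx set set" where
  "rim_part X M \<equiv> full X {v. level v = M \<and> \<not> is_core v}"

abbreviation preserves :: "'v set set \<Rightarrow> (('v \<Rightarrow> real) \<Rightarrow> 'v \<Rightarrow> real) \<Rightarrow> bool" where
  "preserves A k \<equiv> k ` topspace (geo A) \<subseteq> topspace (geo A)"

lemma on_cells_shape:
  assumes X: "cell_like K X" and M: "0 < M" and \<phi>: "cell_shape M \<phi>"
    and s: "s \<in> X" "v \<in> s" "level v = M"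
  shows "level (on_cells M \<phi> v) = M \<and> (\<not> is_core v \<longrightarrow> \<not> is_core (on_cells M \<phi> v))"
proof -
  have lv: "0 < level v" using s M by simp
  obtain n k f g c where v: "v = Cell n k f g c" "1 \<le> n" "n < level v" "k \<le> n"
    "c \<in> sd2_verts n" "\<not> c \<subseteq> horn_face n k"
    using cell_like_vertex[OF X s(1,2) lv] by metis
  have \<phi>c: "\<phi> n k c \<in> sd2_verts n" "\<not> \<phi> n k c \<subseteq> horn_face n k"
    "c \<inter> horn_face n k \<noteq> {} \<Longrightarrow> \<phi> n k c \<inter> horn_face n k \<noteq> {}"
    using cell_shapeD(1-3)[OF \<phi> v(2) _ v(4-6)] v(3) s(3) by auto
  have "on_cells M \<phi> v = Cell n k f g (\<phi> n k c)"
    using s(3) \<phi>c by (simp add: on_cells_def v(1) att_def sd2_horn_def del: level.simps)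
  then show ?thesis using s(3) v(1) level_cell_cong \<phi>c(3) by (auto simp: is_core_def simp del: level.simps)
qed

text \<open>The order homotopy between comparable poset maps. Starting from the larger map, the
  vertices are lowered in the order of their size; a mixed set is a chain because
  \<open>\<phi> c \<subseteq> \<phi> d \<subseteq> \<psi> d\<close> for
  \<open>c \<subseteq> d\<close>. All vertices have level \<open>M\<close>, so no horn vertex
  interferes, and carriers of rim points consist of rim vertices.\<close>

lemma homotopic_on_cells:
  assumes X: "cell_like K X" and M: "0 < M" and \<phi>: "cell_shape M \<phi>" and \<psi>: "cell_shape M \<psi>"
    and le: "cell_below M \<phi> \<psi>"
  shows "homotopic_with (preserves (rim_part X M)) (geo (new_part X M)) (geo (new_part X M))
    (gmap (on_cells M \<psi>)) (gmap (on_cells M \<phi>))"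
proof -
  let ?U = "new_part X M" and ?W = "rim_part X M" and ?m = "mixed (on_cells M \<psi>) (on_cells M \<phi>) (cell_size M)"
  have cX: "complex X" by (rule cell_likeD(1)[OF X])
  have cU: "complex ?U" and cW: "complex ?W" by (rule complex_full[OF cX])+
  have sub: "?m s j \<subseteq> on_cells M \<psi> ` s \<union> on_cells M \<phi> ` s" for s j by (auto simp: mixed_def)
  have "homotopic_with (\<lambda>k. \<forall>x\<in>topspace (geo ?U). \<exists>j. gsupp (k x) \<subseteq> ?m (gsupp x) j) (geo ?U) (geo ?U)
      (gmap (on_cells M \<psi>)) (gmap (on_cells M \<phi>))"
  proof (rule homotopic_ordered[OF cU cU])
    fix s j assume s: "s \<in> ?U"
    have "?m s j \<in> X"
    proof (rule cell_like_mixed[OF X s])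
      fix s j assume s: "s \<in> full (cell_cpx K) {v. level v = M}"
      show "?m s j \<in> cell_cpx K"
      proof (rule mixed_cell_cpx)
        show "s \<in> cell_cpx K" "\<And>v. v \<in> s \<Longrightarrow> level v \<le> M" "0 < M" using s M by auto
        fix n k f g C
        assume n: "1 \<le> n" "n < M" "k \<le> n" and C: "cchain n C" "s = att n k f g ` C"
          and lv: "\<And>c. level (Cell n k f g c) = M"
        let ?E = "cell_mix (\<psi> n k) (\<phi> n k) n k C j"
        have Cs: "C \<subseteq> sd2_verts n" "chain C" "C \<noteq> {}" using C by (auto simp: cchain_def)
        have nh: "c \<notin> sd2_horn n k" if "c \<in> C" for c
        proof
          assume h: "c \<in> sd2_horn n k"
          then have "level (att n k f g c) < M" using level_cell(2)[OF h, of f g c] lv[of c] by (simp add: att_def)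
          moreover have "level (att n k f g c) = M" using s C(2) that by blast
          ultimately show False by simp
        qed
        have nH: "\<not> c \<subseteq> horn_face n k" if "c \<in> C" for c
          using nh[OF that] that Cs(1) sd2_horn_iff[of c n k] by auto
        have \<phi>C: "\<phi> n k c \<in> sd2_verts n" "\<psi> n k c \<in> sd2_verts n" "\<phi> n k c \<subseteq> \<psi> n k c" if c: "c \<in> C" for c
        proof -
          have cs: "c \<in> sd2_verts n" using Cs(1) c by auto
          show "\<phi> n k c \<in> sd2_verts n" "\<psi> n k c \<in> sd2_verts n" "\<phi> n k c \<subseteq> \<psi> n k c"
            by (rule cell_shapeD(1)[OF \<phi> n cs nH[OF c]] cell_shapeD(1)[OF \<psi> n cs nH[OF c]] cell_belowD[OF le n cs nH[OF c]])+
        qed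
        have \<phi>mono: "\<phi> n k c \<subseteq> \<phi> n k d" "\<psi> n k c \<subseteq> \<psi> n k d" if c: "c \<in> C" "d \<in> C" "c \<subseteq> d" for c d
        proof -
          have cs: "c \<in> sd2_verts n" "d \<in> sd2_verts n" using Cs(1) c by auto
          show "\<phi> n k c \<subseteq> \<phi> n k d" "\<psi> n k c \<subseteq> \<psi> n k d"
            by (rule cell_shapeD(4)[OF \<phi> n cs(1) nH[OF c(1)] cs(2) c(3)] cell_shapeD(4)[OF \<psi> n cs(1) nH[OF c(1)] cs(2) c(3)])+
        qed
        have E: "?E = \<phi> n k ` {c \<in> C. card c \<le> j} \<union> \<psi> n k ` {c \<in> C. j \<le> card c}"
          unfolding cell_mix_def using nh by blast
        have "?E \<noteq> {}"
        proof -
          obtain c where "c \<in> C" using Cs(3) by blast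
          then show ?thesis using linear[of "card c" j] unfolding E by blast
        qed
        moreover have "?E \<subseteq> sd2_verts n" using \<phi>C unfolding E by blast
        moreover have "chain ?E"
        proof -
          have ab: "a \<subseteq> b \<or> b \<subseteq> a" if "a \<in> C" "b \<in> C" for a b using Cs(2) that unfolding chain_def by blast
          have le: "a \<subseteq> b" if "a \<in> C" "b \<in> C" "card a \<le> card b" for a b
            using ab[OF that(1,2)] that(3) sd2_vertsD(2)[of a n] Cs(1) that(1)
            by (metis card_subset_eq card_mono le_antisym order_refl subsetD)
          have mix: "\<phi> n k c \<subseteq> \<psi> n k d" if "c \<in> C" "d \<in> C" "card c \<le> j" "j \<le> card d" for c d
            using \<phi>mono(1)[OF that(1,2) le[OF that(1,2)]] \<phi>C(3)[OF that(2)] that(3,4) by auto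
          have "a \<subseteq> b \<or> b \<subseteq> a" if "a \<in> ?E" "b \<in> ?E" for a b
            using that unfolding E
          proof (elim UnE imageE)
            fix c d assume "a = \<phi> n k c" "c \<in> {c \<in> C. card c \<le> j}" "b = \<phi> n k d" "d \<in> {c \<in> C. card c \<le> j}"
            then show ?thesis using ab[of c d] \<phi>mono(1)[of c d] \<phi>mono(1)[of d c] by blast
          next
            fix c d assume "a = \<psi> n k c" "c \<in> {c \<in> C. j \<le> card c}" "b = \<psi> n k d" "d \<in> {c \<in> C. j \<le> card c}"
            then show ?thesis using ab[of c d] \<phi>mono(2)[of c d] \<phi>mono(2)[of d c] by blast
          next
            fix c d assume "a = \<phi> n k c" "c \<in> {c \<in> C. card c \<le> j}" "b = \<psi> n k d" "d \<in> {c \<in> C. j \<le> card c}"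
            then show ?thesis using mix[of c d] by blast
          next
            fix c d assume "a = \<psi> n k c" "c \<in> {c \<in> C. j \<le> card c}" "b = \<phi> n k d" "d \<in> {c \<in> C. card c \<le> j}"
            then show ?thesis using mix[of d c] by blast
          qed
          then show ?thesis unfolding chain_def by blast
        qed
        ultimately show "cchain n ?E" by (simp add: cchain_def)
      qed
    qed
    moreover have "?m s j \<subseteq> {v. level v = M}"
    proof
      fix w assume "w \<in> ?m s j"
      then obtain v where "v \<in> s" "w = on_cells M \<psi> v \<or> w = on_cells M \<phi> v" using sub by blast
      then show "w \<in> {v. level v = M}"
        using on_cells_shape[OF X M \<phi>, of s v] on_cells_shape[OF X M \<psi>, of s v] s by auto
    qed
    ultimately show "?m s j \<in> ?U" by blast
  qed blast
  then show ?thesis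
  proof (rule homotopic_with_mono)
    fix k assume ck: "continuous_map (geo ?U) (geo ?U) k"
      and k: "\<forall>x\<in>topspace (geo ?U). \<exists>j. gsupp (k x) \<subseteq> ?m (gsupp x) j"
    show "preserves ?W k"
    proof
      fix y assume "y \<in> k ` topspace (geo ?W)"
      then obtain x where x: "x \<in> topspace (geo ?W)" "y = k x" by blast
      have xU: "x \<in> topspace (geo ?U)" using x(1) topspace_geo_mono[of ?W ?U] by blast
      then have kx: "gsupp (k x) \<in> ?U" "k x \<in> gsimp (gsupp (k x))"
        using ck in_geo_iff[OF cU, of "k x"] by (auto simp: continuous_map_def)
      have gx: "gsupp x \<in> ?W" using x(1) in_geo_iff[OF cW] by blast
      obtain j where j: "gsupp (k x) \<subseteq> ?m (gsupp x) j" using k xU by blast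
      have "\<not> is_core w" if w: "w \<in> gsupp (k x)" for w
      proof -
        obtain v where "v \<in> gsupp x" "w = on_cells M \<psi> v \<or> w = on_cells M \<phi> v" using sub w j by blast
        then show ?thesis
          using on_cells_shape[OF X M \<phi>, of "gsupp x" v] on_cells_shape[OF X M \<psi>, of "gsupp x" v] gx by blast
      qed
      then have "gsupp (k x) \<in> ?W" using kx by blast
      then show "y \<in> topspace (geo ?W)" using in_geo_iff[OF cW, of "k x"] kx x by blast
    qed
  qed
qed

lemma top_not_horn: "k \<le> n \<Longrightarrow> {..n} \<notin> horn_face n k"
  by (auto simp: horn_face_def)

lemma horn_insert: "S \<in> horn_face n k \<Longrightarrow> insert k S \<in> horn_face n k"
  by (auto simp: horn_face_def)

lemma horn_singleton: "1 \<le> n \<Longrightarrow> {k} \<in> horn_face n k"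
proof -
  assume "1 \<le> n"
  then have "{..n} \<noteq> {k}" by (metis atMost_iff singletonD zero_le not_one_le_zero)
  then show ?thesis by (auto simp: horn_face_def)
qed

text \<open>The top face \<open>{..n}\<close> is never in the horn, so its presence keeps the values
  of \<open>\<phi>\<close> outside the horn.\<close>

lemma cell_shapeI:
  assumes "\<And>n k c. 1 \<le> n \<Longrightarrow> n < M \<Longrightarrow> k \<le> n \<Longrightarrow> c \<in> sd2_verts n \<Longrightarrow> \<not> c \<subseteq> horn_face n k \<Longrightarrow> {..n} \<in> \<phi> n k c"
    and "\<And>n k c S. 1 \<le> n \<Longrightarrow> k \<le> n \<Longrightarrow> c \<in> sd2_verts n \<Longrightarrow> S \<in> \<phi> n k c \<Longrightarrow> S \<noteq> {} \<and> S \<subseteq> {..n}"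
    and "\<And>n k c S T. 1 \<le> n \<Longrightarrow> k \<le> n \<Longrightarrow> c \<in> sd2_verts n \<Longrightarrow> S \<in> \<phi> n k c \<Longrightarrow> T \<in> \<phi> n k c \<Longrightarrow> S \<subseteq> T \<or> T \<subseteq> S"
    and "\<And>n k c. 1 \<le> n \<Longrightarrow> k \<le> n \<Longrightarrow> c \<inter> horn_face n k \<noteq> {} \<Longrightarrow> \<phi> n k c \<inter> horn_face n k \<noteq> {}"
    and "\<And>n k c c'. c \<subseteq> c' \<Longrightarrow> \<phi> n k c \<subseteq> \<phi> n k c'"
  shows "cell_shape M \<phi>"
  unfolding cell_shape_def
proof (intro allI impI conjI ballI)
  fix n k c
  assume "1 \<le> n \<and> n < M \<and> k \<le> n \<and> c \<in> sd2_verts n \<and> \<not> c \<subseteq> horn_face n k"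
  then have a: "1 \<le> n" "n < M" "k \<le> n" "c \<in> sd2_verts n" "\<not> c \<subseteq> horn_face n k" by auto
  note T = assms(1)[OF a]
  show "\<phi> n k c \<in> sd2_verts n"
    using T assms(2)[OF a(1,3,4)] assms(3)[OF a(1,3,4)] by (intro sd2_vertsI) (auto simp: chain_def)
  show "\<not> \<phi> n k c \<subseteq> horn_face n k" using T top_not_horn[OF a(3)] by blast
  show "\<phi> n k c \<inter> horn_face n k \<noteq> {}" if "c \<inter> horn_face n k \<noteq> {}"
    using assms(4)[OF a(1,3) that] .
  show "\<phi> n k c \<subseteq> \<phi> n k c'" if "c \<subseteq> c'" for c' using assms(5)[OF that] .
qed

text \<open>Horn faces of size up to \<open>i\<close> are kept and those larger than
  \<open>j\<close> receive \<open>k\<close>. For \<open>i = j\<close> each face has one image; for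
  \<open>i = Suc j\<close> the faces of size \<open>Suc j\<close> have both, which is the common
  upper bound of two consecutive steps.\<close>

definition push_horn :: "nat \<Rightarrow> nat \<Rightarrow> nat \<Rightarrow> nat \<Rightarrow> nat set set \<Rightarrow> nat set set" where
  "push_horn i j n k c = insert {..n} ({S \<in> c \<inter> horn_face n k. card S \<le> i} \<union>
     insert k ` {S \<in> c \<inter> horn_face n k. j < card S})"

lemma sd2_verts_comparable:
  assumes "c \<in> sd2_verts n" "S \<in> c" "T \<in> c"
  shows "S \<subseteq> T \<or> T \<subseteq> S" "card S < card T \<Longrightarrow> S \<subseteq> T"
proof -
  show 1: "S \<subseteq> T \<or> T \<subseteq> S" using sd2_vertsD(4)[OF assms(1)] assms(2,3) by (auto simp: chain_def)
  show "S \<subseteq> T" if "card S < card T"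
    using 1 that card_mono[of S T] sd2_vertsD(3)[OF assms(1,2)] by auto
qed

lemma push_horn_elem:
  assumes "k \<le> n" "c \<in> sd2_verts n" "S \<in> push_horn i j n k c"
  shows "S \<noteq> {} \<and> S \<subseteq> {..n}"
  using assms sd2_vertsD(3)[OF assms(2)] unfolding push_horn_def by auto

text \<open>Because \<open>i \<le> Suc j\<close>, a kept face is never larger than one that receives
  \<open>k\<close>, hence is contained in it.\<close>

lemma push_horn_chain:
  assumes k: "k \<le> n" and c: "c \<in> sd2_verts n" and ij: "i \<le> Suc j"
    and S: "S \<in> push_horn i j n k c" and T: "T \<in> push_horn i j n k c"
  shows "S \<subseteq> T \<or> T \<subseteq> S"
proof -
  have mixed: "S \<subseteq> insert k T" if st: "S \<in> c" "card S \<le> i" "T \<in> c" "j < card T" for S T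
  proof -
    consider "card S < card T" | "card S = card T" using st(2,4) ij by linarith
    then show ?thesis
    proof cases
      case 1
      then show ?thesis using sd2_verts_comparable(2)[OF c st(1,3)] by blast
    next
      case 2
      then have "S = T"
        using sd2_verts_comparable(1)[OF c st(1,3)] sd2_vertsD(3)[OF c st(1)] sd2_vertsD(3)[OF c st(3)]
        by (metis card_subset_eq)
      then show ?thesis by blast
    qed
  qed
  have el: "S = {..n} \<or> (S \<in> c \<and> card S \<le> i) \<or> (\<exists>S'\<in>c. j < card S' \<and> S = insert k S')"
    if "S \<in> push_horn i j n k c" for S
    using that unfolding push_horn_def by blast
  show ?thesis
  proof (cases "S = {..n} \<or> T = {..n}")
    case True
    then show ?thesis using push_horn_elem[OF k c S] push_horn_elem[OF k c T] by blast
  next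
    case False
    then have "(S \<in> c \<and> card S \<le> i) \<or> (\<exists>S'\<in>c. j < card S' \<and> S = insert k S')"
      "(T \<in> c \<and> card T \<le> i) \<or> (\<exists>T'\<in>c. j < card T' \<and> T = insert k T')"
      using el[OF S] el[OF T] by blast+
    then show ?thesis
    proof (elim disjE bexE conjE)
      fix S' T' assume "S' \<in> c" "S = insert k S'" "T' \<in> c" "T = insert k T'"
      then show ?thesis using sd2_verts_comparable(1)[OF c, of S' T'] by blast
    next
      assume "S \<in> c" "T \<in> c"
      then show ?thesis using sd2_verts_comparable(1)[OF c] by blast
    next
      fix T' assume "S \<in> c" "card S \<le> i" "T' \<in> c" "j < card T'" "T = insert k T'"
      then show ?thesis using mixed[of S T'] by blast
    next
      fix S' assume "T \<in> c" "card T \<le> i" "S' \<in> c" "j < card S'" "S = insert k S'"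
      then show ?thesis using mixed[of T S'] by blast
    qed
  qed
qed

text \<open>\<open>j \<le> i\<close> ensures that every horn face leaves an image, and adding
  \<open>k\<close> does not leave the horn.\<close>

lemma cell_shape_push_horn:
  assumes "j \<le> i" "i \<le> Suc j"
  shows "cell_shape M (push_horn i j)"
proof (rule cell_shapeI)
  show "push_horn i j n k c \<inter> horn_face n k \<noteq> {}" if c: "c \<inter> horn_face n k \<noteq> {}" for n k c
  proof -
    obtain S where S: "S \<in> c \<inter> horn_face n k" using c by blast
    show ?thesis
    proof (cases "card S \<le> i")
      case True
      then show ?thesis using S unfolding push_horn_def by blast
    next
      case False
      then have "j < card S" using assms by linarith
      then have "insert k S \<in> push_horn i j n k c" using S unfolding push_horn_def by blast
      then show ?thesis using horn_insert[of S n k] S by blast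
    qed
  qed
  show "push_horn i j n k c \<subseteq> push_horn i j n k c'" if "c \<subseteq> c'" for n k c c'
    using that unfolding push_horn_def by blast
qed (use push_horn_elem push_horn_chain assms in \<open>auto simp: push_horn_def\<close>)

text \<open>The pair consisting of a cell and its rim is deformed into the rim through the poset maps
  \<open>c \<le> c \<union> {T} \<ge> (c \<inter> \<Lambda>) \<union> {T} \<sim> \<dots> \<sim> {S \<union> {k} | S \<in> c \<inter> \<Lambda>} \<union> {T} \<le> \<dots> \<ge> {{k}, T}\<close> with
  \<open>T = {..n}\<close> and \<open>\<Lambda>\<close> the horn; the dots replace \<open>S\<close> by \<open>S \<union> {k}\<close> for one cardinality of
  \<open>S\<close> at a time.\<close>

lemma homotopic_cell_rim:
  assumes X: "cell_like K X" and M: "0 < M"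
  shows "homotopic_with (preserves (rim_part X M)) (geo (new_part X M)) (geo (new_part X M))
    id (gmap (on_cells M (\<lambda>n k c. {{..n}, {k}})))"
proof -
  let ?U = "new_part X M" and ?W = "rim_part X M"
  let ?HR = "\<lambda>\<phi> \<psi>. homotopic_with (preserves ?W) (geo ?U) (geo ?U) (gmap (on_cells M \<phi>)) (gmap (on_cells M \<psi>))"
  let ?i = "\<lambda>n k c. c" and ?T = "\<lambda>n k c. insert {..n} c"
  \<comment> \<open>In \<open>push_horn 0 0\<close> every horn face has received \<open>k\<close>,
    as none is empty; therefore \<open>{k}\<close> can be adjoined.\<close>
  let ?\<omega> = "\<lambda>n k c. insert {k} (push_horn 0 0 n k c)" and ?\<kappa> = "\<lambda>n k c. {{..n}, {k}}"
  have cX: "complex X" by (rule cell_likeD(1)[OF X])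
  have cU: "complex ?U" by (rule complex_full[OF cX])
  have s_i: "cell_shape M ?i" by (simp add: cell_shape_def)
  have s_T: "cell_shape M ?T"
  proof (rule cell_shapeI)
    show "S \<noteq> {} \<and> S \<subseteq> {..n}" if "c \<in> sd2_verts n" "S \<in> insert {..n} c" for n :: nat and c S
      using sd2_vertsD(3)[OF that(1)] that(2) by auto
    show "S \<subseteq> T \<or> T \<subseteq> S" if "c \<in> sd2_verts n" "S \<in> insert {..n} c" "T \<in> insert {..n} c" for n :: nat and c S T
      using sd2_verts_comparable(1)[OF that(1)] sd2_vertsD(3)[OF that(1)] that(2,3) by blast
  qed auto
  have s_\<omega>: "cell_shape M ?\<omega>"
  proof (rule cell_shapeI)
    fix n k c S assume n: "1 \<le> n" "k \<le> n" and c: "c \<in> sd2_verts n"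
    have kin: "{k} \<subseteq> S" if "S \<in> push_horn 0 0 n k c" for S
      using that n sd2_vertsD(3)[OF c] unfolding push_horn_def by auto
    show "S \<noteq> {} \<and> S \<subseteq> {..n}" if "S \<in> insert {k} (push_horn 0 0 n k c)"
      using that push_horn_elem[OF n(2) c] n by auto
    show "S \<subseteq> T \<or> T \<subseteq> S" if "S \<in> insert {k} (push_horn 0 0 n k c)" "T \<in> insert {k} (push_horn 0 0 n k c)" for T
      using that kin push_horn_chain[OF n(2) c, of 0 0 S T] by blast
  next
    show "insert {k} (push_horn 0 0 n k c) \<inter> horn_face n k \<noteq> {}" if "1 \<le> n" for n k :: nat and c
      using horn_singleton[OF that] by blast
    show "insert {k} (push_horn 0 0 n k c) \<subseteq> insert {k} (push_horn 0 0 n k c')" if "c \<subseteq> c'" for n k c c'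
      using that unfolding push_horn_def by blast
  qed (auto simp: push_horn_def)
  have s_\<kappa>: "cell_shape M ?\<kappa>"
  proof (rule cell_shapeI)
    show "{{..n}, {k}} \<inter> horn_face n k \<noteq> {}" if "1 \<le> n" for n k
      using horn_singleton[OF that] by blast
  qed auto
  have b1: "cell_below M ?i ?T" by (auto simp: cell_below_def)
  \<comment> \<open>Faces have at most \<open>n + 1 \<le> M\<close> elements, so
    \<open>push_horn M M\<close> adds \<open>k\<close> to none of them. This is where the dimension
    counted in \<open>level\<close> pays off: one number of steps serves all cells of the
    level.\<close>
  have b2: "cell_below M (push_horn M M) ?T"
    unfolding cell_below_def
  proof (intro allI impI)
    fix n k c assume a: "1 \<le> n \<and> n < M \<and> k \<le> n \<and> c \<in> sd2_verts n \<and> \<not> c \<subseteq> horn_face n k"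
    have "\<not> M < card S" if "S \<in> c" for S
      using a sd2_vertsD(3)[of c n S] that card_mono[of "{..n}" S] by simp
    then show "push_horn M M n k c \<subseteq> insert {..n} c" unfolding push_horn_def by blast
  qed
  have "push_horn j j n k c \<subseteq> push_horn (Suc j) j n k c" "push_horn (Suc j) (Suc j) n k c \<subseteq> push_horn (Suc j) j n k c"
    for j n k c unfolding push_horn_def by (intro insert_mono Un_mono image_mono; auto)+
  then have b3: "cell_below M (push_horn j j) (push_horn (Suc j) j)" "cell_below M (push_horn (Suc j) (Suc j)) (push_horn (Suc j) j)" for j
    by (simp_all add: cell_below_def)
  have b4: "cell_below M (push_horn 0 0) ?\<omega>" by (auto simp: cell_below_def)
  have b5: "cell_below M ?\<kappa> ?\<omega>" by (auto simp: cell_below_def push_horn_def)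
  note HR = homotopic_on_cells[OF X M] and tr = homotopic_with_trans and sy = homotopic_with_symD
  have 1: "?HR ?i ?T" by (rule sy[OF HR[OF s_i s_T b1]])
  have 2: "?HR ?T (push_horn M M)" by (rule HR[OF cell_shape_push_horn s_T b2]) auto
  have 3: "?HR (push_horn (Suc j) (Suc j)) (push_horn j j)" for j
    by (rule tr[OF sy[OF HR[OF _ _ b3(2)[of j]]] HR[OF _ _ b3(1)[of j]]]) (auto intro: cell_shape_push_horn)
  have 4: "?HR (push_horn j j) (push_horn 0 0)" for j
  proof (induction j)
    case 0
    \<comment> \<open>Reflexivity presupposes continuity and preservation of the rim; both are read
      off from an end of a homotopy already built.\<close>
    show ?case using 3[of 0] homotopic_with_imp_continuous_maps homotopic_with_imp_property
      by (simp add: homotopic_with_imp_continuous_maps[OF 3[of 0]] homotopic_with_imp_property[OF 3[of 0]])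
  next
    case (Suc j)
    show ?case by (rule tr[OF 3 Suc])
  qed
  have 5: "?HR (push_horn 0 0) ?\<omega>" by (rule sy[OF HR[OF cell_shape_push_horn s_\<omega> b4]]) auto
  have 6: "?HR ?\<omega> ?\<kappa>" by (rule HR[OF s_\<kappa> s_\<omega> b5])
  have main: "?HR ?i ?\<kappa>" by (rule tr[OF tr[OF tr[OF tr[OF 1 2] 4] 5] 6])
  have "homotopic_with (preserves ?W) (geo ?U) (geo ?U) id (gmap (on_cells M ?i))"
  proof (rule homotopic_with_equal)
    show "id x = gmap (on_cells M ?i) x" if x: "x \<in> topspace (geo ?U)" for x
    proof -
      have "on_cells M ?i v = v" if v: "v \<in> gsupp x" for v
      proof -
        have gx: "gsupp x \<in> X" "level v = M" using x in_geo_iff[OF cU] v by blast+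
        then have lv0: "0 < level v" using M by simp
        obtain n k f g c where "v = Cell n k f g c" "c \<notin> sd2_horn n k"
          using cell_like_vertex[OF X gx(1) v lv0] by metis
        then show ?thesis by (simp add: on_cells_def att_def)
      qed
      then show ?thesis using gmap_id_on[OF finite_gsupp_geo[OF cU x]] by simp
    qed
    show "preserves ?W (gmap (on_cells M ?i))" using homotopic_with_imp_property[OF main] by blast
  qed auto
  then show ?thesis using main homotopic_with_trans by blast
qed

text \<open>A simplex of this stage with a core vertex has only vertices of level
  \<open>Suc m\<close>, so these vertices can play the part of \<open>U\<close> in
  \<open>sdr_push\<close>. The deformation fed into it moves every cell to its single rim vertex
  \<open>{{..n}, {k}}\<close>.\<close>

lemma sdr_core:
  assumes X: "cell_like K X"
  shows "sdr (full X {v. level v \<le> Suc m \<and> \<not> (level v = Suc m \<and> is_core v)}) (full X {v. level v \<le> Suc m})"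
proof -
  let ?M = "Suc m"
  let ?Y = "full X {v. level v \<le> ?M}" and ?C = "{v. level v = ?M \<and> is_core v}" and ?U = "{v. level v = ?M}"
  have cX: "complex X" by (rule cell_likeD(1)[OF X])
  have YU: "full ?Y ?U = new_part X ?M" by auto
  have YW: "full ?Y (?U - ?C) = rim_part X ?M" by auto
  have cU: "complex (new_part X ?M)" and cW: "complex (rim_part X ?M)" by (rule complex_full[OF cX])+
  let ?\<kappa> = "on_cells ?M (\<lambda>n k c. {{..n}, {k}})"
  have G: "homotopic_with (preserves (rim_part X ?M)) (geo (new_part X ?M)) (geo (new_part X ?M)) id (gmap ?\<kappa>)"
    by (rule homotopic_cell_rim[OF X]) simp
  have "sdr (full ?Y (- ?C)) ?Y"
  proof (rule sdr_push)
    show "complex ?Y" by (rule complex_full[OF cX])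
    show "s \<subseteq> ?U" if s: "s \<in> ?Y" "s \<inter> ?C \<noteq> {}" for s
    proof
      fix w assume w: "w \<in> s"
      obtain v where v: "v \<in> s" "level v = ?M" "is_core v" using s(2) by blast
      obtain n k f g c where vc: "v = Cell n k f g c" using v(2) by (cases v) auto
      have le: "level w \<le> level (Cell n k f g c)" using s(1) w v(2) vc by auto
      have sX: "s \<in> X" using s(1) by blast
      \<comment> \<open>Only edges are examined, so the argument covers cliques as well.\<close>
      have "{v, w} \<in> cell_cpx K" by (rule cell_likeD(2)[OF X sX v(1) w])
      from cell_cpx_top[OF this order_refl, of n k f g c] le
      obtain C where C: "cchain n C" "c \<in> C" "{v, w} = att n k f g ` C" "c \<notin> sd2_horn n k"
        by (auto simp: vc simp del: level.simps)
      obtain d where d: "d \<in> C" "w = att n k f g d" using C(3) by blast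
      have cH: "c \<inter> horn_face n k = {}" using v(3) by (simp add: vc is_core_def)
      have cd: "c \<in> sd2_verts n" "d \<in> sd2_verts n" "chain C" using C(1,2) d(1) by (auto simp: cchain_def)
      have "c \<noteq> {}" "d \<noteq> {}" by (rule sd2_vertsD(1)[OF cd(1)] sd2_vertsD(1)[OF cd(2)])+
      moreover have "c \<subseteq> d \<or> d \<subseteq> c" using cd(3) C(2) d(1) by (simp add: chain_def)
      \<comment> \<open>If \<open>d\<close> were in the horn, comparability of the nonempty chains
        \<open>c\<close> and \<open>d\<close> would put a member of \<open>c\<close> into the
        horn.\<close>
      ultimately have "d \<notin> sd2_horn n k" using cH unfolding sd2_horn_def by blast
      then have wd: "w = Cell n k f g d" using d(2) by (simp add: att_def)
      have "level w = level v" unfolding wd vc by (rule level_cell_cong)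
      then show "w \<in> ?U" using v(2) by simp
    qed
    show "homotopic_with (preserves (full ?Y (?U - ?C))) (geo (full ?Y ?U)) (geo (full ?Y ?U)) id (gmap ?\<kappa>)"
      unfolding YU YW by (rule G)
    show "gmap ?\<kappa> ` topspace (geo (full ?Y ?U)) \<subseteq> topspace (geo (full ?Y (?U - ?C)))"
      unfolding YU YW
    proof
      fix y assume "y \<in> gmap ?\<kappa> ` topspace (geo (new_part X ?M))"
      then obtain x where x: "x \<in> topspace (geo (new_part X ?M))" "y = gmap ?\<kappa> x" by blast
      have "continuous_map (geo (new_part X ?M)) (geo (new_part X ?M)) (gmap ?\<kappa>)"
        using homotopic_with_imp_continuous_maps[OF G] by blast
      then have y: "gsupp y \<in> new_part X ?M" "y \<in> gsimp (gsupp y)"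
        using x in_geo_iff[OF cU, of y] by (auto simp: continuous_map_def)
      have "\<not> is_core w" if w: "w \<in> gsupp y" for w
      proof -
        obtain v where v: "v \<in> gsupp x" "w = ?\<kappa> v" using w gsupp_gmap[of ?\<kappa> x] x(2) by blast
        have gx: "gsupp x \<in> X" "level v = ?M" using x(1) v(1) in_geo_iff[OF cU] by blast+
        then have lv0: "0 < level v" by simp
        obtain n k f g c where vc: "v = Cell n k f g c" "1 \<le> n" "k \<le> n"
          using cell_like_vertex[OF X gx(1) v(1) lv0] by metis
        have "{{..n}, {k}} \<notin> sd2_horn n k" using top_not_horn[OF vc(3)] by (auto simp: sd2_horn_def)
        then have "w = Cell n k f g {{..n}, {k}}"
          using v(2) gx(2) by (simp add: on_cells_def vc(1) att_def del: level.simps)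
        then show ?thesis using horn_singleton[OF vc(2)] by (auto simp: is_core_def)
      qed
      then have "gsupp y \<in> rim_part X ?M" using y by blast
      then show "y \<in> topspace (geo (rim_part X ?M))" using in_geo_iff[OF cW] y(2) by blast
    qed
  qed
  moreover have "full ?Y (- ?C) = full X {v. level v \<le> ?M \<and> \<not> (level v = ?M \<and> is_core v)}" by auto
  ultimately show ?thesis by simp
qed

text \<open>The stages are the full subcomplexes of bounded level; each retracts first onto its rim
  and then onto the previous stage.\<close>

lemma sdr_cell_like:
  assumes X: "cell_like K X"
  shows "sdr ((`) (\<lambda>p. Base (fst p) (snd p)) ` blow K) X"
proof -
  have cX: "complex X" by (rule cell_likeD(1)[OF X])
  have "sdr (full X {v. level v \<le> 0}) (\<Union>m. full X {v. level v \<le> m})"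
    by (rule sdr_union[where X = "\<lambda>m. full X {v. level v \<le> m}"])
      (auto intro: complex_full[OF cX] sdr_trans[OF sdr_rim[OF X] sdr_core[OF X]])
  moreover have "(\<Union>m. full X {v. level v \<le> m}) = X"
  proof (intro equalityI subsetI)
    fix s assume s: "s \<in> X"
    have "s \<subseteq> {v. level v \<le> Max (level ` s)}" using complex_finite[OF cX s] by auto
    then show "s \<in> (\<Union>m. full X {v. level v \<le> m})" using s by blast
  qed auto
  ultimately show ?thesis using cell_likeD(3)[OF X] by simp
qed

section \<open>Lifting to the free cell complex\<close>

lemma complex_image: "complex X \<Longrightarrow> complex ((`) e ` X)"
  unfolding complex_def
proof (intro conjI ballI allI impI)
  fix s t assume X: "(\<forall>s\<in>X. finite s \<and> s \<noteq> {}) \<and> (\<forall>s\<in>X. \<forall>t. t \<subseteq> s \<and> t \<noteq> {} \<longrightarrow> t \<in> X)"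
    and s: "s \<in> (`) e ` X" and t: "t \<subseteq> s \<and> t \<noteq> {}"
  obtain s' where s': "s' \<in> X" "s = e ` s'" using s by blast
  obtain t' where t': "t' \<subseteq> s'" "t = e ` t'" using t s'(2) subset_image_iff[of t e s'] by auto
  then have "t' \<in> X" using X s'(1) t by blast
  then show "t \<in> (`) e ` X" using t' by blast
qed auto

lemma gsupp_verts: "complex X \<Longrightarrow> x \<in> topspace (geo X) \<Longrightarrow> gsupp x \<subseteq> verts X"
  using in_geo_iff by (auto simp: verts_def)

lemma hinverse_iso:
  assumes X: "complex X" and e: "inj_on e (verts X)"
  shows "hinverse (geo X) (geo ((`) e ` X)) (gmap e) (gmap (inv_into (verts X) e))"
proof -
  let ?E = "(`) e ` X" and ?d = "inv_into (verts X) e"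
  have E: "complex ?E" by (rule complex_image[OF X])
  have inv: "?d (e v) = v" if "v \<in> verts X" for v using inv_into_f_f[OF e that] .
  have ds: "?d ` e ` s = s" if "s \<in> X" for s
  proof -
    have "s \<subseteq> verts X" using that by (auto simp: verts_def)
    then show ?thesis using inv by (force simp: image_image)
  qed
  have m1: "cpx_map X ?E e" by (auto simp: cpx_map_def)
  have m2: "cpx_map ?E X ?d" using ds by (auto simp: cpx_map_def)
  note c1 = continuous_map_gmap[OF X E m1] and c2 = continuous_map_gmap[OF E X m2]
  have "gmap ?d (gmap e x) = x" if x: "x \<in> topspace (geo X)" for x
    using gsupp_verts[OF X x] inv
    by (subst gmap_gmap[OF finite_gsupp_geo[OF X x]], subst gmap_id_on[OF finite_gsupp_geo[OF X x]]) auto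
  then have "homotopic_with (\<lambda>_. True) (geo X) (geo X) (gmap ?d \<circ> gmap e) id"
    by (intro homotopic_with_equal continuous_map_compose[OF c1 c2]) auto
  moreover have "gmap e (gmap ?d x) = x" if x: "x \<in> topspace (geo ?E)" for x
  proof -
    have "e (?d w) = w" if "w \<in> gsupp x" for w
    proof -
      have "verts ?E = e ` verts X" unfolding verts_def by (rule image_Union[symmetric])
      then have "w \<in> e ` verts X" using gsupp_verts[OF E x] that by blast
      then show ?thesis by (rule f_inv_into_f)
    qed
    then show ?thesis
      by (subst gmap_gmap[OF finite_gsupp_geo[OF E x]], subst gmap_id_on[OF finite_gsupp_geo[OF E x]]) auto
  qed
  then have "homotopic_with (\<lambda>_. True) (geo ?E) (geo ?E) (gmap e \<circ> gmap ?d) id"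
    by (intro homotopic_with_equal continuous_map_compose[OF c2 c1]) auto
  ultimately show ?thesis using c1 c2 by (simp add: hinverse_def)
qed

text \<open>The inclusion of the blow-up followed by \<open>vproj\<close> is \<open>fst\<close>, and
  both the inclusion and \<open>fst\<close> are homotopy equivalences.\<close>

lemma whe_vproj:
  assumes K: "complex K"
  shows "weak_homotopy_equivalence (geo (cell_cpx K)) (geo K) (gmap vproj)"
proof -
  let ?b = "\<lambda>p. Base (fst p) (snd p)" and ?Q = "cell_cpx K"
  let ?A = "(`) ?b ` blow K"
  have inj: "inj ?b" by (auto simp: inj_def prod_eq_iff)
  have m: "cpx_map ?Q K vproj" using vproj_cell_cpx[OF K] by (simp add: cpx_map_def)
  have cv: "continuous_map (geo ?Q) (geo K) (gmap vproj)" by (rule continuous_map_gmap[OF complex_cell_cpx K m])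
  obtain r where r: "hinverse (geo ?A) (geo ?Q) id r"
    using sdr_hinverse[OF sdr_cell_like[OF cell_like_cell_cpx]] .
  have b: "hinverse (geo (blow K)) (geo ?A) (gmap ?b) (gmap (inv_into (verts (blow K)) ?b))"
    by (rule hinverse_iso[OF complex_blow]) (rule inj_on_subset[OF inj subset_UNIV])
  have br: "hinverse (geo (blow K)) (geo ?Q) (id \<circ> gmap ?b) (gmap (inv_into (verts (blow K)) ?b) \<circ> r)"
    by (rule hinverse_comp[OF b r])
  obtain g where g: "hinverse (geo (blow K)) (geo K) (gmap fst) g" using hinverse_blow[OF K] .
  have "homotopic_with (\<lambda>_. True) (geo (blow K)) (geo K) (gmap fst) (gmap vproj \<circ> (id \<circ> gmap ?b))"
  proof (rule homotopic_with_equal)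
    show "continuous_map (geo (blow K)) (geo K) (gmap fst)" using g by (simp add: hinverse_def)
    show "gmap fst x = (gmap vproj \<circ> (id \<circ> gmap ?b)) x" if x: "x \<in> topspace (geo (blow K))" for x
      by (simp add: gmap_gmap[OF finite_gsupp_geo[OF complex_blow x]]) (intro gmap_cong, simp)
  qed auto
  then have "weak_homotopy_equivalence (geo (blow K)) (geo K) (gmap vproj \<circ> (id \<circ> gmap ?b))"
    by (rule whe_homotopic[OF hinverse_whe[OF g]])
  then show ?thesis using whe_comp_hinverse_right[OF br cv] by blast
qed

section \<open>Chains in the faces of a simplex and the lifting property\<close>

text \<open>Inverse of \<open>coface i\<close> off \<open>i\<close>; \<open>pull i\<close> and
  \<open>push i\<close> thereby identify the chains avoiding \<open>i\<close> with the chains of the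
  \<open>i\<close>-th face.\<close>

definition delete :: "nat \<Rightarrow> nat \<Rightarrow> nat" where
  "delete i x = (if x < i then x else x - 1)"

definition pull :: "nat \<Rightarrow> nat set set \<Rightarrow> nat set set" where
  "pull i c = (\<lambda>S. delete i ` S) ` c"

definition push :: "nat \<Rightarrow> nat set set \<Rightarrow> nat set set" where
  "push i c = (\<lambda>S. coface i ` S) ` c"

lemma delete_coface: "delete i (coface i x) = x"
  by (auto simp: delete_def coface_def)

lemma coface_delete: "x \<noteq> i \<Longrightarrow> coface i (delete i x) = x"
  by (auto simp: delete_def coface_def)

lemma coface_delete2: "i < j \<Longrightarrow> x \<noteq> i \<Longrightarrow> x \<noteq> j \<Longrightarrow> coface (j - 1) (delete i (delete j x)) = delete i x"
  by (auto simp: delete_def coface_def)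

lemma image_cong_id: "(\<And>x. x \<in> S \<Longrightarrow> h x = x) \<Longrightarrow> h ` S = S"
  by force

lemma pull_push: "pull i (push i c) = c"
  unfolding pull_def push_def image_image delete_coface by simp

lemma push_pull:
  assumes "\<And>S. S \<in> c \<Longrightarrow> i \<notin> S"
  shows "push i (pull i c) = c"
  unfolding pull_def push_def image_image
proof (rule image_cong_id)
  show "(\<lambda>x. coface i (delete i x)) ` S = S" if "S \<in> c" for S
    using assms[OF that] by (intro image_cong_id coface_delete) auto
qed

lemma push_pull2:
  assumes "i < j" "\<And>S. S \<in> c \<Longrightarrow> i \<notin> S \<and> j \<notin> S"
  shows "push (j - 1) (pull i (pull j c)) = pull i c"
  unfolding pull_def push_def image_image
proof (rule image_cong[OF refl])
  show "(\<lambda>x. coface (j - 1) (delete i (delete j x))) ` S = delete i ` S" if "S \<in> c" for S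
    using assms(1) assms(2)[OF that] by (intro image_cong refl coface_delete2) auto
qed

lemma chain_image2: "chain c \<Longrightarrow> chain ((\<lambda>S. h ` S) ` c)"
  unfolding chain_def by blast

lemma pull_sd2:
  assumes c: "c \<in> sd2_verts n" and i: "i \<le> n" "\<And>S. S \<in> c \<Longrightarrow> i \<notin> S"
  shows "pull i c \<in> sd2_verts (n - 1)"
proof (rule sd2_vertsI)
  show "pull i c \<noteq> {}" "chain (pull i c)"
    using sd2_vertsD(1,4)[OF c] chain_image2 by (auto simp: pull_def)
  fix T assume "T \<in> pull i c"
  then obtain S where S: "S \<in> c" "T = delete i ` S" by (auto simp: pull_def)
  have "delete i x \<le> n - 1" if "x \<in> S" for x
  proof -
    have "x \<le> n" "x \<noteq> i" using sd2_vertsD(3)[OF c S(1)] i(2)[OF S(1)] that by auto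
    then show ?thesis using i(1) by (auto simp: delete_def)
  qed
  then show "T \<noteq> {} \<and> T \<subseteq> {..n - 1}" using S sd2_vertsD(3)[OF c S(1)] by auto
qed

lemma push_sd2:
  assumes c: "c \<in> sd2_verts (n - 1)" and i: "i \<le> n" "1 \<le> n"
  shows "push i c \<in> sd2_verts n" "\<And>S. S \<in> push i c \<Longrightarrow> i \<notin> S"
proof -
  show "push i c \<in> sd2_verts n"
  proof (rule sd2_vertsI)
    show "push i c \<noteq> {}" "chain (push i c)"
      using sd2_vertsD(1,4)[OF c] chain_image2 by (auto simp: push_def)
    fix T assume "T \<in> push i c"
    then obtain S where S: "S \<in> c" "T = coface i ` S" by (auto simp: push_def)
    have "coface i x \<le> n" if "x \<in> S" for x
    proof -
      have "x \<le> n - 1" using sd2_vertsD(3)[OF c S(1)] that by auto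
      then show ?thesis using i by (auto simp: coface_def)
    qed
    then show "T \<noteq> {} \<and> T \<subseteq> {..n}" using S sd2_vertsD(3)[OF c S(1)] by auto
  qed
  show "i \<notin> S" if "S \<in> push i c" for S
    using that by (auto simp: push_def coface_def split: if_splits)
qed

text \<open>The largest member of the chain already misses a vertex other than \<open>k\<close>, and
  then so do the smaller ones.\<close>

lemma horn_misses:
  assumes c: "c \<in> sd2_horn n k" and k: "k \<le> n"
  obtains i where "i \<le> n" "i \<noteq> k" "\<And>S. S \<in> c \<Longrightarrow> i \<notin> S"
proof -
  have cs: "c \<in> sd2_verts n" "c \<subseteq> horn_face n k" using c by (auto simp: sd2_horn_def)
  have U: "\<Union>c \<in> c" by (rule chain_Union_in[OF sd2_vertsD(2,1,4)[OF cs(1)]])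
  then have "insert k (\<Union>c) \<noteq> {..n}" using cs(2) by (auto simp: horn_face_def)
  moreover have "insert k (\<Union>c) \<subseteq> {..n}" using sd2_vertsD(3)[OF cs(1) U] k by simp
  ultimately obtain i where "i \<le> n" "i \<notin> insert k (\<Union>c)" by auto
  then show thesis using that by blast
qed

lemma missing_horn:
  assumes "c \<in> sd2_verts n" "i \<le> n" "i \<noteq> k" "\<And>S. S \<in> c \<Longrightarrow> i \<notin> S"
  shows "c \<in> sd2_horn n k"
proof -
  have "insert k S \<noteq> {..n}" if "S \<in> c" for S
    using assms(2,3) assms(4)[OF that] by (metis atMost_iff insertE)
  then show ?thesis using assms(1) by (auto simp: sd2_horn_def horn_face_def)
qed

lemma Ex2SingD: "y \<in> Ex2Sing K n \<Longrightarrow> cchain n C \<Longrightarrow> y ` C \<in> K"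
  by (auto simp: Ex2Sing_def cchain_def chain_def)

lemma Ex2Sing_undefined: "y \<in> Ex2Sing K n \<Longrightarrow> c \<notin> sd2_verts n \<Longrightarrow> y c = undefined"
  by (simp add: Ex2Sing_def)

lemma Ex2SingI:
  assumes "\<And>c. c \<notin> sd2_verts n \<Longrightarrow> y c = undefined" "\<And>C. cchain n C \<Longrightarrow> y ` C \<in> K"
  shows "y \<in> Ex2Sing K n"
  using assms by (auto simp: Ex2Sing_def cchain_def chain_def)

lemma Ex2Sing_act_push: "c \<in> sd2_verts m \<Longrightarrow> Ex2Sing_act m n (coface i) y c = y (push i c)"
  by (simp add: Ex2Sing_act_def push_def)

text \<open>A lifting problem names its own solution: its horn map and its simplex of
  \<open>K\<close> are the data \<open>f\<close> and \<open>g\<close> of a cell, and the filler is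
  the characteristic map of that cell. The inductive definition is closed under all such cells, so
  one construction replaces an iterated small object argument. The relabellings \<open>e\<close> and
  \<open>b\<close> bring the map into the type over which cofibrancy is tested.\<close>

lemma cell_cpx_fib:
  fixes e :: "'a vtx \<Rightarrow> 'w" and b :: "'a \<Rightarrow> 'u"
  assumes e: "inj_on e (verts (cell_cpx K))" and b: "inj b"
    and p: "\<And>v. v \<in> verts (cell_cpx K) \<Longrightarrow> p (e v) = b (vproj v)"
  shows "cpx_fib ((`) e ` cell_cpx K) ((`) b ` K) p"
  unfolding cpx_fib_def kan_fibration_def
proof (intro allI impI, elim conjE)
  let ?Q = "cell_cpx K" and ?E = "(`) e ` cell_cpx K" and ?B = "(`) b ` K"
  let ?d = "inv_into (verts ?Q) e"
  fix n k y b'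
  assume n: "1 \<le> n" and k: "k \<le> n" and y0: "\<forall>i\<le>n. i \<noteq> k \<longrightarrow> y i \<in> Ex2Sing ?E (n - 1)"
    and compat: "\<forall>i j. i < j \<and> j \<le> n \<and> i \<noteq> k \<and> j \<noteq> k \<longrightarrow>
      Ex2Sing_act (n - 2) (n - 1) (coface i) (y j) = Ex2Sing_act (n - 2) (n - 1) (coface (j - 1)) (y i)"
    and b': "b' \<in> Ex2Sing ?B n"
    and faces: "\<forall>i\<le>n. i \<noteq> k \<longrightarrow> Ex2Sing_act (n - 1) n (coface i) b' = Ex2Sing_map p (n - 1) (y i)"
  have y: "y i \<in> Ex2Sing ?E (n - 1)" if "i \<le> n" "i \<noteq> k" for i using y0 that by blast
  \<comment> \<open>Two faces agree on the chains avoiding both \<open>i\<close> and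
    \<open>j\<close>: the compatibility of the horn is read after removing \<open>j\<close> and then
    \<open>i\<close>.\<close>
  have agree: "y i (pull i c) = y j (pull j c)"
    if c: "c \<in> sd2_verts n" and ij: "i < j" "j \<le> n" "i \<noteq> k" "j \<noteq> k"
      and m: "\<And>S. S \<in> c \<Longrightarrow> i \<notin> S \<and> j \<notin> S" for c i j
  proof -
    have pj: "pull j c \<in> sd2_verts (n - 1)" by (rule pull_sd2[OF c ij(2)]) (use m in auto)
    have mi: "i \<notin> T" if T: "T \<in> pull j c" for T
    proof -
      obtain S where S: "S \<in> c" "T = delete j ` S" using T by (auto simp: pull_def)
      have "delete j x \<noteq> i" if "x \<in> S" for x
      proof -
        have "x \<noteq> i" "x \<noteq> j" using m[OF S(1)] that by auto
        then show ?thesis using ij(1) unfolding delete_def by (cases "x < j") simp_all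
      qed
      then show ?thesis using S by auto
    qed
    have "i \<le> n - 1" using ij by simp
    from pull_sd2[OF pj this mi] have d: "pull i (pull j c) \<in> sd2_verts (n - 2)"
      by (simp add: numeral_2_eq_2)
    have "Ex2Sing_act (n - 2) (n - 1) (coface i) (y j) (pull i (pull j c)) =
        Ex2Sing_act (n - 2) (n - 1) (coface (j - 1)) (y i) (pull i (pull j c))"
      using compat ij by simp
    then have "y j (push i (pull i (pull j c))) = y i (push (j - 1) (pull i (pull j c)))"
      by (simp only: Ex2Sing_act_push[OF d])
    then show ?thesis using push_pull[of "pull j c" i] mi push_pull2[OF ij(1) m] by simp
  qed
  \<comment> \<open>The horn map, evaluated on any face that contains the chain; by
    \<open>agree\<close> the choice of face is immaterial.\<close>
  define w where "w c = (let i = (SOME i. i \<le> n \<and> i \<noteq> k \<and> (\<forall>S\<in>c. i \<notin> S)) in y i (pull i c))" for c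
  have w: "w c = y i (pull i c)" if c: "c \<in> sd2_verts n" and i: "i \<le> n" "i \<noteq> k" "\<And>S. S \<in> c \<Longrightarrow> i \<notin> S" for c i
  proof -
    let ?P = "\<lambda>i. i \<le> n \<and> i \<noteq> k \<and> (\<forall>S\<in>c. i \<notin> S)"
    have "?P i" using i by blast
    then have j: "?P (SOME i. ?P i)" by (rule someI)
    define j where "j = (SOME i. ?P i)"
    have j': "?P j" unfolding j_def by (rule j)
    have "y j (pull j c) = y i (pull i c)"
    proof (cases rule: linorder_cases[of i j])
      case less
      then show ?thesis using agree[OF c less] i j' by auto
    next
      case greater
      then show ?thesis using agree[OF c greater] i j' by auto
    qed simp
    then show ?thesis by (simp add: w_def j_def Let_def)
  qed
  define f where "f c = (if c \<in> sd2_horn n k then ?d (w c) else undefined)" for c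
  define g where "g c = (if c \<in> sd2_verts n then inv_into UNIV b (b' c) else undefined)" for c
  have dE: "?d ` e ` s = s" if "s \<in> ?Q" for s
  proof -
    have "s \<subseteq> verts ?Q" using that by (auto simp: verts_def)
    then show ?thesis using inv_into_f_f[OF e] by (force simp: image_image)
  qed
  have fC: "f ` C \<in> ?Q" if C: "cchain n C" "C \<subseteq> sd2_horn n k" for C
  proof -
    \<comment> \<open>A chain of chains has a largest member, so one face of the horn contains all
      of it and simpliciality can be checked there.\<close>
    have "\<Union>C \<in> C"
    proof (rule chain_Union_in)
      show "finite C" using C(1) finite_subset[OF _ finite_sd2_verts] by (auto simp: cchain_def)
    qed (use C in \<open>auto simp: cchain_def\<close>)
    then obtain i where i: "i \<le> n" "i \<noteq> k" "\<And>S. S \<in> \<Union>C \<Longrightarrow> i \<notin> S"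
      using C(2) horn_misses[OF _ k] by blast
    have Cs: "C \<subseteq> sd2_verts n" "chain C" "C \<noteq> {}" using C(1) by (auto simp: cchain_def)
    have iC: "i \<notin> S" if "c \<in> C" "S \<in> c" for c S by (rule i(3)[OF UnionI[OF that]])
    have wi: "w c = y i (pull i c)" if c: "c \<in> C" for c
      by (rule w[OF subsetD[OF Cs(1) c] i(1,2) iC[OF c]])
    have "cchain (n - 1) (pull i ` C)"
      unfolding cchain_def
    proof (intro conjI)
      show "pull i ` C \<subseteq> sd2_verts (n - 1)"
        by (intro image_subsetI pull_sd2[OF subsetD[OF Cs(1)] i(1)]) (use iC in auto)
      show "chain (pull i ` C)" using chain_image2[OF Cs(2)] by (simp add: pull_def[abs_def])
    qed (use Cs in auto)
    then have "y i ` pull i ` C \<in> ?E" by (rule Ex2SingD[OF y[OF i(1,2)]])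
    then obtain s where s: "s \<in> ?Q" "y i ` pull i ` C = e ` s" by blast
    have "f ` C = ?d ` y i ` pull i ` C"
      unfolding image_image using C(2) wi by (intro image_cong refl) (auto simp: f_def)
    then show ?thesis using dE[OF s(1)] s by simp
  qed
  have single: "cchain n {c}" if "c \<in> sd2_verts n" for c using that by (simp add: cchain_def chain_def)
  have fv: "f c \<in> verts ?Q" if "c \<in> sd2_horn n k" for c
    using fC[OF single, of c] that by (auto simp: sd2_horn_def verts_def)
  have ef: "e (f c) = w c" if c: "c \<in> sd2_horn n k" for c
  proof -
    have cs: "c \<in> sd2_verts n" using c by (simp add: sd2_horn_def)
    obtain i where i: "i \<le> n" "i \<noteq> k" "\<And>S. S \<in> c \<Longrightarrow> i \<notin> S" using horn_misses[OF c k] by blast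
    have "cchain (n - 1) {pull i c}" using pull_sd2[OF cs i(1,3)] by (simp add: cchain_def chain_def)
    then have "y i ` {pull i c} \<in> ?E" by (rule Ex2SingD[OF y[OF i(1,2)]])
    then obtain s where s: "s \<in> ?Q" "{y i (pull i c)} = e ` s" by auto
    then have "w c \<in> e ` s" using w[OF cs i] by auto
    then have "w c \<in> e ` verts ?Q" using s(1) by (auto simp: verts_def)
    then show ?thesis using c by (simp add: f_def f_inv_into_f)
  qed
  have bg: "b (g c) = b' c" if c: "c \<in> sd2_verts n" for c
  proof -
    have "b' ` {c} \<in> ?B" by (rule Ex2SingD[OF b' single[OF c]])
    then have "b' c \<in> range b" by auto
    then show ?thesis using c by (simp add: g_def f_inv_into_f)
  qed
  have g_in: "g \<in> Ex2Sing K n"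
  proof (rule Ex2SingI)
    fix C assume C: "cchain n C"
    then obtain s where s: "s \<in> K" "b' ` C = b ` s" using Ex2SingD[OF b' C] by blast
    have "g ` C = inv_into UNIV b ` b' ` C" unfolding image_image using C by (intro image_cong refl) (auto simp: g_def cchain_def)
    also have "\<dots> = s" using b by (simp add: s(2) image_image)
    finally show "g ` C \<in> K" using s by simp
  qed (simp add: g_def)
  have fg: "vproj (f c) = g c" if c: "c \<in> sd2_horn n k" for c
  proof -
    have cs: "c \<in> sd2_verts n" using c by (simp add: sd2_horn_def)
    obtain i where i: "i \<le> n" "i \<noteq> k" "\<And>S. S \<in> c \<Longrightarrow> i \<notin> S" using horn_misses[OF c k] by blast
    have pc: "pull i c \<in> sd2_verts (n - 1)" by (rule pull_sd2[OF cs i(1,3)])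
    have "Ex2Sing_act (n - 1) n (coface i) b' (pull i c) = Ex2Sing_map p (n - 1) (y i) (pull i c)"
      using faces i by simp
    then have "b' (push i (pull i c)) = p (y i (pull i c))"
      using pc by (simp add: Ex2Sing_act_push Ex2Sing_map_def)
    then have "b' c = p (w c)" using push_pull[of c i] i(3) w[OF cs i] by simp
    also have "\<dots> = b (vproj (f c))" using p[OF fv[OF c]] ef[OF c] by simp
    finally have "b (vproj (f c)) = b (g c)" using bg[OF cs] by simp
    then show ?thesis using b by (simp add: inj_eq)
  qed
  have cellQ: "att n k f g ` C \<in> ?Q" if "cchain n C" for C
    by (rule cell_cpx.cell[OF n k _ g_in _ _ that]) (use fC fg in \<open>auto simp: f_def\<close>)
  have att_v: "att n k f g c \<in> verts ?Q" if "c \<in> sd2_verts n" for c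
    using cellQ[OF single[OF that]] by (auto simp: verts_def)
  define x where "x c = (if c \<in> sd2_verts n then e (att n k f g c) else undefined)" for c
  show "\<exists>x\<in>Ex2Sing ?E n. Ex2Sing_map p n x = b' \<and>
      (\<forall>i\<le>n. i \<noteq> k \<longrightarrow> Ex2Sing_act (n - 1) n (coface i) x = y i)"
  proof (intro bexI[of _ x] conjI allI impI)
    show "x \<in> Ex2Sing ?E n"
    proof (rule Ex2SingI)
      fix C assume C: "cchain n C"
      have "x ` C = e ` att n k f g ` C"
        unfolding image_image using C by (intro image_cong refl) (auto simp: x_def cchain_def)
      then show "x ` C \<in> ?E" using cellQ[OF C] by simp
    qed (simp add: x_def)
    show "Ex2Sing_map p n x = b'"
    proof
      fix c
      show "Ex2Sing_map p n x c = b' c"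
      proof (cases "c \<in> sd2_verts n")
        case True
        then have "Ex2Sing_map p n x c = b (vproj (att n k f g c))"
          using p[OF att_v[OF True]] by (simp add: Ex2Sing_map_def x_def)
        then show ?thesis using vproj_att[of n k f g c] fg bg[OF True] by simp
      next
        case False
        then show ?thesis using Ex2Sing_undefined[OF b' False] by (simp add: Ex2Sing_map_def)
      qed
    qed
    fix i assume i: "i \<le> n" "i \<noteq> k"
    show "Ex2Sing_act (n - 1) n (coface i) x = y i"
    proof
      fix c
      show "Ex2Sing_act (n - 1) n (coface i) x c = y i c"
      proof (cases "c \<in> sd2_verts (n - 1)")
        case True
        note ps = push_sd2[OF True i(1) n]
        have h: "push i c \<in> sd2_horn n k" by (rule missing_horn[OF ps(1) i ps(2)])
        have "Ex2Sing_act (n - 1) n (coface i) x c = e (f (push i c))"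
          unfolding Ex2Sing_act_push[OF True] using ps(1) h by (simp add: x_def att_def)
        also have "\<dots> = y i (pull i (push i c))" using ef[OF h] w[OF ps(1) i ps(2)] by simp
        finally show ?thesis by (simp add: pull_push)
      next
        case False
        then show ?thesis using Ex2Sing_undefined[OF y[OF i] False] by (simp add: Ex2Sing_act_def)
      qed
    qed
  qed
qed

section \<open>Coding the vertices of the cell complex\<close>

text \<open>An injective pairing is folded over the list. The length is stored as well, since the
  fold is shown to separate only lists of equal length.\<close>

lemma inj_list_code:
  assumes "infinite (UNIV :: 'v set)"
  obtains code :: "'v list \<Rightarrow> 'v" where "inj code"
proof -
  obtain pr :: "'v \<times> 'v \<Rightarrow> 'v" where "bij_betw pr (UNIV \<times> UNIV) UNIV"
    using iffD2[OF card_of_ordIso card_of_Times_same_infinite[OF assms]] by blast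
  then have inj: "inj pr" using bij_betw_imp_inj_on by (simp add: UNIV_Times_UNIV)
  have pr: "pr (a, b) = pr (c, d) \<longleftrightarrow> a = c \<and> b = d" for a b c d
    by (simp add: inj_eq[OF inj])
  obtain nt :: "nat \<Rightarrow> 'v" where nt: "inj nt"
    using infinite_countable_subset[OF assms] by blast
  define cd where "cd = foldr (\<lambda>x a. pr (x, a))"
  have "xs = ys" if "length xs = length ys" "cd xs z = cd ys z" for xs ys z
    using that by (induction xs ys rule: list_induct2) (auto simp: cd_def pr)
  then have "inj (\<lambda>xs. pr (nt (length xs), cd xs undefined))"
    using nt by (intro injI) (auto simp: pr inj_eq)
  then show thesis by (rule that)
qed

definition listing :: "'x set \<Rightarrow> 'x list" where
  "listing A = (SOME xs. set xs = A)"

lemma set_listing: "finite A \<Longrightarrow> set (listing A) = A"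
  unfolding listing_def by (rule someI_ex) (rule finite_list)

definition sd2_index :: "nat \<Rightarrow> nat set set \<Rightarrow> nat" where
  "sd2_index n = (SOME h. inj_on h (sd2_verts n))"

lemma inj_sd2_index: "inj_on (sd2_index n) (sd2_verts n)"
  unfolding sd2_index_def
  by (rule someI_ex[where P = "\<lambda>h. inj_on h (sd2_verts n)"])
    (use finite_imp_inj_to_nat_seg[OF finite_sd2_verts, of n] in blast)

text \<open>\<open>cpx_cofibrant\<close> tests against complexes with vertices in
  \<open>'a + nat\<close>, so names are coded there. For vertices of \<open>cell_cpx K\<close>
  finitely many values suffice, \<open>f\<close> and \<open>g\<close> being undefined off finite
  sets; the tags \<open>Inr 0\<close> and \<open>Inr 1\<close> tell the constructors apart.\<close>

primrec vtx_code :: "(('a + nat) list \<Rightarrow> 'a + nat) \<Rightarrow> 'a vtx \<Rightarrow> 'a + nat" where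
  "vtx_code code (Base v \<sigma>) = code (Inr 0 # Inl v # map Inl (listing \<sigma>))"
| "vtx_code code (Cell n k f g c) = code (Inr 1 # Inr n # Inr k # Inr (sd2_index n c) #
     map (\<lambda>d. vtx_code code (f d)) (listing (sd2_horn n k)) @ map (\<lambda>d. Inl (g d)) (listing (sd2_verts n)))"

lemma cell_cpx_vertex:
  assumes "v \<in> verts (cell_cpx K)"
  shows "case v of Base a \<sigma> \<Rightarrow> \<sigma> \<in> K | Cell n k f g c \<Rightarrow> cell_ok K n k f g \<and> c \<in> sd2_verts n"
proof -
  obtain s where s: "s \<in> cell_cpx K" "v \<in> s" using assms by (auto simp: verts_def)
  show ?thesis
  proof (cases v)
    case (Base a \<sigma>)
    have "{v} \<in> (`) (\<lambda>p. Base (fst p) (snd p)) ` blow K"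
      by (rule cell_cpx_level0[OF s(1)]) (use s(2) Base in auto)
    then obtain t where "t \<in> blow K" "{v} = (\<lambda>p. Base (fst p) (snd p)) ` t" by blast
    then obtain p where "p \<in> t" "v = Base (fst p) (snd p)" by blast
    then show ?thesis using \<open>t \<in> blow K\<close> Base by (auto simp: blow_def)
  next
    case (Cell n k f g c)
    then show ?thesis
      using cell_cpx_top[OF s(1), of "{v}" n k f g c] s(2) by (auto simp: cchain_def)
  qed
qed

lemma inj_vtx_code:
  assumes K: "complex K" and code: "inj code"
  shows "inj_on (vtx_code code) (verts (cell_cpx K))"
proof -
  let ?V = "verts (cell_cpx K)"
  have "x = y" if "x \<in> ?V" "y \<in> ?V" "vtx_code code x = vtx_code code y" for x y
    using that
  proof (induction x arbitrary: y)
    case (Base v \<sigma>)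
    have s: "\<sigma> \<in> K" using cell_cpx_vertex[OF Base(1)] by simp
    obtain v' \<sigma>' where y: "y = Base v' \<sigma>'" using Base(3) code by (cases y) (auto simp: inj_eq)
    have s': "\<sigma>' \<in> K" using cell_cpx_vertex[OF Base(2)] y by simp
    have "v = v'" "map Inl (listing \<sigma>) = (map Inl (listing \<sigma>') :: ('a + nat) list)"
      using Base(3) code by (auto simp: y inj_eq)
    then have "set (listing \<sigma>) = set (listing \<sigma>')"
      by (metis (no_types, lifting) inj_Inl inj_map_eq_map)
    then show ?case
      using set_listing complex_finite[OF K s] complex_finite[OF K s'] \<open>v = v'\<close> y by metis
  next
    case (Cell n k f g c)
    have ok: "cell_ok K n k f g" "c \<in> sd2_verts n" using cell_cpx_vertex[OF Cell(2)] by auto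
    obtain n' k' f' g' c' where y: "y = Cell n' k' f' g' c'" using Cell(4) code by (cases y) (auto simp: inj_eq)
    have ok': "cell_ok K n' k' f' g'" "c' \<in> sd2_verts n'" using cell_cpx_vertex[OF Cell(3)] y by auto
    have eq: "n = n'" "k = k'" "sd2_index n c = sd2_index n' c'" and
      l: "map (\<lambda>d. vtx_code code (f d)) (listing (sd2_horn n k)) @ map (\<lambda>d. Inl (g d)) (listing (sd2_verts n)) =
          map (\<lambda>d. vtx_code code (f' d)) (listing (sd2_horn n k)) @ map (\<lambda>d. Inl (g' d)) (listing (sd2_verts n))"
      using Cell(4) code by (auto simp: y inj_eq)
    have "c = c'" using inj_onD[OF inj_sd2_index, of n c c'] eq ok ok' by simp
    \<comment> \<open>The appended lists split at the same position because \<open>n\<close> and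
      \<open>k\<close> already agree.\<close>
    have fe: "\<forall>d\<in>sd2_horn n k. vtx_code code (f d) = vtx_code code (f' d)" and ge: "\<forall>d\<in>sd2_verts n. g d = g' d"
      using l set_listing[OF finite_sd2_horn, of n k] set_listing[OF finite_sd2_verts, of n] by auto
    have "f d = f' d" for d
    proof (cases "d \<in> sd2_horn n k")
      case True
      then show ?thesis using Cell(1)[of "f d" "f' d"] fe ok(1) ok'(1) eq by (auto simp: cell_ok_def)
    next
      case False
      then show ?thesis using ok(1) ok'(1) eq by (simp add: cell_ok_def)
    qed
    moreover have "g d = g' d" for d
    proof (cases "d \<in> sd2_verts n")
      case False
      have "g \<in> Ex2Sing K n" "g' \<in> Ex2Sing K n" using ok(1) ok'(1) eq by (simp_all add: cell_ok_def)
      then show ?thesis using Ex2Sing_undefined[of g K n d] Ex2Sing_undefined[of g' K n d] False by simp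
    qed (use ge in blast)
    ultimately show ?case using y eq \<open>c = c'\<close> by auto
  qed
  then show ?thesis by (intro inj_onI) blast
qed

text \<open>The identity of \<open>K\<close> is lifted through the trivial fibration
  \<open>vproj\<close>, after both sides have been relabelled into \<open>'a + nat\<close>.\<close>

lemma cofibrant_section:
  fixes K :: "'a set set"
  assumes K: "complex K" and cof: "cpx_cofibrant K"
  obtains h where "cpx_map K (cell_cpx K) h" "\<And>v. v \<in> verts K \<Longrightarrow> vproj (h v) = v"
proof -
  let ?Q = "cell_cpx K"
  have "infinite (UNIV :: ('a + nat) set)" by simp
  then obtain code :: "('a + nat) list \<Rightarrow> 'a + nat" where code: "inj code"
    by (rule inj_list_code)
  let ?e = "vtx_code code"
  let ?d = "inv_into (verts ?Q) ?e"
  let ?E = "(`) ?e ` ?Q" and ?B = "(`) Inl ` K :: ('a + nat) set set"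
  define p where "p w = (Inl (vproj (?d w)) :: 'a + nat)" for w
  note Q = complex_cell_cpx[of K] and e = inj_vtx_code[OF K code]
  have E: "complex ?E" and B: "complex ?B" by (rule complex_image[OF Q] complex_image[OF K])+
  have pe: "p (?e v) = Inl (vproj v)" if "v \<in> verts ?Q" for v
    using inv_into_f_f[OF e that] by (simp add: p_def)
  have de: "?d ` ?e ` s = s" if "s \<in> ?Q" for s
  proof -
    have "s \<subseteq> verts ?Q" using that by (auto simp: verts_def)
    then show ?thesis using inv_into_f_f[OF e] by (force simp: image_image)
  qed
  have mp: "cpx_map ?E ?B p"
    unfolding cpx_map_def
  proof
    fix t assume "t \<in> ?E"
    then obtain s where s: "s \<in> ?Q" "t = ?e ` s" by blast
    have "p ` t = Inl ` vproj ` s"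
      unfolding s(2) image_image using s(1) pe by (intro image_cong refl) (auto simp: verts_def)
    then show "p ` t \<in> ?B" using vproj_cell_cpx[OF K s(1)] by simp
  qed
  have fib: "cpx_fib ?E ?B p" by (rule cell_cpx_fib[where e = ?e and b = Inl and p = p, OF e inj_Inl pe])
  have weq: "cpx_weq ?E ?B p"
  proof -
    have cp: "continuous_map (geo ?E) (geo ?B) (gmap p)" by (rule continuous_map_gmap[OF E B mp])
    have mv: "cpx_map ?Q K vproj" using vproj_cell_cpx[OF K] by (simp add: cpx_map_def)
    have cv: "continuous_map (geo ?Q) (geo K) (gmap vproj)" by (rule continuous_map_gmap[OF Q K mv])
    have iE: "hinverse (geo ?Q) (geo ?E) (gmap ?e) (gmap ?d)" by (rule hinverse_iso[OF Q e])
    have iB: "hinverse (geo K) (geo ?B) (gmap Inl) (gmap (inv_into (verts K) Inl))"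
      by (rule hinverse_iso[OF K]) simp
    have "weak_homotopy_equivalence (geo ?Q) (geo ?B) (gmap Inl \<circ> gmap vproj)"
      using whe_vproj[OF K] whe_comp_hinverse_left[OF iB cv] by blast
    moreover have "homotopic_with (\<lambda>_. True) (geo ?Q) (geo ?B) (gmap Inl \<circ> gmap vproj) (gmap p \<circ> gmap ?e)"
    proof (rule homotopic_with_equal)
      show "continuous_map (geo ?Q) (geo ?B) (gmap Inl \<circ> gmap vproj)"
        using iB by (intro continuous_map_compose[OF cv]) (simp add: hinverse_def)
      show "(gmap Inl \<circ> gmap vproj) x = (gmap p \<circ> gmap ?e) x" if x: "x \<in> topspace (geo ?Q)" for x
        using pe gsupp_verts[OF Q x]
        by (simp add: gmap_gmap[OF finite_gsupp_geo[OF Q x]]) (intro gmap_cong, auto)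
    qed auto
    ultimately have "weak_homotopy_equivalence (geo ?Q) (geo ?B) (gmap p \<circ> gmap ?e)"
      by (rule whe_homotopic)
    then show ?thesis
      using whe_comp_hinverse_right[OF iE cp] cpx_weq_iff_geo[OF E B mp] by blast
  qed
  have mB: "cpx_map K ?B Inl" by (simp add: cpx_map_def)
  obtain h where h: "cpx_map K ?E h" "\<forall>v\<in>verts K. p (h v) = Inl v"
    using cof E B mp fib weq mB unfolding cpx_cofibrant_def cpx_trivfib_def by blast
  show thesis
  proof
    show "cpx_map K ?Q (?d \<circ> h)"
      unfolding cpx_map_def
    proof
      fix s assume "s \<in> K"
      then have "h ` s \<in> ?E" using h(1) by (simp add: cpx_map_def)
      then obtain t where t: "t \<in> ?Q" "h ` s = ?e ` t" by blast
      show "(?d \<circ> h) ` s \<in> ?Q" unfolding image_comp[symmetric] t(2) de[OF t(1)] by (rule t(1))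
    qed
    show "vproj ((?d \<circ> h) v) = v" if "v \<in> verts K" for v
      using h(2) that by (simp add: p_def)
  qed
qed

section \<open>The unit at a cofibrant complex\<close>

lemma cpx_map_Cl_skel1:
  assumes X: "complex X" and Y: "complex Y" and f: "cpx_map X Y f"
  shows "cpx_map (Cl (skel1 X)) (Cl (skel1 Y)) f"
  unfolding cpx_map_def
proof
  fix s assume "s \<in> Cl (skel1 X)"
  then have s: "finite s" "s \<noteq> {}" "\<And>u v. u \<in> s \<Longrightarrow> v \<in> s \<Longrightarrow> {u, v} \<in> X"
    using in_Cl_skel1[OF X] by auto
  have "{f u, f v} \<in> Y" if "u \<in> s" "v \<in> s" for u v
    using f s(3)[OF that] by (force simp: cpx_map_def)
  then show "f ` s \<in> Cl (skel1 Y)" using s in_Cl_skel1[OF Y] by auto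
qed

text \<open>A retract of a homotopy equivalence is one, with an explicit inverse: if
  \<open>q\<close> is inverse to the inclusion of \<open>Q\<close> in its clique complex, then
  \<open>h\<close> followed by \<open>q\<close> and \<open>vproj\<close> is inverse to that of
  \<open>K\<close>, because \<open>h\<close> and \<open>vproj\<close> commute strictly with the two
  inclusions.\<close>

lemma cofibrant_Cl_skel1:
  fixes K :: "'a set set"
  assumes K: "complex K" and cof: "cpx_cofibrant K"
  obtains \<rho> where "hinverse (geo K) (geo (Cl (skel1 K))) id \<rho>"
proof -
  let ?Q = "cell_cpx K" and ?F = "Cl (skel1 K)"
  let ?C = "Cl (skel1 ?Q)" and ?A = "(`) (\<lambda>p. Base (fst p) (snd p)) ` blow K"
  note Q = complex_cell_cpx[of K]
  have F: "complex ?F" and C: "complex ?C" by (rule complex_Cl_skel1[OF K] complex_Cl_skel1[OF Q])+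
  obtain h where h: "cpx_map K ?Q h" "\<And>v. v \<in> verts K \<Longrightarrow> vproj (h v) = v"
    using cofibrant_section[OF K cof] by blast
  have mv: "cpx_map ?Q K vproj" using vproj_cell_cpx[OF K] by (simp add: cpx_map_def)
  have hF: "cpx_map ?F ?C h" and vF: "cpx_map ?C ?F vproj"
    by (rule cpx_map_Cl_skel1[OF K Q h(1)] cpx_map_Cl_skel1[OF Q K mv])+
  have ch: "continuous_map (geo K) (geo ?Q) (gmap h)" "continuous_map (geo ?F) (geo ?C) (gmap h)"
    by (rule continuous_map_gmap[OF K Q h(1)] continuous_map_gmap[OF F C hF])+
  have cv: "continuous_map (geo ?Q) (geo K) (gmap vproj)" "continuous_map (geo ?C) (geo ?F) (gmap vproj)"
    by (rule continuous_map_gmap[OF Q K mv] continuous_map_gmap[OF C F vF])+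
  have iK: "continuous_map (geo K) (geo ?F) id" and iQ: "continuous_map (geo ?Q) (geo ?C) id"
    using continuous_map_geo_mono[OF subset_Cl_skel1[OF K]] continuous_map_geo_mono[OF subset_Cl_skel1[OF Q]]
    by (simp_all add: id_def)
  obtain r where r: "hinverse (geo ?A) (geo ?Q) id r"
    using sdr_hinverse[OF sdr_cell_like[OF cell_like_cell_cpx]] .
  obtain q where q: "hinverse (geo ?A) (geo ?C) id q"
    using sdr_hinverse[OF sdr_cell_like[OF cell_like_Cl]] .
  \<comment> \<open>Two out of three: the inclusion of \<open>Q\<close> is homotopic to the
    retraction of \<open>Q\<close> onto the blow-up followed by the inclusion into the clique
    complex.\<close>
  have "hinverse (geo ?Q) (geo ?C) (id \<circ> r) (id \<circ> q)"
    by (rule hinverse_comp[OF hinverse_sym[OF r] q])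
  moreover have "homotopic_with (\<lambda>_. True) (geo ?Q) (geo ?C) (id \<circ> r) id"
    using homotopic_comp_left[OF _ iQ, of "geo ?Q" "id \<circ> r" id] r by (simp add: hinverse_def)
  ultimately have q': "hinverse (geo ?Q) (geo ?C) id q"
    using hinverse_homotopic[of "geo ?Q" "geo ?C" "id \<circ> r" "id \<circ> q" id] by simp
  have cq: "continuous_map (geo ?C) (geo ?Q) q" using q' by (simp add: hinverse_def)
  have vh: "gmap vproj (gmap h x) = x" if "gsupp x \<subseteq> verts K" "finite (gsupp x)" for x
    using that h(2) by (subst gmap_gmap[OF that(2)], subst gmap_id_on[OF that(2)]) auto
  have vertsF: "verts ?F \<subseteq> verts K" by (auto simp: Cl_def skel1_def verts_def)
  let ?\<rho> = "gmap vproj \<circ> (q \<circ> gmap h)"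
  have c\<rho>: "continuous_map (geo ?F) (geo K) ?\<rho>"
    by (intro continuous_map_compose[OF _ cv(1)] continuous_map_compose[OF ch(2) cq])
  have "homotopic_with (\<lambda>_. True) (geo K) (geo K) (gmap vproj \<circ> ((q \<circ> id) \<circ> gmap h)) (gmap vproj \<circ> (id \<circ> gmap h))"
    using q' by (intro homotopic_comp_left[OF _ cv(1)] homotopic_comp_right[OF _ ch(1)]) (simp add: hinverse_def)
  moreover have "homotopic_with (\<lambda>_. True) (geo K) (geo K) (gmap vproj \<circ> (id \<circ> gmap h)) id"
  proof (rule homotopic_with_equal)
    show "continuous_map (geo K) (geo K) (gmap vproj \<circ> (id \<circ> gmap h))"
      using continuous_map_compose[OF ch(1) cv(1)] by simp
    show "(gmap vproj \<circ> (id \<circ> gmap h)) x = id x" if x: "x \<in> topspace (geo K)" for x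
      using vh[OF gsupp_verts[OF K x] finite_gsupp_geo[OF K x]] by simp
  qed auto
  ultimately have 1: "homotopic_with (\<lambda>_. True) (geo K) (geo K) (?\<rho> \<circ> id) id"
    by (auto intro: homotopic_with_trans simp: o_assoc)
  have "homotopic_with (\<lambda>_. True) (geo ?F) (geo ?F) (gmap vproj \<circ> ((id \<circ> q) \<circ> gmap h)) (gmap vproj \<circ> (id \<circ> gmap h))"
    using q' by (intro homotopic_comp_left[OF _ cv(2)] homotopic_comp_right[OF _ ch(2)]) (simp add: hinverse_def)
  moreover have "homotopic_with (\<lambda>_. True) (geo ?F) (geo ?F) (gmap vproj \<circ> (id \<circ> gmap h)) id"
  proof (rule homotopic_with_equal)
    show "continuous_map (geo ?F) (geo ?F) (gmap vproj \<circ> (id \<circ> gmap h))"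
      using continuous_map_compose[OF ch(2) cv(2)] by simp
    show "(gmap vproj \<circ> (id \<circ> gmap h)) x = id x" if x: "x \<in> topspace (geo ?F)" for x
      using vh[OF subset_trans[OF gsupp_verts[OF F x] vertsF] finite_gsupp_geo[OF F x]] by simp
  qed auto
  ultimately have 2: "homotopic_with (\<lambda>_. True) (geo ?F) (geo ?F) (id \<circ> ?\<rho>) id"
    by (auto intro: homotopic_with_trans simp: o_assoc)
  have "hinverse (geo K) (geo ?F) id ?\<rho>" unfolding hinverse_def using iK c\<rho> 1 2 by blast
  then show thesis by (rule that)
qed

text \<open>The unit is the identity on vertices, so \<open>f\<close> and its adjunct are the same
  vertex function; they differ by precomposition with the equivalence of
  \<open>cofibrant_Cl_skel1\<close>.\<close>

lemma cpx_weq_Cl_skel1: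
  fixes K :: "'a set set" and G :: "'b set set"
  assumes K: "complex K" and cof: "cpx_cofibrant K" and G: "graph G" and f: "cpx_map (skel1 K) G f"
  shows "cpx_weq (Cl (skel1 K)) (Cl G) f \<longleftrightarrow> cpx_weq K (Cl G) f"
proof -
  let ?F = "Cl (skel1 K)"
  have cG: "complex G" and Gs: "skel1 G = G" using G by (auto simp: graph_def skel1_def)
  have CG: "complex (Cl G)" using complex_Cl_skel1[OF cG] Gs by simp
  have F: "complex ?F" by (rule complex_Cl_skel1[OF K])
  have mF: "cpx_map ?F (Cl G) f"
    unfolding cpx_map_def
  proof
    fix s assume "s \<in> ?F"
    then have s: "finite s" "s \<noteq> {}" "\<And>u v. u \<in> s \<Longrightarrow> v \<in> s \<Longrightarrow> {u, v} \<in> skel1 K"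
      by (auto simp: Cl_def)
    have "{f u, f v} \<in> G" if "u \<in> s" "v \<in> s" for u v
      using f s(3)[OF that] by (force simp: cpx_map_def)
    then show "f ` s \<in> Cl G" using s(1,2) in_Cl_skel1[OF cG, of "f ` s"] Gs by auto
  qed
  have mK: "cpx_map K (Cl G) f" using mF subset_Cl_skel1[OF K] by (auto simp: cpx_map_def)
  obtain \<rho> where \<rho>: "hinverse (geo K) (geo ?F) id \<rho>" using cofibrant_Cl_skel1[OF K cof] .
  show ?thesis
    unfolding cpx_weq_iff_geo[OF F CG mF] cpx_weq_iff_geo[OF K CG mK]
    using whe_comp_hinverse_right[OF \<rho> continuous_map_gmap[OF F CG mF]] by simp
qed

theorem theorem5p9:
  shows "(\<forall>(G :: 'b set set) (H :: 'b set set) f. graph G \<and> graph H \<and> cpx_map G H f \<longrightarrow>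
            (gr_fib G H f \<longrightarrow> cpx_fib (Cl G) (Cl H) f) \<and>
            (gr_fib G H f \<and> gr_weq G H f \<longrightarrow> cpx_trivfib (Cl G) (Cl H) f))
       \<and> (\<forall>(K :: 'a set set) (G :: 'b set set) f.
            complex K \<and> cpx_cofibrant K \<and> graph G \<and> gr_fibrant G \<and> cpx_map (skel1 K) G f \<longrightarrow>
            (gr_weq (skel1 K) G f \<longleftrightarrow> cpx_weq K (Cl G) f))"
  \<comment> \<open>The first half is definitional, as fibrations and weak equivalences of graphs
    are created by \<open>Cl\<close>.\<close>
  using cpx_weq_Cl_skel1 unfolding gr_weq_def gr_fib_def cpx_trivfib_def by blast

end
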